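(* Let $\mathcal{P}:|\mathcal{P}|\to\mathcal{E}$ be a totally connected tripos on a Boolean topos $\mathcal{E}$. Then $$j(m)\cong\neg\neg m\qquad\text{for any }A\in\mathcal{E}[\mathcal{P}]\text{ and }m\in\mathrm{sub}(\mathcal{E}[\mathcal{P}])_A,$$ where $j$ is the universal closure operation on $\mathrm{sub}(\mathcal{E}[\mathcal{P}])$ corresponding to the reflection $\Pi\dashv\Delta$.
   Context: A tripos on $\mathcal{E}$ is a fibration of preorders $\mathcal{P}:|\mathcal{P}|\to\mathcal{E}$ (fibers $\mathcal{P}_A$) such that all fibers are Heyting pre-algebras with structure preserved by reindexing; all reindexing functions have right adjoints satisfying the Beck–Chevalley condition; and there is a generic predicate $\mathsf{tr}\in\mathcal{P}_{\mathsf{Prop}}$, i.e. every $\varphi\in\mathcal{P}_A$ is isomorphic to $f^*\mathsf{tr}$ for some $f:A\to\mathsf{Prop}$. Existential quantification $\exists_u\dashv u^*$ is then definable. The tripos is regular (a pre-stack) if $e^*\varphi\le e^*\psi$ implies $\varphi\le\psi$ for every epimorphism $e$; it is then a fibered frame (a fibered preorder with reindexing-stable finite meets, existential quantification with Beck–Chevalley and Frobenius, and the pre-stack property). Let $\mathrm{sub}(\mathcal{E})$ be the subobject fibration; $\delta:\mathrm{sub}(\mathcal{E})\to\mathcal{P}$ sends $m:U\rightarrowtail A$ to $\exists_m\top$. A fibered frame (here: a regular tripos) is totally connected if $\delta$ has a finite meet preserving (fibered) left adjoint $\pi$. $\mathcal{E}[\mathcal{P}]$ is the topos whose objects are pairs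 $(C,\rho)$ with $C\in\mathcal{E}$, $\rho\in\mathcal{P}_{C\times C}$ symmetric and transitive in the internal logic, and whose morphisms $(C,\rho)\to(D,\sigma)$ are classes up to logical equivalence of $\phi\in\mathcal{P}_{C\times D}$ with $\phi(c,d)\vdash\rho(c,c)\wedge\sigma(d,d)$; $\phi(c,d),\rho(c,c'),\sigma(d,d')\vdash\phi(c',d')$; $\phi(c,d),\phi(c,d')\vdash\sigma(d,d')$; $\rho(c,c)\vdash\exists d.\phi(c,d)$; composition is relational. $\Delta:\mathcal{E}\to\mathcal{E}[\mathcal{P}]$ is the constant objects functor $I\mapsto(I,=)$, where equality is $\exists_{\mathrm{diag}}\top$. When $\mathcal{P}$ is totally connected, $\Delta$ has a finite limit preserving left adjoint $\Pi$ (obtained by applying $\pi$ to partial equivalence relations and functional relations and using $\mathcal{E}[\mathrm{sub}(\mathcal{E})]\simeq\mathcal{E}$), with invertible counit. The universal closure operation $j$ corresponding to the reflection: for a mono $m:U\rightarrowtail A$ in $\mathcal{E}[\mathcal{P}]$, $j(m)$ is the pullback of $\Delta\Pi m:\Delta\Pi U\rightarrowtail\Delta\Pi A$ along the unit $\eta_A:A\to\Delta\Pi A$. $\neg\neg$ is double (pseudo-complement) negation of subobjects. *)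

theory Defs
  imports Main
begin

section \<open>Categories, functors, adjunctions\<close>

text \<open>\<open>cmp C g f\<close> is the composite of \<open>g\<close> after \<open>f\<close>; it is only meaningful when
  \<open>src C g = tgt C f\<close>.\<close>

record ('o, 'a) cat =
  Obj :: "'o set"
  Arr :: "'a set"
  src :: "'a \<Rightarrow> 'o"
  tgt :: "'a \<Rightarrow> 'o"
  idt :: "'o \<Rightarrow> 'a"
  cmp :: "'a \<Rightarrow> 'a \<Rightarrow> 'a"

definition Hom :: "('o, 'a) cat \<Rightarrow> 'o \<Rightarrow> 'o \<Rightarrow> 'a set" where
  "Hom C A B = {f \<in> Arr C. src C f = A \<and> tgt C f = B}"

definition is_category :: "('o, 'a) cat \<Rightarrow> bool" where
  "is_category C \<longleftrightarrow>
     (\<forall>f\<in>Arr C. src C f \<in> Obj C \<and> tgt C f \<in> Obj C) \<and>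
     (\<forall>A\<in>Obj C. idt C A \<in> Hom C A A) \<and>
     (\<forall>f\<in>Arr C. \<forall>g\<in>Arr C. src C g = tgt C f \<longrightarrow> cmp C g f \<in> Hom C (src C f) (tgt C g)) \<and>
     (\<forall>f\<in>Arr C. cmp C f (idt C (src C f)) = f \<and> cmp C (idt C (tgt C f)) f = f) \<and>
     (\<forall>f\<in>Arr C. \<forall>g\<in>Arr C. \<forall>h\<in>Arr C. src C g = tgt C f \<longrightarrow> src C h = tgt C g \<longrightarrow>
        cmp C h (cmp C g f) = cmp C (cmp C h g) f)"

definition mono_arr :: "('o, 'a) cat \<Rightarrow> 'a \<Rightarrow> bool" where
  "mono_arr C m \<longleftrightarrow> m \<in> Arr C \<and>
     (\<forall>X\<in>Obj C. \<forall>f\<in>Hom C X (src C m). \<forall>g\<in>Hom C X (src C m). cmp C m f = cmp C m g \<longrightarrow> f = g)"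

definition epi_arr :: "('o, 'a) cat \<Rightarrow> 'a \<Rightarrow> bool" where
  "epi_arr C e \<longleftrightarrow> e \<in> Arr C \<and>
     (\<forall>X\<in>Obj C. \<forall>f\<in>Hom C (tgt C e) X. \<forall>g\<in>Hom C (tgt C e) X. cmp C f e = cmp C g e \<longrightarrow> f = g)"

record ('o1, 'a1, 'o2, 'a2) cfunctor =
  FOb :: "'o1 \<Rightarrow> 'o2"
  FAr :: "'a1 \<Rightarrow> 'a2"

definition is_functor ::
  "('o1, 'a1) cat \<Rightarrow> ('o2, 'a2) cat \<Rightarrow> ('o1, 'a1, 'o2, 'a2) cfunctor \<Rightarrow> bool" where
  "is_functor C D F \<longleftrightarrow>
     (\<forall>A\<in>Obj C. FOb F A \<in> Obj D) \<and>
     (\<forall>f\<in>Arr C. FAr F f \<in> Hom D (FOb F (src C f)) (FOb F (tgt C f))) \<and>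
     (\<forall>A\<in>Obj C. FAr F (idt C A) = idt D (FOb F A)) \<and>
     (\<forall>f\<in>Arr C. \<forall>g\<in>Arr C. src C g = tgt C f \<longrightarrow>
        FAr F (cmp C g f) = cmp D (FAr F g) (FAr F f))"

text \<open>\<open>L\<close> is left adjoint to \<open>R\<close> with unit \<open>\<eta>\<close>.\<close>

definition adjunction ::
  "('o1, 'a1) cat \<Rightarrow> ('o2, 'a2) cat \<Rightarrow> ('o1, 'a1, 'o2, 'a2) cfunctor \<Rightarrow>
   ('o2, 'a2, 'o1, 'a1) cfunctor \<Rightarrow> ('o1 \<Rightarrow> 'a1) \<Rightarrow> bool" where
  "adjunction C D L R \<eta> \<longleftrightarrow>
     is_functor C D L \<and> is_functor D C R \<and>
     (\<forall>X\<in>Obj C. \<eta> X \<in> Hom C X (FOb R (FOb L X))) \<and>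
     (\<forall>f\<in>Arr C. cmp C (FAr R (FAr L f)) (\<eta> (src C f)) = cmp C (\<eta> (tgt C f)) f) \<and>
     (\<forall>X\<in>Obj C. \<forall>Y\<in>Obj D. \<forall>f\<in>Hom C X (FOb R Y).
        \<exists>!g. g \<in> Hom D (FOb L X) Y \<and> cmp C (FAr R g) (\<eta> X) = f)"

section \<open>Finite limits and toposes\<close>

definition is_terminal :: "('o, 'a) cat \<Rightarrow> 'o \<Rightarrow> bool" where
  "is_terminal C T \<longleftrightarrow> T \<in> Obj C \<and> (\<forall>X\<in>Obj C. \<exists>!f. f \<in> Hom C X T)"

text \<open>\<open>is_pullback C f g p q\<close>: the square \<open>f \<circ> p = g \<circ> q\<close> is a pullback, so that \<open>p\<close> is a
  pullback of \<open>g\<close> along \<open>f\<close>.\<close>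

definition is_pullback :: "('o, 'a) cat \<Rightarrow> 'a \<Rightarrow> 'a \<Rightarrow> 'a \<Rightarrow> 'a \<Rightarrow> bool" where
  "is_pullback C f g p q \<longleftrightarrow>
     {f, g, p, q} \<subseteq> Arr C \<and> tgt C f = tgt C g \<and> src C p = src C q \<and>
     tgt C p = src C f \<and> tgt C q = src C g \<and> cmp C f p = cmp C g q \<and>
     (\<forall>Z\<in>Obj C. \<forall>a\<in>Hom C Z (src C f). \<forall>b\<in>Hom C Z (src C g). cmp C f a = cmp C g b \<longrightarrow>
        (\<exists>!h. h \<in> Hom C Z (src C p) \<and> cmp C p h = a \<and> cmp C q h = b))"

definition pullback_along :: "('o, 'a) cat \<Rightarrow> 'a \<Rightarrow> 'a \<Rightarrow> 'a" where
  "pullback_along C f g = (SOME p. \<exists>q. is_pullback C f g p q)"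

definition is_product :: "('o, 'a) cat \<Rightarrow> 'o \<Rightarrow> 'o \<Rightarrow> 'o \<times> 'a \<times> 'a \<Rightarrow> bool" where
  "is_product C A B = (\<lambda>(X, p, q). X \<in> Obj C \<and> p \<in> Hom C X A \<and> q \<in> Hom C X B \<and>
     (\<forall>Z\<in>Obj C. \<forall>f\<in>Hom C Z A. \<forall>g\<in>Hom C Z B.
        \<exists>!h. h \<in> Hom C Z X \<and> cmp C p h = f \<and> cmp C q h = g))"

text \<open>A choice of binary products, used to interpret contexts of several variables.\<close>

definition some_product :: "('o, 'a) cat \<Rightarrow> 'o \<Rightarrow> 'o \<Rightarrow> 'o \<times> 'a \<times> 'a" where
  "some_product C A B = (SOME x. is_product C A B x)"

definition prd :: "('o, 'a) cat \<Rightarrow> 'o \<Rightarrow> 'o \<Rightarrow> 'o" where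
  "prd C A B = fst (some_product C A B)"

definition pr1 :: "('o, 'a) cat \<Rightarrow> 'o \<Rightarrow> 'o \<Rightarrow> 'a" where
  "pr1 C A B = fst (snd (some_product C A B))"

definition pr2 :: "('o, 'a) cat \<Rightarrow> 'o \<Rightarrow> 'o \<Rightarrow> 'a" where
  "pr2 C A B = snd (snd (some_product C A B))"

definition tuple :: "('o, 'a) cat \<Rightarrow> 'a \<Rightarrow> 'a \<Rightarrow> 'a" where
  "tuple C f g = (THE h. h \<in> Hom C (src C f) (prd C (tgt C f) (tgt C g)) \<and>
     cmp C (pr1 C (tgt C f) (tgt C g)) h = f \<and> cmp C (pr2 C (tgt C f) (tgt C g)) h = g)"

definition has_finite_limits :: "('o, 'a) cat \<Rightarrow> bool" where
  "has_finite_limits C \<longleftrightarrow> (\<exists>T. is_terminal C T) \<and>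
     (\<forall>f\<in>Arr C. \<forall>g\<in>Arr C. tgt C f = tgt C g \<longrightarrow> (\<exists>p q. is_pullback C f g p q))"

definition has_exponentials :: "('o, 'a) cat \<Rightarrow> bool" where
  "has_exponentials C \<longleftrightarrow> (\<forall>A\<in>Obj C. \<forall>B\<in>Obj C. \<exists>X\<in>Obj C. \<exists>ev\<in>Hom C (prd C X A) B.
     \<forall>Z\<in>Obj C. \<forall>f\<in>Hom C (prd C Z A) B. \<exists>!g. g \<in> Hom C Z X \<and>
       cmp C ev (tuple C (cmp C g (pr1 C Z A)) (pr2 C Z A)) = f)"

definition has_subobject_classifier :: "('o, 'a) cat \<Rightarrow> bool" where
  "has_subobject_classifier C \<longleftrightarrow> (\<exists>T \<Omega> t. is_terminal C T \<and> t \<in> Hom C T \<Omega> \<and>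
     (\<forall>m. mono_arr C m \<longrightarrow>
        (\<exists>!\<chi>. \<chi> \<in> Hom C (tgt C m) \<Omega> \<and> (\<exists>u\<in>Hom C (src C m) T. is_pullback C \<chi> t m u))))"

definition topos :: "('o, 'a) cat \<Rightarrow> bool" where
  "topos C \<longleftrightarrow> is_category C \<and> has_finite_limits C \<and> has_exponentials C \<and>
     has_subobject_classifier C"

section \<open>Fibrations of preorders\<close>

text \<open>A functor \<open>Proj\<close> from a total category \<open>Tot\<close> to a base category \<open>Base\<close>.\<close>

record ('o, 'a, 'p, 'q) fib =
  Base :: "('o, 'a) cat"
  Tot :: "('p, 'q) cat"
  Proj :: "('p, 'q, 'o, 'a) cfunctor"

definition fibre :: "('o, 'a, 'p, 'q) fib \<Rightarrow> 'o \<Rightarrow> 'p set" where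
  "fibre F A = {x \<in> Obj (Tot F). FOb (Proj F) x = A}"

definition over :: "('o, 'a, 'p, 'q) fib \<Rightarrow> 'a \<Rightarrow> 'p \<Rightarrow> 'p \<Rightarrow> 'q set" where
  "over F f x y = {u \<in> Hom (Tot F) x y. FAr (Proj F) u = f}"

definition cartesian :: "('o, 'a, 'p, 'q) fib \<Rightarrow> 'q \<Rightarrow> bool" where
  "cartesian F u \<longleftrightarrow> u \<in> Arr (Tot F) \<and>
     (\<forall>v\<in>Arr (Tot F). \<forall>h.
        tgt (Tot F) v = tgt (Tot F) u \<longrightarrow>
        h \<in> Hom (Base F) (FOb (Proj F) (src (Tot F) v)) (FOb (Proj F) (src (Tot F) u)) \<longrightarrow>
        FAr (Proj F) v = cmp (Base F) (FAr (Proj F) u) h \<longrightarrow>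
        (\<exists>!w. w \<in> over F h (src (Tot F) v) (src (Tot F) u) \<and> cmp (Tot F) u w = v))"

definition is_fibration :: "('o, 'a, 'p, 'q) fib \<Rightarrow> bool" where
  "is_fibration F \<longleftrightarrow> is_category (Base F) \<and> is_category (Tot F) \<and>
     is_functor (Tot F) (Base F) (Proj F) \<and>
     (\<forall>f\<in>Arr (Base F). \<forall>y\<in>fibre F (tgt (Base F) f).
        \<exists>u. cartesian F u \<and> tgt (Tot F) u = y \<and> FAr (Proj F) u = f)"

text \<open>The fibres are preorders: there is at most one vertical arrow between two objects.\<close>

definition fibration_of_preorders :: "('o, 'a, 'p, 'q) fib \<Rightarrow> bool" where
  "fibration_of_preorders F \<longleftrightarrow> is_fibration F \<and>
     (\<forall>A\<in>Obj (Base F). \<forall>x\<in>fibre F A. \<forall>y\<in>fibre F A.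
        \<forall>u\<in>over F (idt (Base F) A) x y. \<forall>v\<in>over F (idt (Base F) A) x y. u = v)"

definition le :: "('o, 'a, 'p, 'q) fib \<Rightarrow> 'o \<Rightarrow> 'p \<Rightarrow> 'p \<Rightarrow> bool" where
  "le F A x y \<longleftrightarrow> x \<in> fibre F A \<and> y \<in> fibre F A \<and> over F (idt (Base F) A) x y \<noteq> {}"

definition fib_iso :: "('o, 'a, 'p, 'q) fib \<Rightarrow> 'o \<Rightarrow> 'p \<Rightarrow> 'p \<Rightarrow> bool" where
  "fib_iso F A x y \<longleftrightarrow> le F A x y \<and> le F A y x"

definition reindex :: "('o, 'a, 'p, 'q) fib \<Rightarrow> 'a \<Rightarrow> 'p \<Rightarrow> 'p" where
  "reindex F f y =
     src (Tot F) (SOME u. cartesian F u \<and> tgt (Tot F) u = y \<and> FAr (Proj F) u = f)"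

subsection \<open>Heyting structure and quantifiers\<close>

definition is_top :: "('o, 'a, 'p, 'q) fib \<Rightarrow> 'o \<Rightarrow> 'p \<Rightarrow> bool" where
  "is_top F A t \<longleftrightarrow> t \<in> fibre F A \<and> (\<forall>x\<in>fibre F A. le F A x t)"

definition is_bot :: "('o, 'a, 'p, 'q) fib \<Rightarrow> 'o \<Rightarrow> 'p \<Rightarrow> bool" where
  "is_bot F A b \<longleftrightarrow> b \<in> fibre F A \<and> (\<forall>x\<in>fibre F A. le F A b x)"

definition is_meet :: "('o, 'a, 'p, 'q) fib \<Rightarrow> 'o \<Rightarrow> 'p \<Rightarrow> 'p \<Rightarrow> 'p \<Rightarrow> bool" where
  "is_meet F A x y z \<longleftrightarrow> le F A z x \<and> le F A z y \<and>
     (\<forall>w\<in>fibre F A. le F A w x \<longrightarrow> le F A w y \<longrightarrow> le F A w z)"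

definition is_join :: "('o, 'a, 'p, 'q) fib \<Rightarrow> 'o \<Rightarrow> 'p \<Rightarrow> 'p \<Rightarrow> 'p \<Rightarrow> bool" where
  "is_join F A x y z \<longleftrightarrow> le F A x z \<and> le F A y z \<and>
     (\<forall>w\<in>fibre F A. le F A x w \<longrightarrow> le F A y w \<longrightarrow> le F A z w)"

text \<open>\<open>z\<close> is the Heyting implication \<open>x \<Rightarrow> y\<close>; \<open>v\<close> ranges over the meets of \<open>w\<close> and \<open>x\<close>, which
  are all isomorphic.\<close>

definition is_imp :: "('o, 'a, 'p, 'q) fib \<Rightarrow> 'o \<Rightarrow> 'p \<Rightarrow> 'p \<Rightarrow> 'p \<Rightarrow> bool" where
  "is_imp F A x y z \<longleftrightarrow> z \<in> fibre F A \<and>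
     (\<forall>w\<in>fibre F A. \<forall>v. is_meet F A w x v \<longrightarrow> (le F A w z \<longleftrightarrow> le F A v y))"

definition top_of :: "('o, 'a, 'p, 'q) fib \<Rightarrow> 'o \<Rightarrow> 'p" where
  "top_of F A = (SOME t. is_top F A t)"

definition bot_of :: "('o, 'a, 'p, 'q) fib \<Rightarrow> 'o \<Rightarrow> 'p" where
  "bot_of F A = (SOME b. is_bot F A b)"

definition meet :: "('o, 'a, 'p, 'q) fib \<Rightarrow> 'o \<Rightarrow> 'p \<Rightarrow> 'p \<Rightarrow> 'p" where
  "meet F A x y = (SOME z. is_meet F A x y z)"

definition imp :: "('o, 'a, 'p, 'q) fib \<Rightarrow> 'o \<Rightarrow> 'p \<Rightarrow> 'p \<Rightarrow> 'p" where
  "imp F A x y = (SOME z. is_imp F A x y z)"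

definition neg :: "('o, 'a, 'p, 'q) fib \<Rightarrow> 'o \<Rightarrow> 'p \<Rightarrow> 'p" where
  "neg F A x = imp F A x (bot_of F A)"

definition heyting_fibre :: "('o, 'a, 'p, 'q) fib \<Rightarrow> 'o \<Rightarrow> bool" where
  "heyting_fibre F A \<longleftrightarrow> (\<exists>t. is_top F A t) \<and> (\<exists>b. is_bot F A b) \<and>
     (\<forall>x\<in>fibre F A. \<forall>y\<in>fibre F A.
        (\<exists>z. is_meet F A x y z) \<and> (\<exists>z. is_join F A x y z) \<and> (\<exists>z. is_imp F A x y z))"

definition reindexing_preserves_heyting :: "('o, 'a, 'p, 'q) fib \<Rightarrow> bool" where
  "reindexing_preserves_heyting F \<longleftrightarrow>
     (\<forall>A B. \<forall>f\<in>Hom (Base F) A B.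
        (\<forall>t. is_top F B t \<longrightarrow> is_top F A (reindex F f t)) \<and>
        (\<forall>b. is_bot F B b \<longrightarrow> is_bot F A (reindex F f b)) \<and>
        (\<forall>x\<in>fibre F B. \<forall>y\<in>fibre F B. \<forall>z.
           (is_meet F B x y z \<longrightarrow> is_meet F A (reindex F f x) (reindex F f y) (reindex F f z)) \<and>
           (is_join F B x y z \<longrightarrow> is_join F A (reindex F f x) (reindex F f y) (reindex F f z)) \<and>
           (is_imp F B x y z \<longrightarrow> is_imp F A (reindex F f x) (reindex F f y) (reindex F f z))))"

definition is_forall :: "('o, 'a, 'p, 'q) fib \<Rightarrow> 'a \<Rightarrow> 'p \<Rightarrow> 'p \<Rightarrow> bool" where
  "is_forall F u \<phi> \<psi> \<longleftrightarrow> \<psi> \<in> fibre F (tgt (Base F) u) \<and>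
     (\<forall>\<chi>\<in>fibre F (tgt (Base F) u).
        le F (tgt (Base F) u) \<chi> \<psi> \<longleftrightarrow> le F (src (Base F) u) (reindex F u \<chi>) \<phi>)"

definition is_exists :: "('o, 'a, 'p, 'q) fib \<Rightarrow> 'a \<Rightarrow> 'p \<Rightarrow> 'p \<Rightarrow> bool" where
  "is_exists F u \<phi> \<psi> \<longleftrightarrow> \<psi> \<in> fibre F (tgt (Base F) u) \<and>
     (\<forall>\<chi>\<in>fibre F (tgt (Base F) u).
        le F (tgt (Base F) u) \<psi> \<chi> \<longleftrightarrow> le F (src (Base F) u) \<phi> (reindex F u \<chi>))"

definition ex :: "('o, 'a, 'p, 'q) fib \<Rightarrow> 'a \<Rightarrow> 'p \<Rightarrow> 'p" where
  "ex F u \<phi> = (SOME \<psi>. is_exists F u \<phi> \<psi>)"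

subsection \<open>Triposes\<close>

definition has_forall_beck_chevalley :: "('o, 'a, 'p, 'q) fib \<Rightarrow> bool" where
  "has_forall_beck_chevalley F \<longleftrightarrow>
     (\<forall>u\<in>Arr (Base F). \<forall>\<phi>\<in>fibre F (src (Base F) u). \<exists>\<psi>. is_forall F u \<phi> \<psi>) \<and>
     (\<forall>f g p q. is_pullback (Base F) f g p q \<longrightarrow>
        (\<forall>\<phi>\<in>fibre F (src (Base F) f). \<forall>\<psi>.
           is_forall F f \<phi> \<psi> \<longrightarrow> is_forall F q (reindex F p \<phi>) (reindex F g \<psi>)))"

definition has_generic_predicate :: "('o, 'a, 'p, 'q) fib \<Rightarrow> bool" where
  "has_generic_predicate F \<longleftrightarrow> (\<exists>Prp\<in>Obj (Base F). \<exists>tr\<in>fibre F Prp.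
     \<forall>A\<in>Obj (Base F). \<forall>\<phi>\<in>fibre F A. \<exists>f\<in>Hom (Base F) A Prp. fib_iso F A \<phi> (reindex F f tr))"

definition tripos :: "('o, 'a, 'p, 'q) fib \<Rightarrow> bool" where
  "tripos P \<longleftrightarrow> fibration_of_preorders P \<and>
     (\<forall>A\<in>Obj (Base P). heyting_fibre P A) \<and> reindexing_preserves_heyting P \<and>
     has_forall_beck_chevalley P \<and> has_generic_predicate P"

definition pre_stack :: "('o, 'a, 'p, 'q) fib \<Rightarrow> bool" where
  "pre_stack F \<longleftrightarrow> (\<forall>e. epi_arr (Base F) e \<longrightarrow>
     (\<forall>\<phi>\<in>fibre F (tgt (Base F) e). \<forall>\<psi>\<in>fibre F (tgt (Base F) e).
        le F (src (Base F) e) (reindex F e \<phi>) (reindex F e \<psi>) \<longrightarrow> le F (tgt (Base F) e) \<phi> \<psi>))"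

definition regular_tripos :: "('o, 'a, 'p, 'q) fib \<Rightarrow> bool" where
  "regular_tripos P \<longleftrightarrow> tripos P \<and> pre_stack P"

section \<open>The subobject fibration\<close>

text \<open>Subobjects are represented by monomorphisms. An arrow of the total category from \<open>m\<close> to \<open>n\<close>
  over \<open>f\<close> is the triple \<open>(m, f, n)\<close>, present iff \<open>f \<circ> m\<close> factors through \<open>n\<close>.\<close>

definition sub_tot :: "('o, 'a) cat \<Rightarrow> ('a, 'a \<times> 'a \<times> 'a) cat" where
  "sub_tot C = \<lparr>
     Obj = {m. mono_arr C m},
     Arr = {(m, f, n). mono_arr C m \<and> mono_arr C n \<and> f \<in> Hom C (tgt C m) (tgt C n) \<and>
              (\<exists>g\<in>Hom C (src C m) (src C n). cmp C n g = cmp C f m)},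
     src = (\<lambda>(m, f, n). m),
     tgt = (\<lambda>(m, f, n). n),
     idt = (\<lambda>m. (m, idt C (tgt C m), m)),
     cmp = (\<lambda>(m2, g, n2) (m1, f, n1). (m1, cmp C g f, n2)) \<rparr>"

definition sub :: "('o, 'a) cat \<Rightarrow> ('o, 'a, 'a, 'a \<times> 'a \<times> 'a) fib" where
  "sub C = \<lparr> Base = C, Tot = sub_tot C, Proj = \<lparr> FOb = tgt C, FAr = (\<lambda>(m, f, n). f) \<rparr> \<rparr>"

text \<open>A topos is Boolean if all its subobject lattices are, i.e. every subobject has a
  complement.\<close>

definition boolean_topos :: "('o, 'a) cat \<Rightarrow> bool" where
  "boolean_topos C \<longleftrightarrow> topos C \<and>
     (\<forall>A\<in>Obj C. \<forall>m\<in>fibre (sub C) A. \<exists>n b t.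
        is_bot (sub C) A b \<and> is_meet (sub C) A m n b \<and>
        is_top (sub C) A t \<and> is_join (sub C) A m n t)"

section \<open>Total connectedness\<close>

definition delta :: "('o, 'a, 'p, 'q) fib \<Rightarrow> 'a \<Rightarrow> 'p" where
  "delta P m = ex P m (top_of P (src (Base P) m))"

text \<open>The fibres being preorders, a fibred functor is determined by its action on objects, and it
  is a monotone map on each fibre that commutes with reindexing up to isomorphism. Monotonicity
  of \<open>\<pi>\<close> follows from the fibrewise adjunction.\<close>

definition totally_connected :: "('o, 'a, 'p, 'q) fib \<Rightarrow> bool" where
  "totally_connected P \<longleftrightarrow> (\<exists>\<pi>.
     (\<forall>A\<in>Obj (Base P). \<forall>\<phi>\<in>fibre P A. \<pi> \<phi> \<in> fibre (sub (Base P)) A \<and>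
        (\<forall>m\<in>fibre (sub (Base P)) A.
           le (sub (Base P)) A (\<pi> \<phi>) m \<longleftrightarrow> le P A \<phi> (delta P m))) \<and>
     (\<forall>A B. \<forall>f\<in>Hom (Base P) A B. \<forall>\<phi>\<in>fibre P B.
        fib_iso (sub (Base P)) A (\<pi> (reindex P f \<phi>)) (reindex (sub (Base P)) f (\<pi> \<phi>))) \<and>
     (\<forall>A\<in>Obj (Base P).
        (\<forall>t. is_top P A t \<longrightarrow> is_top (sub (Base P)) A (\<pi> t)) \<and>
        (\<forall>\<phi>\<in>fibre P A. \<forall>\<psi>\<in>fibre P A. \<forall>\<chi>.
           is_meet P A \<phi> \<psi> \<chi> \<longrightarrow> is_meet (sub (Base P)) A (\<pi> \<phi>) (\<pi> \<psi>) (\<pi> \<chi>))))"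

definition totally_connected_tripos :: "('o, 'a, 'p, 'q) fib \<Rightarrow> bool" where
  "totally_connected_tripos P \<longleftrightarrow> regular_tripos P \<and> totally_connected P"

section \<open>The topos of partial equivalence relations\<close>

text \<open>\<open>rel P \<phi> t u\<close> is the predicate \<open>\<phi>(t, u)\<close> for terms \<open>t\<close> and \<open>u\<close> with common context, a term
  being an arrow of the base from the context to its type.\<close>

definition rel :: "('o, 'a, 'p, 'q) fib \<Rightarrow> 'p \<Rightarrow> 'a \<Rightarrow> 'a \<Rightarrow> 'p" where
  "rel P \<phi> t u = reindex P (tuple (Base P) t u) \<phi>"

definition is_symmetric :: "('o, 'a, 'p, 'q) fib \<Rightarrow> 'o \<Rightarrow> 'p \<Rightarrow> bool" where
  "is_symmetric P C \<rho> \<longleftrightarrow>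
     (let E = Base P; c = pr1 E C C; c' = pr2 E C C
      in le P (prd E C C) (rel P \<rho> c c') (rel P \<rho> c' c))"

definition is_transitive :: "('o, 'a, 'p, 'q) fib \<Rightarrow> 'o \<Rightarrow> 'p \<Rightarrow> bool" where
  "is_transitive P C \<rho> \<longleftrightarrow>
     (let E = Base P; D = prd E C C; \<Gamma> = prd E D C;
          c = cmp E (pr1 E C C) (pr1 E D C);
          c' = cmp E (pr2 E C C) (pr1 E D C);
          c'' = pr2 E D C
      in le P \<Gamma> (meet P \<Gamma> (rel P \<rho> c c') (rel P \<rho> c' c'')) (rel P \<rho> c c''))"

definition is_per :: "('o, 'a, 'p, 'q) fib \<Rightarrow> 'o \<times> 'p \<Rightarrow> bool" where
  "is_per P = (\<lambda>(C, \<rho>). C \<in> Obj (Base P) \<and> \<rho> \<in> fibre P (prd (Base P) C C) \<and>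
     is_symmetric P C \<rho> \<and> is_transitive P C \<rho>)"

text \<open>The conjuncts say \<open>\<phi>(c, d) \<turnstile> \<rho>(c, c) \<and> \<sigma>(d, d)\<close>;
  \<open>\<phi>(c, d), \<rho>(c, c'), \<sigma>(d, d') \<turnstile> \<phi>(c', d')\<close>; \<open>\<phi>(c, d), \<phi>(c, d') \<turnstile> \<sigma>(d, d')\<close>;
  \<open>\<rho>(c, c) \<turnstile> \<exists>d. \<phi>(c, d)\<close>.\<close>

definition functional_relation ::
  "('o, 'a, 'p, 'q) fib \<Rightarrow> 'o \<times> 'p \<Rightarrow> 'o \<times> 'p \<Rightarrow> 'p \<Rightarrow> bool" where
  "functional_relation P = (\<lambda>(C, \<rho>) (D, \<sigma>) \<phi>. let E = Base P; CD = prd E C D in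
     \<phi> \<in> fibre P CD \<and>
     (let c = pr1 E C D; d = pr2 E C D
      in le P CD (rel P \<phi> c d) (meet P CD (rel P \<rho> c c) (rel P \<sigma> d d))) \<and>
     (let \<Gamma> = prd E CD CD;
          c = cmp E (pr1 E C D) (pr1 E CD CD); d = cmp E (pr2 E C D) (pr1 E CD CD);
          c' = cmp E (pr1 E C D) (pr2 E CD CD); d' = cmp E (pr2 E C D) (pr2 E CD CD)
      in le P \<Gamma> (meet P \<Gamma> (meet P \<Gamma> (rel P \<phi> c d) (rel P \<rho> c c')) (rel P \<sigma> d d'))
           (rel P \<phi> c' d')) \<and>
     (let \<Gamma> = prd E CD D;
          c = cmp E (pr1 E C D) (pr1 E CD D); d = cmp E (pr2 E C D) (pr1 E CD D);
          d' = pr2 E CD D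
      in le P \<Gamma> (meet P \<Gamma> (rel P \<phi> c d) (rel P \<phi> c d')) (rel P \<sigma> d d')) \<and>
     (let c = idt E C in le P C (rel P \<rho> c c) (ex P (pr1 E C D) \<phi>)))"

text \<open>The class of predicates logically equivalent to \<open>\<phi>\<close>.\<close>

definition eqclass :: "('o, 'a, 'p, 'q) fib \<Rightarrow> 'o \<Rightarrow> 'p \<Rightarrow> 'p set" where
  "eqclass P A \<phi> = {\<phi>'. fib_iso P A \<phi> \<phi>'}"

text \<open>\<open>\<exists>d. \<phi>(c, d) \<and> \<psi>(d, k)\<close>, a predicate in the context \<open>c : C, k : K\<close>.\<close>

definition rel_comp ::
  "('o, 'a, 'p, 'q) fib \<Rightarrow> 'o \<Rightarrow> 'o \<Rightarrow> 'o \<Rightarrow> 'p \<Rightarrow> 'p \<Rightarrow> 'p" where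
  "rel_comp P C D K \<psi> \<phi> =
     (let E = Base P; CD = prd E C D; \<Gamma> = prd E CD K;
          c = cmp E (pr1 E C D) (pr1 E CD K); d = cmp E (pr2 E C D) (pr1 E CD K);
          k = pr2 E CD K
      in ex P (tuple E c k) (meet P \<Gamma> (rel P \<phi> c d) (rel P \<psi> d k)))"

text \<open>The category \<open>\<E>[\<P>]\<close>. An arrow is a triple of source, target and equivalence class.\<close>

definition tripos_to_topos ::
  "('o, 'a, 'p, 'q) fib \<Rightarrow> ('o \<times> 'p, ('o \<times> 'p) \<times> ('o \<times> 'p) \<times> 'p set) cat" where
  "tripos_to_topos P = \<lparr>
     Obj = {X. is_per P X},
     Arr = {(X, Y, eqclass P (prd (Base P) (fst X) (fst Y)) \<phi>) | X Y \<phi>.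
              is_per P X \<and> is_per P Y \<and> functional_relation P X Y \<phi>},
     src = (\<lambda>(X, Y, \<Phi>). X),
     tgt = (\<lambda>(X, Y, \<Phi>). Y),
     idt = (\<lambda>X. (X, X, eqclass P (prd (Base P) (fst X) (fst X)) (snd X))),
     cmp = (\<lambda>(Y', Z, \<Psi>) (X, Y, \<Phi>). (X, Z,
              \<Union>\<phi>\<in>\<Phi>. \<Union>\<psi>\<in>\<Psi>. eqclass P (prd (Base P) (fst X) (fst Z))
                                 (rel_comp P (fst X) (fst Y) (fst Z) \<psi> \<phi>))) \<rparr>"

definition equality :: "('o, 'a, 'p, 'q) fib \<Rightarrow> 'o \<Rightarrow> 'p" where
  "equality P I = ex P (tuple (Base P) (idt (Base P) I) (idt (Base P) I)) (top_of P I)"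

text \<open>The constant objects functor, sending \<open>f : I \<rightarrow> J\<close> to the class of the predicate
  \<open>f(i) = j\<close>.\<close>

definition const_obj :: "('o, 'a, 'p, 'q) fib \<Rightarrow> 'o \<Rightarrow> 'o \<times> 'p" where
  "const_obj P I = (I, equality P I)"

definition const_arr ::
  "('o, 'a, 'p, 'q) fib \<Rightarrow> 'a \<Rightarrow> ('o \<times> 'p) \<times> ('o \<times> 'p) \<times> 'p set" where
  "const_arr P f = (let E = Base P; I = src E f; J = tgt E f in
     (const_obj P I, const_obj P J,
      eqclass P (prd E I J) (rel P (equality P J) (cmp E f (pr1 E I J)) (pr2 E I J))))"

definition constant_objects ::
  "('o, 'a, 'p, 'q) fib \<Rightarrow>
   ('o, 'a, 'o \<times> 'p, ('o \<times> 'p) \<times> ('o \<times> 'p) \<times> 'p set) cfunctor" where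
  "constant_objects P = \<lparr> FOb = const_obj P, FAr = const_arr P \<rparr>"

section \<open>The closure operation of a reflection\<close>

text \<open>For \<open>L\<close> left adjoint to \<open>R\<close> with unit \<open>\<eta>\<close>: the pullback of \<open>R L m\<close> along the unit at the
  codomain of \<open>m\<close>.\<close>

definition closure_op ::
  "('o1, 'a1) cat \<Rightarrow> ('o1, 'a1, 'o2, 'a2) cfunctor \<Rightarrow> ('o2, 'a2, 'o1, 'a1) cfunctor \<Rightarrow>
   ('o1 \<Rightarrow> 'a1) \<Rightarrow> 'a1 \<Rightarrow> 'a1" where
  "closure_op C L R \<eta> m = pullback_along C (\<eta> (tgt C m)) (FAr R (FAr L m))"

end

theory Submission
  imports Defs
begin

text \<open>
  Subobjects of \<open>A = (C, \<rho>)\<close> in \<open>\<E>[\<P>]\<close> are the strict, \<open>\<rho>\<close>-extensional predicates on \<open>C\<close>.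
  Let \<open>J = \<delta> \<circ> \<pi>\<close>, a closure operator on \<open>\<P>\<close> that commutes with reindexing and finite meets, and
  let \<open>n = \<Pi> m\<close>. The unit \<open>\<eta>\<close> is surjective up to \<open>J\<close> and its kernel at \<open>(C, \<rho>)\<close> lies in \<open>J \<rho>\<close>;
  both follow from its universal property. Consequently \<open>n\<close> is monic and \<open>j(m)\<close>, which is the
  predicate \<open>\<exists>i. \<eta>(c, i) \<and> \<delta> n (i)\<close>, is contained in \<open>J(m)\<close>.

  As \<open>J \<bottom> = \<bottom>\<close>, the predicate \<open>J(m)\<close> is disjoint from \<open>\<not> m\<close>, so \<open>j(m) \<le> \<not>\<not> m\<close>. Conversely,
  over a Boolean base every \<open>J\<close>-closed predicate, in particular \<open>\<delta> n\<close>, is stable under double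
  negation, so \<open>\<not>\<not> m \<le> j(m)\<close>.
\<close>

section \<open>Categories with finite limits\<close>


text \<open>The functor \<open>\<Pi>\<close> is an arbitrary left adjoint of the constant objects
  functor, not the one built from \<open>\<pi>\<close>, so \<open>\<eta>\<close> is known only
  through naturality and its universal property. The link with \<open>\<pi>\<close> is made by maps
  into well-chosen constant objects: the domain of \<open>\<pi>\<close> of the image of
  \<open>\<eta>\<close>, and a power object of the carrier.

  What makes properties that hold only up to \<open>J\<close> usable is that the goals that matter
  are closed: equality on a constant object, \<open>\<delta>\<close> of a subobject,
  \<open>\<bottom>\<close>. Since \<open>\<pi>\<close> preserves binary meets, a hypothesis
  \<open>J \<psi>\<close> may be replaced by \<open>\<psi>\<close> while proving a closed goal, as
  with a modality.

  A second obstacle is that an existential statement of the internal logic seldom has a witness at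
  the stage where it holds. Witnesses live on covers: a stage \<open>\<theta>'\<close> over
  \<open>\<theta>\<close> is a cover if whatever holds after restriction to \<open>\<theta>'\<close>
  already holds at \<open>\<theta>\<close>. Every existential hypothesis is opened by passing to a
  cover, and every goal is brought back by descent.\<close>

lemma Hom_src: "f \<in> Hom C A B \<Longrightarrow> src C f = A"
  and Hom_tgt: "f \<in> Hom C A B \<Longrightarrow> tgt C f = B"
  and Hom_Arr: "f \<in> Hom C A B \<Longrightarrow> f \<in> Arr C"
  by (simp_all add: Hom_def)

lemma Arr_Hom: "f \<in> Arr C \<Longrightarrow> f \<in> Hom C (src C f) (tgt C f)"
  by (simp add: Hom_def)

locale category =
  fixes C :: "('o, 'a) cat"
  assumes category: "is_category C"
begin

lemma Hom_Obj: "f \<in> Hom C A B \<Longrightarrow> A \<in> Obj C" "f \<in> Hom C A B \<Longrightarrow> B \<in> Obj C"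
  using category by (auto simp: is_category_def Hom_def)

lemma id_hom: "A \<in> Obj C \<Longrightarrow> idt C A \<in> Hom C A A"
  using category by (auto simp: is_category_def)

lemma comp_hom: "g \<in> Hom C B D \<Longrightarrow> f \<in> Hom C A B \<Longrightarrow> cmp C g f \<in> Hom C A D"
  using category unfolding is_category_def Hom_def by auto

lemma comp_id: "f \<in> Hom C A B \<Longrightarrow> cmp C f (idt C A) = f"
  and id_comp: "f \<in> Hom C A B \<Longrightarrow> cmp C (idt C B) f = f"
  using category unfolding is_category_def Hom_def by auto

lemma assoc:
  "h \<in> Hom C B' D \<Longrightarrow> g \<in> Hom C B B' \<Longrightarrow> f \<in> Hom C A B \<Longrightarrow>
   cmp C h (cmp C g f) = cmp C (cmp C h g) f"
  using category unfolding is_category_def Hom_def by auto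

lemma mono_arrD:
  assumes "mono_arr C m" "m \<in> Hom C A B" "f \<in> Hom C X A" "g \<in> Hom C X A" "cmp C m f = cmp C m g"
  shows "f = g"
  using assms Hom_Obj(1)[OF assms(3)] by (auto simp: mono_arr_def Hom_src)

lemma pullback_Hom:
  assumes "is_pullback C f g p q" "f \<in> Hom C A D" "g \<in> Hom C B D"
  shows "p \<in> Hom C (src C p) A" "q \<in> Hom C (src C p) B" "cmp C f p = cmp C g q"
  using assms by (auto simp: is_pullback_def Hom_def)

lemma pullback_ex1:
  assumes "is_pullback C f g p q" "f \<in> Hom C A D" "g \<in> Hom C B D"
    and "a \<in> Hom C Z A" "b \<in> Hom C Z B" "cmp C f a = cmp C g b"
  shows "\<exists>!h. h \<in> Hom C Z (src C p) \<and> cmp C p h = a \<and> cmp C q h = b"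
proof -
  have "\<forall>Z\<in>Obj C. \<forall>a\<in>Hom C Z (src C f). \<forall>b\<in>Hom C Z (src C g). cmp C f a = cmp C g b \<longrightarrow>
        (\<exists>!h. h \<in> Hom C Z (src C p) \<and> cmp C p h = a \<and> cmp C q h = b)"
    using assms(1) unfolding is_pullback_def by blast
  moreover have "a \<in> Hom C Z (src C f)" "b \<in> Hom C Z (src C g)" "Z \<in> Obj C"
    using assms Hom_Obj by (simp_all add: Hom_src)
  ultimately show ?thesis using assms(6) by blast
qed

lemma pullback_lift:
  assumes "is_pullback C f g p q" "f \<in> Hom C A D" "g \<in> Hom C B D"
    and "a \<in> Hom C Z A" "b \<in> Hom C Z B" "cmp C f a = cmp C g b"
  obtains h where "h \<in> Hom C Z (src C p)" "cmp C p h = a" "cmp C q h = b"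
  using pullback_ex1[OF assms] that by blast

lemma pullback_unique:
  assumes pb: "is_pullback C f g p q" and f: "f \<in> Hom C A D" and g: "g \<in> Hom C B D"
    and x: "x \<in> Hom C Z (src C p)" and y: "y \<in> Hom C Z (src C p)"
    and "cmp C p x = cmp C p y" "cmp C q x = cmp C q y"
  shows "x = y"
proof -
  note h = pullback_Hom[OF pb f g]
  have e: "cmp C f (cmp C p x) = cmp C g (cmp C q x)"
    using assoc[OF f h(1) x] assoc[OF g h(2) x] h(3) by simp
  have "\<exists>!h. h \<in> Hom C Z (src C p) \<and> cmp C p h = cmp C p x \<and> cmp C q h = cmp C q x"
    using pullback_ex1[OF pb f g comp_hom[OF h(1) x] comp_hom[OF h(2) x] e] .
  then show ?thesis using x y assms(6,7) by metis
qed

lemma pullback_mono: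
  assumes pb: "is_pullback C f g p q" and f: "f \<in> Hom C A D" and g: "g \<in> Hom C B D"
    and mono: "mono_arr C g"
  shows "mono_arr C p"
  unfolding mono_arr_def
proof (intro conjI ballI impI)
  note h = pullback_Hom[OF pb f g]
  show "p \<in> Arr C" using h(1) by (rule Hom_Arr)
  fix X x y assume x: "x \<in> Hom C X (src C p)" and y: "y \<in> Hom C X (src C p)"
    and e: "cmp C p x = cmp C p y"
  have "cmp C g (cmp C q x) = cmp C g (cmp C q y)"
    using assoc[OF f h(1) x] assoc[OF g h(2) x] assoc[OF f h(1) y] assoc[OF g h(2) y] h(3) e by simp
  then have "cmp C q x = cmp C q y"
    using mono_arrD[OF mono g] comp_hom[OF h(2) x] comp_hom[OF h(2) y] by blast
  then show "x = y" using pullback_unique[OF pb f g x y e] by blast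
qed

end

section \<open>Products, tuples and diagonals from finite limits\<close>

locale lex_category = category C for C :: "('o, 'a) cat" +
  assumes lex: "has_finite_limits C"
begin

lemma pullback_exists:
  assumes "f \<in> Hom C A D" "g \<in> Hom C B D"
  obtains p q where "is_pullback C f g p q"
proof -
  have "tgt C f = tgt C g" using assms by (simp add: Hom_tgt)
  then show thesis
    using that lex Hom_Arr[OF assms(1)] Hom_Arr[OF assms(2)] unfolding has_finite_limits_def by blast
qed

text \<open>A pullback over the terminal object is a product. This makes the \<open>SOME\<close> in
  \<open>some_product\<close> meaningful, and with it \<open>prd\<close>, \<open>pr1\<close>,
  \<open>pr2\<close> and \<open>tuple\<close>.\<close>

lemma product_exists:
  assumes "A \<in> Obj C" "B \<in> Obj C"
  shows "\<exists>x. is_product C A B x"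
proof -
  obtain T where T: "is_terminal C T" using lex by (auto simp: has_finite_limits_def)
  obtain f where f: "f \<in> Hom C A T" using T assms(1) by (auto simp: is_terminal_def)
  obtain g where g: "g \<in> Hom C B T" using T assms(2) by (auto simp: is_terminal_def)
  obtain p q where pb: "is_pullback C f g p q" using pullback_exists[OF f g] by blast
  note h = pullback_Hom[OF pb f g]
  have "\<exists>!h. h \<in> Hom C Z (src C p) \<and> cmp C p h = a \<and> cmp C q h = b"
    if Z: "Z \<in> Obj C" and a: "a \<in> Hom C Z A" and b: "b \<in> Hom C Z B" for Z a b
  proof -
    have "cmp C f a = cmp C g b"
      using T Z comp_hom[OF f a] comp_hom[OF g b] unfolding is_terminal_def by blast
    then show ?thesis using pullback_ex1[OF pb f g a b] by blast
  qed
  then have "is_product C A B (src C p, p, q)"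
    unfolding is_product_def using h Hom_Obj(1)[OF h(1)] by auto
  then show ?thesis by blast
qed

lemma is_product_prd:
  assumes "A \<in> Obj C" "B \<in> Obj C"
  shows "is_product C A B (prd C A B, pr1 C A B, pr2 C A B)"
  using someI_ex[OF product_exists[OF assms]] by (simp add: prd_def pr1_def pr2_def some_product_def)

lemma prd_Obj: "A \<in> Obj C \<Longrightarrow> B \<in> Obj C \<Longrightarrow> prd C A B \<in> Obj C"
  and pr1_hom: "A \<in> Obj C \<Longrightarrow> B \<in> Obj C \<Longrightarrow> pr1 C A B \<in> Hom C (prd C A B) A"
  and pr2_hom: "A \<in> Obj C \<Longrightarrow> B \<in> Obj C \<Longrightarrow> pr2 C A B \<in> Hom C (prd C A B) B"
  using is_product_prd[of A B] by (auto simp: is_product_def)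

lemma tuple_ex1:
  assumes "f \<in> Hom C X A" "g \<in> Hom C X B"
  shows "\<exists>!h. h \<in> Hom C X (prd C A B) \<and> cmp C (pr1 C A B) h = f \<and> cmp C (pr2 C A B) h = g"
  using is_product_prd[OF Hom_Obj(2)[OF assms(1)] Hom_Obj(2)[OF assms(2)]] assms Hom_Obj(1)[OF assms(1)]
  by (auto simp: is_product_def)

lemma
  assumes "f \<in> Hom C X A" "g \<in> Hom C X B"
  shows tuple_hom: "tuple C f g \<in> Hom C X (prd C A B)"
    and pr1_tuple: "cmp C (pr1 C A B) (tuple C f g) = f"
    and pr2_tuple: "cmp C (pr2 C A B) (tuple C f g) = g"
  using theI'[OF tuple_ex1[OF assms]] assms by (simp_all add: tuple_def Hom_src Hom_tgt)

lemma tuple_eqI: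
  assumes "h \<in> Hom C X (prd C A B)" "A \<in> Obj C" "B \<in> Obj C"
    and "cmp C (pr1 C A B) h = f" "cmp C (pr2 C A B) h = g"
  shows "h = tuple C f g"
proof -
  have f: "f \<in> Hom C X A" and g: "g \<in> Hom C X B"
    using assms comp_hom pr1_hom pr2_hom by blast+
  show ?thesis
    using tuple_ex1[OF f g] assms(1,4,5) tuple_hom[OF f g] pr1_tuple[OF f g] pr2_tuple[OF f g] by blast
qed

lemma tuple_comp:
  assumes f: "f \<in> Hom C X A" and g: "g \<in> Hom C X B" and h: "h \<in> Hom C Y X"
  shows "cmp C (tuple C f g) h = tuple C (cmp C f h) (cmp C g h)"
proof (rule tuple_eqI)
  have A: "A \<in> Obj C" and B: "B \<in> Obj C" using Hom_Obj f g by blast+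
  show "A \<in> Obj C" "B \<in> Obj C" by fact+
  show "cmp C (tuple C f g) h \<in> Hom C Y (prd C A B)" using tuple_hom[OF f g] h by (rule comp_hom)
  show "cmp C (pr1 C A B) (cmp C (tuple C f g) h) = cmp C f h"
    using assoc[OF pr1_hom[OF A B] tuple_hom[OF f g] h] pr1_tuple[OF f g] by simp
  show "cmp C (pr2 C A B) (cmp C (tuple C f g) h) = cmp C g h"
    using assoc[OF pr2_hom[OF A B] tuple_hom[OF f g] h] pr2_tuple[OF f g] by simp
qed

lemma tuple_cases:
  assumes "h \<in> Hom C X (prd C A B)" "A \<in> Obj C" "B \<in> Obj C"
  obtains f g where "f \<in> Hom C X A" "g \<in> Hom C X B" "h = tuple C f g"
    "cmp C (pr1 C A B) h = f" "cmp C (pr2 C A B) h = g"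
  using that[OF comp_hom[OF pr1_hom[OF assms(2,3)] assms(1)] comp_hom[OF pr2_hom[OF assms(2,3)] assms(1)]
      tuple_eqI[OF assms refl refl] refl refl] .

lemma tuple_inj:
  assumes "tuple C f g = tuple C f' g'" "f \<in> Hom C X A" "g \<in> Hom C X B" "f' \<in> Hom C X A" "g' \<in> Hom C X B"
  shows "f = f'" "g = g'"
  using assms(1) pr1_tuple[OF assms(2,3)] pr1_tuple[OF assms(4,5)]
    pr2_tuple[OF assms(2,3)] pr2_tuple[OF assms(4,5)] by simp_all

abbreviation diag :: "'o \<Rightarrow> 'a" where "diag A \<equiv> tuple C (idt C A) (idt C A)"

lemma diag_hom: "A \<in> Obj C \<Longrightarrow> diag A \<in> Hom C A (prd C A A)"
  by (intro tuple_hom id_hom)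

lemma diag_comp: "x \<in> Hom C X A \<Longrightarrow> cmp C (diag A) x = tuple C x x"
  by (simp add: tuple_comp[OF id_hom id_hom] Hom_Obj(2) id_comp)

lemma diag_mono: 
  assumes "A \<in> Obj C" shows "mono_arr C (diag A)"
  unfolding mono_arr_def Hom_src[OF diag_hom[OF assms]]
proof (intro conjI ballI impI)
  show "diag A \<in> Arr C" using diag_hom[OF assms] by (rule Hom_Arr)
  fix X f g assume f: "f \<in> Hom C X A" and g: "g \<in> Hom C X A" and "cmp C (diag A) f = cmp C (diag A) g"
  then have "tuple C f f = tuple C g g" by (simp add: diag_comp)
  then show "f = g" using tuple_inj f g by blast
qed

end

section \<open>The subobject fibration\<close>

text \<open>Membership of the generalized element \<open>x\<close> in the subobject
  \<open>m\<close>. It plays for subobjects the role that forcing plays for predicates: order, meets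
  and reindexing are all read off from it.\<close>

definition factors :: "('o, 'a) cat \<Rightarrow> 'a \<Rightarrow> 'a \<Rightarrow> bool" where
  "factors C m x \<longleftrightarrow> (\<exists>g\<in>Hom C (src C x) (src C m). cmp C m g = x)"

lemma Base_sub: "Base (sub C) = C"
  by (simp add: sub_def)

lemma fibre_sub: "m \<in> fibre (sub C) A \<longleftrightarrow> mono_arr C m \<and> tgt C m = A"
  by (auto simp: fibre_def sub_def sub_tot_def)

lemma fibre_subD: "m \<in> fibre (sub C) A \<Longrightarrow> mono_arr C m" "m \<in> fibre (sub C) A \<Longrightarrow> m \<in> Hom C (src C m) A"
  by (auto simp: fibre_sub mono_arr_def Hom_def)

lemma fibre_subI: "mono_arr C m \<Longrightarrow> m \<in> Hom C B A \<Longrightarrow> m \<in> fibre (sub C) A"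
  by (auto simp: fibre_sub Hom_def)

context category begin

lemma factorsI: "m \<in> Hom C B A \<Longrightarrow> g \<in> Hom C X B \<Longrightarrow> cmp C m g = x \<Longrightarrow> factors C m x"
  unfolding factors_def using comp_hom by (metis Hom_src)

lemma factors_self: "m \<in> Hom C B A \<Longrightarrow> factors C m m"
  using factorsI[OF _ id_hom comp_id] Hom_Obj(1) by blast

lemma factorsE:
  assumes "factors C m x" "m \<in> Hom C B A" "x \<in> Hom C X A"
  obtains g where "g \<in> Hom C X B" "cmp C m g = x"
  using assms by (auto simp: factors_def Hom_src)

lemma factors_trans:
  assumes "factors C m n" "factors C n x" "m \<in> Hom C B A" "n \<in> Hom C B' A" "x \<in> Hom C X A"
  shows "factors C m x"
proof -
  obtain g where g: "g \<in> Hom C B' B" "cmp C m g = n" using factorsE[OF assms(1,3,4)] .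
  obtain h where h: "h \<in> Hom C X B'" "cmp C n h = x" using factorsE[OF assms(2,4,5)] .
  show ?thesis
    using factorsI[OF assms(3) comp_hom[OF g(1) h(1)]] assoc[OF assms(3) g(1) h(1)] g h by simp
qed

lemma factors_comp:
  assumes "factors C m x" "m \<in> Hom C B A" "x \<in> Hom C X A" "y \<in> Hom C Y X"
  shows "factors C m (cmp C x y)"
  using factors_trans[OF assms(1) _ assms(2,3) comp_hom[OF assms(3,4)]] factorsI[OF assms(3,4) refl] by blast

text \<open>A vertical arrow of \<open>sub_tot\<close> is a triple carrying no data beyond its ends,
  so containment amounts to membership of the generic element of \<open>m\<close>, namely
  \<open>m\<close> itself, in \<open>n\<close>.\<close>

lemma sub_le:
  "le (sub C) A m n \<longleftrightarrow> m \<in> fibre (sub C) A \<and> n \<in> fibre (sub C) A \<and> factors C n m"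
proof -
  have "over (sub C) (idt C A) m n \<noteq> {} \<longleftrightarrow> factors C n m"
    if m: "m \<in> fibre (sub C) A" and n: "n \<in> fibre (sub C) A"
  proof -
    have "over (sub C) (idt C A) m n \<noteq> {} \<longleftrightarrow> (m, idt C A, n) \<in> Arr (sub_tot C)"
      by (auto simp: over_def sub_def Hom_def sub_tot_def)
    also have "\<dots> \<longleftrightarrow> factors C n m"
      using fibre_subD[OF m] fibre_subD[OF n] id_comp[OF fibre_subD(2)[OF m]]
        id_hom[OF Hom_Obj(2)[OF fibre_subD(2)[OF m]]]
      by (auto simp: sub_tot_def factors_def Hom_tgt[OF fibre_subD(2)[OF m]] Hom_tgt[OF fibre_subD(2)[OF n]])
    finally show ?thesis .
  qed
  then show ?thesis by (auto simp: le_def sub_def)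
qed

end

context lex_category begin

lemma pullback_factors:
  assumes pb: "is_pullback C f m p q" and f: "f \<in> Hom C A B" and m: "m \<in> Hom C M B"
    and x: "x \<in> Hom C X A"
  shows "factors C p x \<longleftrightarrow> factors C m (cmp C f x)"
proof -
  note h = pullback_Hom[OF pb f m]
  show ?thesis
  proof
    assume "factors C p x"
    then obtain g where g: "g \<in> Hom C X (src C p)" "cmp C p g = x" using factorsE[OF _ h(1) x] by blast
    have "cmp C f x = cmp C m (cmp C q g)"
      using assoc[OF f h(1) g(1)] assoc[OF m h(2) g(1)] h(3) g(2) by simp
    then show "factors C m (cmp C f x)" using factorsI[OF m comp_hom[OF h(2) g(1)]] by simp
  next
    assume "factors C m (cmp C f x)"
    then obtain g where "g \<in> Hom C X M" "cmp C m g = cmp C f x" using factorsE[OF _ m comp_hom[OF f x]] by blast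
    then obtain k where "k \<in> Hom C X (src C p)" "cmp C p k = x" using pullback_lift[OF pb f m x] by metis
    then show "factors C p x" using factorsI[OF h(1)] by blast
  qed
qed

text \<open>\<open>reindex\<close> takes an arbitrary cartesian arrow, hence is known only up to
  isomorphism. A pullback provides a cartesian arrow to compare it with, and isomorphic subobjects
  have the same elements.\<close>

lemma
  assumes f: "f \<in> Hom C A B" and m: "m \<in> fibre (sub C) B"
  shows reindex_sub: "reindex (sub C) f m \<in> fibre (sub C) A" (is ?thesis1)
    and factors_reindex_sub:
      "x \<in> Hom C X A \<Longrightarrow> factors C (reindex (sub C) f m) x \<longleftrightarrow> factors C m (cmp C f x)"
proof -
  note mm = fibre_subD(1)[OF m] and mh = fibre_subD(2)[OF m]
  obtain p q where pb: "is_pullback C f m p q" using pullback_exists[OF f mh] by blast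
  note h = pullback_Hom[OF pb f mh]
  have pm: "mono_arr C p" using pullback_mono[OF pb f mh mm] .
  have car: "cartesian (sub C) (p, f, m)"
    unfolding cartesian_def
  proof (intro conjI ballI allI impI)
    show "(p, f, m) \<in> Arr (Tot (sub C))"
      using pm mm f h by (auto simp: sub_def sub_tot_def Hom_tgt[OF h(1)] Hom_tgt[OF mh])
    fix v k assume v: "v \<in> Arr (Tot (sub C))" and t: "tgt (Tot (sub C)) v = tgt (Tot (sub C)) (p, f, m)"
      and k: "k \<in> Hom (Base (sub C)) (FOb (Proj (sub C)) (src (Tot (sub C)) v)) (FOb (Proj (sub C)) (src (Tot (sub C)) (p, f, m)))"
      and e: "FAr (Proj (sub C)) v = cmp (Base (sub C)) (FAr (Proj (sub C)) (p, f, m)) k"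
    obtain n where vn: "v = (n, cmp C f k, m)" using t e by (cases v) (auto simp: sub_def sub_tot_def)
    have k': "k \<in> Hom C (tgt C n) A" using k vn by (auto simp: sub_def sub_tot_def Hom_tgt[OF h(1)])
    have nm: "mono_arr C n" and nf: "\<exists>g\<in>Hom C (src C n) (src C m). cmp C m g = cmp C (cmp C f k) n"
      using v vn by (auto simp: sub_def sub_tot_def)
    have n: "n \<in> Hom C (src C n) (tgt C n)" using nm by (simp add: mono_arr_def Arr_Hom)
    have "factors C m (cmp C f (cmp C k n))"
      using nf factorsI[OF mh] assoc[OF f k' n] by auto
    then have "factors C p (cmp C k n)" using pullback_factors[OF pb f mh comp_hom[OF k' n]] by blast
    then obtain g where g: "g \<in> Hom C (src C n) (src C p)" "cmp C p g = cmp C k n"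
      using factorsE[OF _ h(1) comp_hom[OF k' n]] by blast
    have "(n, k, p) \<in> Arr (sub_tot C)"
      using nm pm k' g by (auto simp: sub_tot_def Hom_tgt[OF h(1)])
    then show "\<exists>!w. w \<in> over (sub C) k (src (Tot (sub C)) v) (src (Tot (sub C)) (p, f, m)) \<and> cmp (Tot (sub C)) (p, f, m) w = v"
      unfolding over_def Hom_def sub_def vn
      by (intro ex1I[of _ "(n, k, p)"]) (simp_all add: sub_tot_def split: prod.splits)
  qed
  then have "\<exists>u. cartesian (sub C) u \<and> tgt (Tot (sub C)) u = m \<and> FAr (Proj (sub C)) u = f"
    by (intro exI[of _ "(p, f, m)"]) (auto simp: sub_def sub_tot_def)
  then obtain u where u: "cartesian (sub C) u" "tgt (Tot (sub C)) u = m" "FAr (Proj (sub C)) u = f"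
    and r: "reindex (sub C) f m = src (Tot (sub C)) u"
    unfolding reindex_def by (metis (mono_tags, lifting) someI_ex)
  define n where "n = reindex (sub C) f m"
  have un: "u = (n, f, m)" using u r by (cases u) (auto simp: n_def sub_def sub_tot_def)
  have "(n, f, m) \<in> Arr (sub_tot C)" using u(1) un by (auto simp: cartesian_def sub_def)
  then have nm: "mono_arr C n" and nt: "tgt C n = A"
    and nf: "\<exists>g\<in>Hom C (src C n) (src C m). cmp C m g = cmp C f n"
    using f by (auto simp: sub_tot_def Hom_def)
  then have n: "n \<in> fibre (sub C) A" by (simp add: fibre_sub)
  note nh = fibre_subD(2)[OF n]
  show ?thesis1 using n by (simp add: n_def)
  have "factors C p n" using nf factorsI[OF mh] pullback_factors[OF pb f mh nh] by blast
  \<comment> \<open>The universal property of the chosen arrow \<open>u\<close>, applied to the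
    pullback triple over the identity of \<open>A\<close>, gives a vertical arrow from
    \<open>p\<close> to \<open>n\<close>.\<close>
  moreover have "factors C n p"
  proof -
    have A: "idt C A \<in> Hom C A A" "cmp C f (idt C A) = f" using id_hom comp_id Hom_Obj f by blast+
    have "(p, f, m) \<in> Arr (Tot (sub C))" using car by (auto simp: cartesian_def)
    then have "\<exists>!w. w \<in> over (sub C) (idt C A) (src (Tot (sub C)) (p, f, m)) (src (Tot (sub C)) u) \<and>
        cmp (Tot (sub C)) u w = (p, f, m)"
      using A by (intro u(1)[unfolded cartesian_def, THEN conjunct2, rule_format])
        (simp_all add: un sub_def sub_tot_def nt Hom_tgt[OF h(1)])
    then have "\<exists>w. w \<in> over (sub C) (idt C A) p n" by (auto simp: un sub_def sub_tot_def)
    then have "le (sub C) A p n" using pm n by (auto simp: le_def fibre_sub Hom_tgt[OF h(1)] Base_sub)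
    then show ?thesis by (simp add: sub_le)
  qed
  ultimately have "factors C n x \<longleftrightarrow> factors C p x" if "x \<in> Hom C X A" for x X
    using factors_trans h(1) nh that by blast
  then show "x \<in> Hom C X A \<Longrightarrow> factors C (reindex (sub C) f m) x \<longleftrightarrow> factors C m (cmp C f x)"
    using pullback_factors[OF pb f mh] by (simp add: n_def)
qed

lemma id_fibre_sub: "A \<in> Obj C \<Longrightarrow> idt C A \<in> fibre (sub C) A"
  using mono_arr_def id_comp fibre_subI[OF _ id_hom] by (auto simp: mono_arr_def Hom_src[OF id_hom] Hom_Arr[OF id_hom])

lemma factors_top:
  assumes "is_top (sub C) A t" "x \<in> Hom C X A"
  shows "factors C t x"
proof -
  have A: "A \<in> Obj C" using Hom_Obj assms(2) by blast
  have "factors C t (idt C A)" using assms(1) id_fibre_sub[OF A] by (auto simp: is_top_def sub_le)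
  moreover have "factors C (idt C A) x" using factorsI[OF id_hom[OF A] assms(2)] id_comp[OF assms(2)] by simp
  moreover have "t \<in> Hom C (src C t) A" using assms(1) fibre_subD(2) by (auto simp: is_top_def)
  ultimately show ?thesis using factors_trans id_hom[OF A] assms(2) by blast
qed

text \<open>The meet \<open>z\<close> is given only by its order property, which speaks about monos
  and not about arbitrary elements. It is therefore compared with the intersection built as a
  pullback.\<close>

lemma factors_meet:
  assumes z: "is_meet (sub C) A m n z" and x: "x \<in> Hom C X A"
  shows "factors C z x \<longleftrightarrow> factors C m x \<and> factors C n x"
proof -
  have fib: "z \<in> fibre (sub C) A" "m \<in> fibre (sub C) A" "n \<in> fibre (sub C) A"
    and zm: "factors C m z" and zn: "factors C n z"
    using z by (auto simp: is_meet_def sub_le)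
  note h = fibre_subD(2)[OF fib(1)] fibre_subD(2)[OF fib(2)] fibre_subD(2)[OF fib(3)]
  obtain p q where pb: "is_pullback C m n p q" using pullback_exists[OF h(2,3)] by blast
  note k = pullback_Hom[OF pb h(2,3)]
  \<comment> \<open>The diagonal of the pullback square, the concrete intersection of
    \<open>m\<close> and \<open>n\<close>. Being a mono below both, it lies below
    \<open>z\<close>.\<close>
  let ?w = "cmp C m p"
  have wm: "mono_arr C ?w"
    unfolding mono_arr_def
  proof (intro conjI ballI impI)
    have w: "?w \<in> Hom C (src C p) A" using comp_hom[OF h(2) k(1)] .
    show "?w \<in> Arr C" using Hom_Arr[OF w] .
    fix Y f g assume f: "f \<in> Hom C Y (src C ?w)" and g: "g \<in> Hom C Y (src C ?w)" and e: "cmp C ?w f = cmp C ?w g"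
    have f: "f \<in> Hom C Y (src C p)" and g: "g \<in> Hom C Y (src C p)" using f g by (auto simp: Hom_src[OF w])
    have pe: "cmp C p f = cmp C p g"
      using mono_arrD[OF fibre_subD(1)[OF fib(2)] h(2) comp_hom[OF k(1) f] comp_hom[OF k(1) g]] e
        assoc[OF h(2) k(1) f] assoc[OF h(2) k(1) g] by simp
    have qe: "cmp C q f = cmp C q g"
      using mono_arrD[OF fibre_subD(1)[OF fib(3)] h(3) comp_hom[OF k(2) f] comp_hom[OF k(2) g]] e k(3)
        assoc[OF h(3) k(2) f] assoc[OF h(3) k(2) g] by simp
    show "f = g" using pullback_unique[OF pb h(2,3) f g pe qe] .
  qed
  have wf: "?w \<in> fibre (sub C) A" using fibre_subI[OF wm comp_hom[OF h(2) k(1)]] .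
  note wh = fibre_subD(2)[OF wf]
  have "factors C m ?w" using factorsI[OF h(2) k(1)] by simp
  moreover have "factors C n ?w" using factorsI[OF h(3) k(2)] k(3) by simp
  ultimately have "factors C z ?w" using z wf fib by (auto simp: is_meet_def sub_le)
  moreover have "factors C ?w x" if mx: "factors C m x" and nx: "factors C n x"
  proof -
    obtain a where a: "a \<in> Hom C X (src C m)" "cmp C m a = x" using factorsE[OF mx h(2) x] .
    obtain b where b: "b \<in> Hom C X (src C n)" "cmp C n b = x" using factorsE[OF nx h(3) x] .
    obtain g where g: "g \<in> Hom C X (src C p)" "cmp C p g = a"
      using pullback_lift[OF pb h(2,3) a(1) b(1)] a b by metis
    show ?thesis using factorsI[OF comp_hom[OF h(2) k(1)] g(1)] assoc[OF h(2) k(1) g(1)] g a by simp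
  qed
  ultimately show ?thesis
    using factors_trans[OF _ _ h(1) wh x] factors_trans[OF zm _ h(2) h(1) x] factors_trans[OF zn _ h(3) h(1) x]
    by blast
qed

end

section \<open>Forcing in a fibration of preorders\<close>


locale preorder_fib =
  fixes P :: "('o, 'a, 'p, 'q) fib"
  assumes fib_preorders: "fibration_of_preorders P"
    and lex_base: "has_finite_limits (Base P)"

sublocale preorder_fib \<subseteq> lex_category "Base P"
  using fib_preorders lex_base
  by unfold_locales (auto simp: fibration_of_preorders_def is_fibration_def)

sublocale preorder_fib \<subseteq> tot: category "Tot P"
  using fib_preorders by unfold_locales (auto simp: fibration_of_preorders_def is_fibration_def)

context preorder_fib begin

abbreviation E :: "('o, 'a) cat" where "E \<equiv> Base P"
abbreviation comp :: "'a \<Rightarrow> 'a \<Rightarrow> 'a" (infixl "\<cdot>" 75) where "g \<cdot> f \<equiv> cmp E g f"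
abbreviation ob :: "'p \<Rightarrow> 'o" where "ob \<theta> \<equiv> FOb (Proj P) \<theta>"
abbreviation Pred :: "'p set" where "Pred \<equiv> Obj (Tot P)"

text \<open>Kripke--Joyal semantics: the predicate \<open>\<theta>\<close> over \<open>ob \<theta>\<close> is viewed as a stage at which the
  generalized element \<open>a\<close> satisfies \<open>\<phi>\<close>. All entailments of the internal logic are phrased
  through it, which makes reindexing functors disappear.\<close>

definition ent :: "'p \<Rightarrow> 'a \<Rightarrow> 'p \<Rightarrow> bool" where
  "ent \<theta> a \<phi> \<longleftrightarrow> \<theta> \<in> Pred \<and> \<phi> \<in> Pred \<and> over P a \<theta> \<phi> \<noteq> {}"

lemma proj_hom: "u \<in> Hom (Tot P) x y \<Longrightarrow> FAr (Proj P) u \<in> Hom E (ob x) (ob y)"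
  using fib_preorders by (auto simp: fibration_of_preorders_def is_fibration_def is_functor_def Hom_def)

lemma proj_ob: "x \<in> Pred \<Longrightarrow> ob x \<in> Obj E"
  using fib_preorders by (auto simp: fibration_of_preorders_def is_fibration_def is_functor_def)

lemma
  assumes "ent \<theta> a \<phi>"
  shows ent_hom: "a \<in> Hom E (ob \<theta>) (ob \<phi>)" and ent_dom: "\<theta> \<in> Pred" and ent_cod: "\<phi> \<in> Pred"
  using assms proj_hom by (auto simp: ent_def over_def)

lemma ent_refl: "\<theta> \<in> Pred \<Longrightarrow> ent \<theta> (idt E (ob \<theta>)) \<theta>"
  using fib_preorders tot.id_hom[of \<theta>]
  by (auto simp: ent_def over_def fibration_of_preorders_def is_fibration_def is_functor_def)

lemma ent_comp:
  assumes "ent \<theta>' f \<theta>" "ent \<theta> a \<phi>"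
  shows "ent \<theta>' (a \<cdot> f) \<phi>"
proof -
  obtain u v where u: "u \<in> Hom (Tot P) \<theta>' \<theta>" "FAr (Proj P) u = f"
    and v: "v \<in> Hom (Tot P) \<theta> \<phi>" "FAr (Proj P) v = a"
    using assms by (auto simp: ent_def over_def)
  have "FAr (Proj P) (cmp (Tot P) v u) = a \<cdot> f"
    using fib_preorders u v
    by (auto simp: fibration_of_preorders_def is_fibration_def is_functor_def Hom_def)
  then show ?thesis using tot.comp_hom[OF v(1) u(1)] assms by (auto simp: ent_def over_def)
qed

lemma le_ent: "le P A x y \<longleftrightarrow> x \<in> fibre P A \<and> y \<in> fibre P A \<and> ent x (idt E A) y"
  by (auto simp: le_def ent_def fibre_def)

lemma reindex_cartesian:
  assumes f: "f \<in> Hom E A B" and y: "y \<in> fibre P B"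
  obtains u where "cartesian P u" "tgt (Tot P) u = y" "FAr (Proj P) u = f" "reindex P f y = src (Tot P) u"
proof -
  have "\<exists>u. cartesian P u \<and> tgt (Tot P) u = y \<and> FAr (Proj P) u = f"
    using fib_preorders f y by (auto simp: fibration_of_preorders_def is_fibration_def Hom_def)
  from someI_ex[OF this] show thesis using that by (auto simp: reindex_def)
qed

text \<open>The substitution rule: composing with the cartesian arrow over \<open>f\<close> is a
  bijection between arrows over \<open>a\<close> and arrows over \<open>f \<cdot> a\<close>. The
  arbitrary choice inside \<open>reindex\<close> leaves no trace after this.\<close>

lemma
  assumes f: "f \<in> Hom E A B" and y: "y \<in> fibre P B"
  shows reindex_fibre: "reindex P f y \<in> fibre P A"
    and ent_reindex: "a \<in> Hom E (ob \<theta>) A \<Longrightarrow> ent \<theta> a (reindex P f y) \<longleftrightarrow> ent \<theta> (f \<cdot> a) y"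
proof -
  obtain u where u: "cartesian P u" "tgt (Tot P) u = y" "FAr (Proj P) u = f"
    and r: "reindex P f y = src (Tot P) u" using reindex_cartesian[OF f y] .
  define x where "x = reindex P f y"
  have ux: "u \<in> Hom (Tot P) x y" using u r by (auto simp: cartesian_def Hom_def x_def)
  have x: "x \<in> fibre P A"
    using proj_hom[OF ux] f u(3) tot.Hom_Obj[OF ux] by (auto simp: fibre_def Hom_def)
  then show "reindex P f y \<in> fibre P A" by (simp add: x_def)
  have yy: "y \<in> Pred" "ob y = B" and xx: "x \<in> Pred" "ob x = A" using x y by (auto simp: fibre_def)
  have exy: "ent x f y" using ux u(3) xx yy by (auto simp: ent_def over_def)
  assume a: "a \<in> Hom E (ob \<theta>) A"
  show "ent \<theta> a (reindex P f y) \<longleftrightarrow> ent \<theta> (f \<cdot> a) y"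
    unfolding x_def[symmetric]
  proof
    assume "ent \<theta> a x" then show "ent \<theta> (f \<cdot> a) y" using exy by (rule ent_comp)
  next
    assume e: "ent \<theta> (f \<cdot> a) y"
    then obtain v where v: "v \<in> Hom (Tot P) \<theta> y" "FAr (Proj P) v = f \<cdot> a"
      by (auto simp: ent_def over_def)
    have "\<exists>!w. w \<in> over P a (src (Tot P) v) (src (Tot P) u) \<and> cmp (Tot P) u w = v"
      by (rule u(1)[unfolded cartesian_def, THEN conjunct2, rule_format])
        (use v u a xx ux in \<open>auto simp: Hom_def\<close>)
    then show "ent \<theta> a x" using xx ent_dom[OF e] Hom_src[OF v(1)] Hom_src[OF ux] by (auto simp: ent_def)
  qed
qed

text \<open>The way back from forcing to the order of a single fibre, in which the Heyting structure
  and the quantifiers are specified.\<close>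

lemma ent_id_iff:
  assumes "\<theta> \<in> fibre P A" "a \<in> Hom E A B" "\<phi> \<in> fibre P B"
  shows "ent \<theta> a \<phi> \<longleftrightarrow> le P A \<theta> (reindex P a \<phi>)"
proof -
  have t: "ob \<theta> = A" using assms(1) by (simp add: fibre_def)
  have "idt E A \<in> Hom E (ob \<theta>) A" using id_hom Hom_Obj(1)[OF assms(2)] t by simp
  then show ?thesis
    using ent_reindex[OF assms(2,3), of "idt E A" \<theta>] comp_id[OF assms(2)] reindex_fibre[OF assms(2,3)] assms(1)
    by (simp add: le_ent)
qed

text \<open>A Yoneda argument: for the converse, the stage is \<open>x\<close> itself with the
  identity as its generic element.\<close>

lemma le_ent_all:
  assumes "x \<in> fibre P A" "y \<in> fibre P A"
  shows "le P A x y \<longleftrightarrow> (\<forall>\<theta> a. ent \<theta> a x \<longrightarrow> ent \<theta> a y)"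
proof
  assume l: "le P A x y"
  show "\<forall>\<theta> a. ent \<theta> a x \<longrightarrow> ent \<theta> a y"
  proof (intro allI impI)
    fix \<theta> a assume e: "ent \<theta> a x"
    then have "a \<in> Hom E (ob \<theta>) A" using ent_hom assms by (auto simp: fibre_def)
    then show "ent \<theta> a y" using ent_comp[OF e, of "idt E A" y] l id_comp by (auto simp: le_ent)
  qed
next
  assume "\<forall>\<theta> a. ent \<theta> a x \<longrightarrow> ent \<theta> a y"
  then show "le P A x y" using ent_refl assms by (auto simp: le_ent fibre_def)
qed

lemma le_ent_mono: "le P A x y \<Longrightarrow> ent \<theta> a x \<Longrightarrow> ent \<theta> a y"
  using le_ent_all le_ent by blast

lemma le_trans: "le P A x y \<Longrightarrow> le P A y z \<Longrightarrow> le P A x z"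
  by (metis le_ent le_ent_all)

lemma le_refl: "x \<in> fibre P A \<Longrightarrow> le P A x x"
  by (simp add: le_ent_all)

lemma ent_restrict: "ent \<theta>' f \<theta> \<Longrightarrow> a \<in> Hom E (ob \<theta>) A \<Longrightarrow> a \<cdot> f \<in> Hom E (ob \<theta>') A"
  using comp_hom ent_hom by blast

text \<open>This says that \<open>\<theta>\<close> entails the existential image of
  \<open>\<theta>'\<close> along \<open>f\<close>, phrased as the descent property through which it
  is used. The phrasing needs no quantifier, so it is available before existential quantification
  has been constructed.\<close>

definition covers :: "'a \<Rightarrow> 'p \<Rightarrow> 'p \<Rightarrow> bool" where
  "covers f \<theta>' \<theta> \<longleftrightarrow> ent \<theta>' f \<theta> \<and>
     (\<forall>a \<chi>. a \<in> Hom E (ob \<theta>) (ob \<chi>) \<longrightarrow> ent \<theta>' (a \<cdot> f) \<chi> \<longrightarrow> ent \<theta> a \<chi>)"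

lemma covers_ent: "covers f \<theta>' \<theta> \<Longrightarrow> ent \<theta>' f \<theta>"
  by (simp add: covers_def)

lemma covers_local: "covers f \<theta>' \<theta> \<Longrightarrow> ent \<theta>' (a \<cdot> f) \<chi> \<Longrightarrow> a \<in> Hom E (ob \<theta>) (ob \<chi>) \<Longrightarrow> ent \<theta> a \<chi>"
  by (simp add: covers_def)

lemma covers_hom: "covers f \<theta>' \<theta> \<Longrightarrow> f \<in> Hom E (ob \<theta>') (ob \<theta>)"
  using covers_ent ent_hom by blast

lemma covers_restrict: "covers f \<theta>' \<theta> \<Longrightarrow> a \<in> Hom E (ob \<theta>) A \<Longrightarrow> a \<cdot> f \<in> Hom E (ob \<theta>') A"
  using ent_restrict covers_ent by blast

lemma covers_refl: "\<theta> \<in> Pred \<Longrightarrow> covers (idt E (ob \<theta>)) \<theta> \<theta>"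
  by (simp add: covers_def ent_refl comp_id)

end

section \<open>Connectives and quantifiers under forcing\<close>

locale tripos_fib = preorder_fib P for P :: "('o, 'a, 'p, 'q) fib" +
  assumes trip: "tripos P"
begin

lemma top_exists: "A \<in> Obj E \<Longrightarrow> is_top P A (top_of P A)"
  and bot_exists: "A \<in> Obj E \<Longrightarrow> is_bot P A (bot_of P A)"
  using trip unfolding tripos_def heyting_fibre_def top_of_def bot_of_def by (blast intro: someI_ex)+

lemma
  assumes "x \<in> fibre P A" "y \<in> fibre P A"
  shows meet_exists: "is_meet P A x y (meet P A x y)" and imp_exists: "is_imp P A x y (imp P A x y)"
proof -
  have "A \<in> Obj E" using assms(1) proj_ob by (auto simp: fibre_def)
  then show "is_meet P A x y (meet P A x y)" "is_imp P A x y (imp P A x y)"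
    using trip assms unfolding tripos_def heyting_fibre_def meet_def imp_def by (blast intro: someI_ex)+
qed

lemma meet_fibre: "x \<in> fibre P A \<Longrightarrow> y \<in> fibre P A \<Longrightarrow> meet P A x y \<in> fibre P A"
  using meet_exists by (auto simp: is_meet_def le_def)

lemma imp_fibre: "x \<in> fibre P A \<Longrightarrow> y \<in> fibre P A \<Longrightarrow> imp P A x y \<in> fibre P A"
  using imp_exists by (auto simp: is_imp_def)

lemma top_fibre: "A \<in> Obj E \<Longrightarrow> top_of P A \<in> fibre P A"
  and bot_fibre: "A \<in> Obj E \<Longrightarrow> bot_of P A \<in> fibre P A"
  using top_exists bot_exists by (auto simp: is_top_def is_bot_def)

lemma reindex_heyting:
  assumes "f \<in> Hom E A B"
  shows "is_top P B t \<Longrightarrow> is_top P A (reindex P f t)"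
    and "is_bot P B b \<Longrightarrow> is_bot P A (reindex P f b)"
    and "is_meet P B x y z \<Longrightarrow> x \<in> fibre P B \<Longrightarrow> y \<in> fibre P B \<Longrightarrow>
      is_meet P A (reindex P f x) (reindex P f y) (reindex P f z)"
    and "is_imp P B x y z \<Longrightarrow> x \<in> fibre P B \<Longrightarrow> y \<in> fibre P B \<Longrightarrow>
      is_imp P A (reindex P f x) (reindex P f y) (reindex P f z)"
  using trip assms unfolding tripos_def reindexing_preserves_heyting_def by blast+

lemma ent_top:
  assumes "is_top P A t" "\<theta> \<in> Pred" "a \<in> Hom E (ob \<theta>) A"
  shows "ent \<theta> a t"
proof -
  have "\<theta> \<in> fibre P (ob \<theta>)" "t \<in> fibre P A" using assms by (auto simp: fibre_def is_top_def)
  then show ?thesis using ent_id_iff reindex_heyting(1)[OF assms(3,1)] assms(3) by (auto simp: is_top_def)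
qed

text \<open>Reindexed falsity is falsity over the context of the stage and lies below every
  predicate there, so the conclusion may concern an element \<open>c\<close> of any type.\<close>

lemma ent_bot:
  assumes "is_bot P A b" "ent \<theta> a b" "c \<in> Hom E (ob \<theta>) (ob \<chi>)" "\<chi> \<in> Pred"
  shows "ent \<theta> c \<chi>"
proof -
  have b: "b \<in> fibre P A" using assms(1) by (simp add: is_bot_def)
  have t: "\<theta> \<in> fibre P (ob \<theta>)" and x: "\<chi> \<in> fibre P (ob \<chi>)" using assms ent_dom by (auto simp: fibre_def)
  have a: "a \<in> Hom E (ob \<theta>) A" using ent_hom[OF assms(2)] b by (simp add: fibre_def)
  have "le P (ob \<theta>) \<theta> (reindex P a b)" using ent_id_iff[OF t a b] assms(2) by blast
  moreover have "le P (ob \<theta>) (reindex P a b) (reindex P c \<chi>)"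
    using reindex_heyting(2)[OF a assms(1)] reindex_fibre[OF assms(3) x] by (auto simp: is_bot_def)
  ultimately show ?thesis using ent_id_iff[OF t assms(3) x] le_trans by blast
qed

lemma ent_is_meet:
  assumes z: "is_meet P A x y z"
  shows "ent \<theta> a z \<longleftrightarrow> ent \<theta> a x \<and> ent \<theta> a y"
proof -
  have f: "x \<in> fibre P A" "y \<in> fibre P A" "z \<in> fibre P A" and l: "le P A z x" "le P A z y"
    using z by (auto simp: is_meet_def le_def)
  have "ent \<theta> a z" if e: "ent \<theta> a x" "ent \<theta> a y"
  proof -
    have a: "a \<in> Hom E (ob \<theta>) A" using ent_hom[OF e(1)] f by (simp add: fibre_def)
    have t: "\<theta> \<in> fibre P (ob \<theta>)" using ent_dom e by (auto simp: fibre_def)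
    have "le P (ob \<theta>) \<theta> (reindex P a z)"
      using reindex_heyting(3)[OF a z f(1,2)] e ent_id_iff[OF t a] f t by (auto simp: is_meet_def)
    then show ?thesis using ent_id_iff[OF t a f(3)] by blast
  qed
  then show ?thesis using le_ent_mono l by blast
qed

lemma ent_meet:
  "x \<in> fibre P A \<Longrightarrow> y \<in> fibre P A \<Longrightarrow> ent \<theta> a (meet P A x y) \<longleftrightarrow> ent \<theta> a x \<and> ent \<theta> a y"
  using ent_is_meet meet_exists by blast

text \<open>The Kripke clause. From right to left it suffices to look at one later stage, the
  generic one at which \<open>x\<close> holds.\<close>

lemma ent_imp:
  assumes x: "x \<in> fibre P A" and y: "y \<in> fibre P A" and t: "\<theta> \<in> Pred" and a: "a \<in> Hom E (ob \<theta>) A"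
  shows "ent \<theta> a (imp P A x y) \<longleftrightarrow> (\<forall>f \<theta>'. ent \<theta>' f \<theta> \<longrightarrow> ent \<theta>' (a \<cdot> f) x \<longrightarrow> ent \<theta>' (a \<cdot> f) y)"
    (is "?l \<longleftrightarrow> ?r")
proof
  let ?z = "imp P A x y"
  note z = imp_fibre[OF x y] and zi = imp_exists[OF x y]
  show ?r if l: ?l
  proof (intro allI impI)
    fix f \<theta>' assume f: "ent \<theta>' f \<theta>" and ex: "ent \<theta>' (a \<cdot> f) x"
    have ff: "a \<cdot> f \<in> Hom E (ob \<theta>') A" using ent_restrict[OF f a] .
    have t': "\<theta>' \<in> fibre P (ob \<theta>')" using f ent_dom by (auto simp: fibre_def)
    have "le P (ob \<theta>') \<theta>' (reindex P (a \<cdot> f) x)" using ent_id_iff[OF t' ff x] ex by blast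
    \<comment> \<open>As \<open>\<theta>'\<close> already entails \<open>x\<close> at this element,
      it is its own meet with that instance; this is the meet inserted into
      \<open>is_imp\<close>.\<close>
    then have "is_meet P (ob \<theta>') \<theta>' (reindex P (a \<cdot> f) x) \<theta>'"
      using le_refl[OF t'] by (auto simp: is_meet_def)
    moreover have "le P (ob \<theta>') \<theta>' (reindex P (a \<cdot> f) ?z)"
      using ent_id_iff[OF t' ff z] ent_comp[OF f l] by blast
    ultimately have "le P (ob \<theta>') \<theta>' (reindex P (a \<cdot> f) y)"
      using reindex_heyting(4)[OF ff zi x y] t' unfolding is_imp_def by blast
    then show "ent \<theta>' (a \<cdot> f) y" using ent_id_iff[OF t' ff y] by blast
  qed
  show ?l if r: ?r
  proof -
    have tt: "\<theta> \<in> fibre P (ob \<theta>)" using t by (simp add: fibre_def)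
    have xf: "reindex P a x \<in> fibre P (ob \<theta>)" using reindex_fibre[OF a x] .
    \<comment> \<open>The generic later stage at which \<open>x\<close> holds of
      \<open>a\<close>.\<close>
    let ?v = "meet P (ob \<theta>) \<theta> (reindex P a x)"
    note v = meet_exists[OF tt xf] and vf = meet_fibre[OF tt xf]
    have I: "idt E (ob \<theta>) \<in> Hom E (ob \<theta>) (ob \<theta>)" using id_hom Hom_Obj(1)[OF a] .
    have ov: "ob ?v = ob \<theta>" using vf by (simp add: fibre_def)
    have 1: "ent ?v (idt E (ob \<theta>)) \<theta>" "ent ?v (idt E (ob \<theta>)) (reindex P a x)"
      using v by (auto simp: is_meet_def le_ent)
    then have "ent ?v (a \<cdot> idt E (ob \<theta>)) x" using ent_reindex[OF a x] I ov by simp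
    then have "ent ?v a y" using r 1 comp_id[OF a] by metis
    then have "le P (ob \<theta>) ?v (reindex P a y)" using ent_id_iff[OF vf a y] by blast
    then have "le P (ob \<theta>) \<theta> (reindex P a ?z)"
      using reindex_heyting(4)[OF a zi x y] v tt unfolding is_imp_def by blast
    then show ?l using ent_id_iff[OF tt a z] by blast
  qed
qed

lemma forall_exists: "u \<in> Hom E A B \<Longrightarrow> \<phi> \<in> fibre P A \<Longrightarrow> \<exists>\<psi>. is_forall P u \<phi> \<psi>"
  using trip unfolding tripos_def has_forall_beck_chevalley_def by (metis Hom_Arr Hom_src)

lemma forall_fibre: "u \<in> Hom E A B \<Longrightarrow> is_forall P u \<phi> \<psi> \<Longrightarrow> \<psi> \<in> fibre P B"
  unfolding is_forall_def by (simp add: Hom_tgt)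

text \<open>Beck-Chevalley along the pullback of \<open>u\<close> and \<open>b\<close> turns the
  quantifier at \<open>b\<close> into one along \<open>q\<close>. The reindexing of
  \<open>\<theta>\<close> along \<open>q\<close>, with \<open>p\<close> as its element, is then the
  generic instance, through which all others factor.\<close>

lemma ent_forall:
  assumes u: "u \<in> Hom E A B" and x: "\<phi> \<in> fibre P A" and all: "is_forall P u \<phi> \<psi>"
    and t: "\<theta> \<in> Pred" and b: "b \<in> Hom E (ob \<theta>) B"
  shows "ent \<theta> b \<psi> \<longleftrightarrow> (\<forall>f \<theta>' a. ent \<theta>' f \<theta> \<longrightarrow> a \<in> Hom E (ob \<theta>') A \<longrightarrow> u \<cdot> a = b \<cdot> f \<longrightarrow> ent \<theta>' a \<phi>)"
    (is "?l \<longleftrightarrow> ?r")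
proof -
  obtain p q where pb: "is_pullback E u b p q" using pullback_exists[OF u b] .
  note h = pullback_Hom[OF pb u b]
  have psi: "\<psi> \<in> fibre P B" using forall_fibre[OF u all] .
  have tt: "\<theta> \<in> fibre P (ob \<theta>)" using t by (simp add: fibre_def)
  have "is_forall P q (reindex P p \<phi>) (reindex P b \<psi>)"
    using trip pb all x Hom_src[OF u] unfolding tripos_def has_forall_beck_chevalley_def by blast
  then have iff: "le P (ob \<theta>) \<theta> (reindex P b \<psi>) \<longleftrightarrow> le P (src E p) (reindex P q \<theta>) (reindex P p \<phi>)"
    using tt by (simp add: is_forall_def Hom_tgt[OF h(2)] Hom_src[OF h(2)])
  have qt: "reindex P q \<theta> \<in> fibre P (src E p)" using reindex_fibre[OF h(2) tt] .
  have oq: "ob (reindex P q \<theta>) = src E p" "reindex P q \<theta> \<in> Pred" using qt by (auto simp: fibre_def)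
  have "?l \<longleftrightarrow> ent (reindex P q \<theta>) p \<phi>"
    using iff ent_id_iff[OF tt b psi] ent_id_iff[OF qt h(1) x] by blast
  also have "\<dots> \<longleftrightarrow> ?r"
  proof
    assume e: "ent (reindex P q \<theta>) p \<phi>"
    show ?r
    proof (intro allI impI)
      fix f \<theta>' a assume f: "ent \<theta>' f \<theta>" and a: "a \<in> Hom E (ob \<theta>') A" and ab: "u \<cdot> a = b \<cdot> f"
      obtain k where k: "k \<in> Hom E (ob \<theta>') (src E p)" "p \<cdot> k = a" "q \<cdot> k = f"
        using pullback_lift[OF pb u b a ent_hom[OF f] ab] .
      have "ent \<theta>' k (reindex P q \<theta>)" using ent_reindex[OF h(2) tt k(1)] k f by simp
      then show "ent \<theta>' a \<phi>" using ent_comp e k by metis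
    qed
  next
    assume r: ?r
    have "ent (reindex P q \<theta>) q \<theta>"
      using ent_reindex[OF h(2) tt, of "idt E (src E p)" "reindex P q \<theta>"] ent_refl[OF oq(2)] oq(1)
        id_hom[OF Hom_Obj(1)[OF h(2)]] comp_id[OF h(2)] by simp
    then show "ent (reindex P q \<theta>) p \<phi>" using r h oq by auto
  qed
  finally show ?thesis .
qed

text \<open>The second-order encoding of the existential quantifier: \<open>\<exists>a. u a = b \<and> \<phi> a\<close> is
  \<open>\<forall>p : Prop. (\<forall>a. u a = b \<longrightarrow> \<phi> a \<longrightarrow> p) \<longrightarrow> p\<close>.\<close>

lemma exists_exists:
  assumes u: "u \<in> Hom E A B" and x: "\<phi> \<in> fibre P A"
  shows "\<exists>\<psi>. is_exists P u \<phi> \<psi>"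
proof -
  obtain Prp tr where Prp: "Prp \<in> Obj E" and tr: "tr \<in> fibre P Prp"
    and gen: "\<And>A \<phi>. A \<in> Obj E \<Longrightarrow> \<phi> \<in> fibre P A \<Longrightarrow> \<exists>f\<in>Hom E A Prp. fib_iso P A \<phi> (reindex P f tr)"
    using trip unfolding tripos_def has_generic_predicate_def by blast
  note AB = Hom_Obj[OF u]
  let ?V = "prd E A Prp" and ?W = "prd E B Prp"
  note v1 = pr1_hom[OF AB(1) Prp] and v2 = pr2_hom[OF AB(1) Prp]
  note w1 = pr1_hom[OF AB(2) Prp] and w2 = pr2_hom[OF AB(2) Prp]
  let ?uu = "tuple E (u \<cdot> pr1 E A Prp) (pr2 E A Prp)"
  have uu: "?uu \<in> Hom E ?V ?W" using tuple_hom[OF comp_hom[OF u v1] v2] .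
  have uu_app: "?uu \<cdot> tuple E a y = tuple E (u \<cdot> a) y"
    if a: "a \<in> Hom E X A" and y: "y \<in> Hom E X Prp" for a y X
    using tuple_comp[OF comp_hom[OF u v1] v2 tuple_hom[OF a y]] assoc[OF u v1 tuple_hom[OF a y]]
      pr1_tuple[OF a y] pr2_tuple[OF a y] by simp
  let ?f = "reindex P (pr1 E A Prp) \<phi>" and ?t = "reindex P (pr2 E A Prp) tr"
  let ?s = "reindex P (pr2 E B Prp) tr"
  have f: "?f \<in> fibre P ?V" and tf: "?t \<in> fibre P ?V" and sf: "?s \<in> fibre P ?W"
    using reindex_fibre v1 v2 w2 x tr by blast+
  \<comment> \<open>At \<open>(a, y)\<close> this reads \<open>\<phi> a \<longrightarrow> y\<close>.
    Then \<open>\<psi>1\<close> at \<open>(b, y)\<close> is the premise of the encoding, universal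
    over the \<open>a\<close> with \<open>u a = b\<close>, and \<open>?\<beta>\<close> adds the
    conclusion \<open>y\<close>.\<close>
  let ?\<alpha> = "imp P ?V ?f ?t"
  have al: "?\<alpha> \<in> fibre P ?V" using imp_fibre[OF f tf] .
  obtain \<psi>1 where \<psi>1: "is_forall P ?uu ?\<alpha> \<psi>1" using forall_exists[OF uu al] by blast
  have p1: "\<psi>1 \<in> fibre P ?W" using forall_fibre[OF uu \<psi>1] .
  let ?\<beta> = "imp P ?W \<psi>1 ?s"
  have be: "?\<beta> \<in> fibre P ?W" using imp_fibre[OF p1 sf] .
  obtain \<psi> where \<psi>: "is_forall P (pr1 E B Prp) ?\<beta> \<psi>" using forall_exists[OF w1 be] by blast
  have pf: "\<psi> \<in> fibre P B" using forall_fibre[OF w1 \<psi>] .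
  have of: "ob \<phi> = A" "\<phi> \<in> Pred" "ob \<psi> = B" "\<psi> \<in> Pred" "ob tr = Prp"
    using x pf tr by (auto simp: fibre_def)
  have unit: "ent \<phi> u \<psi>"
    unfolding ent_forall[OF w1 be \<psi> of(2) u[folded of(1)]]
  proof (intro allI impI)
    fix f \<theta> w assume e: "ent \<theta> f \<phi>" and w: "w \<in> Hom E (ob \<theta>) ?W" and ww: "pr1 E B Prp \<cdot> w = u \<cdot> f"
    note fh = ent_hom[OF e, unfolded of]
    obtain y where y: "y \<in> Hom E (ob \<theta>) Prp" "w = tuple E (u \<cdot> f) y"
      using tuple_cases[OF w AB(2) Prp] ww by metis
    show "ent \<theta> w ?\<beta>"
      unfolding ent_imp[OF p1 sf ent_dom[OF e] w]
    proof (intro allI impI)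
      fix g \<theta>' assume g: "ent \<theta>' g \<theta>" and h: "ent \<theta>' (w \<cdot> g) \<psi>1"
      note gh = ent_hom[OF g]
      have wg: "w \<cdot> g \<in> Hom E (ob \<theta>') ?W" using comp_hom[OF w gh] .
      have t': "\<theta>' \<in> Pred" using ent_dom[OF g] .
      note hh = h[unfolded ent_forall[OF uu al \<psi>1 t' wg], rule_format]
      let ?a = "tuple E (f \<cdot> g) (y \<cdot> g)"
      have fg: "f \<cdot> g \<in> Hom E (ob \<theta>') A" and yg: "y \<cdot> g \<in> Hom E (ob \<theta>') Prp"
        using comp_hom fh y(1) gh by blast+
      have a: "?a \<in> Hom E (ob \<theta>') ?V" using tuple_hom[OF fg yg] .
      have "w \<cdot> g = tuple E (u \<cdot> (f \<cdot> g)) (y \<cdot> g)"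
        using tuple_comp[OF comp_hom[OF u fh] y(1) gh] y(2) assoc[OF u fh gh] by simp
      then have "ent \<theta>' ?a ?\<alpha>"
        using hh[OF ent_refl[OF t'] a] uu_app[OF fg yg] comp_id[OF wg] by simp
      moreover have "ent \<theta>' ?a ?f"
        using ent_reindex[OF v1 x a] pr1_tuple[OF fg yg] ent_comp[OF g e] by simp
      ultimately have "ent \<theta>' ?a ?t"
        using ent_imp[OF f tf t' a] ent_refl[OF t'] comp_id[OF a] by metis
      then have "ent \<theta>' (y \<cdot> g) tr" using ent_reindex[OF v2 tr a] pr2_tuple[OF fg yg] by simp
      moreover have "pr2 E B Prp \<cdot> (w \<cdot> g) = y \<cdot> g"
        using assoc[OF w2 w gh] pr2_tuple[OF comp_hom[OF u fh] y(1)] y(2) by simp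
      ultimately show "ent \<theta>' (w \<cdot> g) ?s" using ent_reindex[OF w2 tr wg] by simp
    qed
  qed
  have "le P B \<psi> \<chi>" if c: "\<chi> \<in> fibre P B" and e: "ent \<phi> u \<chi>" for \<chi>
  proof -
    \<comment> \<open>The bound proposition is instantiated with a name \<open>k\<close> of
      \<open>\<chi>\<close>, supplied by the generic predicate.\<close>
    obtain k where k: "k \<in> Hom E B Prp" and iso: "fib_iso P B \<chi> (reindex P k tr)"
      using gen[OF AB(2) c] by blast
    let ?w = "tuple E (idt E B) k"
    have I: "idt E B \<in> Hom E B B" using id_hom[OF AB(2)] .
    have w: "?w \<in> Hom E B ?W" using tuple_hom[OF I k] .
    have "ent \<psi> ?w ?\<beta>"
      using ent_forall[OF w1 be \<psi>, of \<psi> "idt E B"] ent_refl[OF of(4)] w pr1_tuple[OF I k] comp_id[OF I] of I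
      by (metis)
    then have imp: "ent \<psi> ?w \<psi>1 \<Longrightarrow> ent \<psi> ?w ?s"
      using ent_imp[OF p1 sf of(4), unfolded of, OF w] ent_refl[OF of(4)] comp_id[OF w] of by metis
    have "ent \<psi> ?w \<psi>1"
      unfolding ent_forall[OF uu al \<psi>1 of(4), unfolded of, OF w]
    proof (intro allI impI)
      fix f \<theta> a assume g: "ent \<theta> f \<psi>" and a: "a \<in> Hom E (ob \<theta>) ?V" and ua: "?uu \<cdot> a = ?w \<cdot> f"
      have fh: "f \<in> Hom E (ob \<theta>) B" using ent_hom[OF g] of by simp
      obtain a1 a2 where a1: "a1 \<in> Hom E (ob \<theta>) A" and a2: "a2 \<in> Hom E (ob \<theta>) Prp" and aa: "a = tuple E a1 a2"
        using tuple_cases[OF a AB(1) Prp] by metis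
      have "tuple E (u \<cdot> a1) a2 = tuple E f (k \<cdot> f)"
        using ua uu_app[OF a1 a2] aa tuple_comp[OF I k fh] id_comp[OF fh] by simp
      then have ua1: "u \<cdot> a1 = f" and ka: "a2 = k \<cdot> f"
        using tuple_inj[OF _ comp_hom[OF u a1] a2 fh comp_hom[OF k fh]] by blast+
      show "ent \<theta> a ?\<alpha>"
        unfolding ent_imp[OF f tf ent_dom[OF g] a]
      proof (intro allI impI)
        fix h \<theta>' assume h: "ent \<theta>' h \<theta>" and ef: "ent \<theta>' (a \<cdot> h) ?f"
        note hh = ent_hom[OF h]
        have ah: "a \<cdot> h = tuple E (a1 \<cdot> h) (a2 \<cdot> h)" using tuple_comp[OF a1 a2 hh] aa by simp
        note ahh = comp_hom[OF a1 hh] comp_hom[OF a2 hh]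
        have "ent \<theta>' (a1 \<cdot> h) \<phi>"
          using ef ent_reindex[OF v1 x comp_hom[OF a hh]] pr1_tuple[OF ahh] ah by simp
        then have "ent \<theta>' (u \<cdot> (a1 \<cdot> h)) \<chi>" using ent_comp e by blast
        then have "ent \<theta>' (u \<cdot> (a1 \<cdot> h)) (reindex P k tr)" using iso le_ent_mono by (auto simp: fib_iso_def)
        then have "ent \<theta>' (k \<cdot> (u \<cdot> (a1 \<cdot> h))) tr" using ent_reindex[OF k tr comp_hom[OF u ahh(1)]] by simp
        moreover have "k \<cdot> (u \<cdot> (a1 \<cdot> h)) = a2 \<cdot> h"
          using assoc[OF u a1 hh] ua1 assoc[OF k fh hh] ka by simp
        ultimately show "ent \<theta>' (a \<cdot> h) ?t"
          using ent_reindex[OF v2 tr comp_hom[OF a hh]] pr2_tuple[OF ahh] ah by simp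
      qed
    qed
    then have "ent \<psi> ?w ?s" by (rule imp)
    then have "ent \<psi> k tr" using ent_reindex[OF w2 tr, of ?w \<psi>] w of pr2_tuple[OF I k] by simp
    then have "le P B \<psi> (reindex P k tr)" using ent_id_iff[OF pf k tr] by blast
    then show ?thesis using iso le_trans by (auto simp: fib_iso_def)
  qed
  moreover have "ent \<phi> u \<chi>" if "le P B \<psi> \<chi>" for \<chi> using le_ent_mono[OF that unit] .
  ultimately have "is_exists P u \<phi> \<psi>"
    using pf ent_id_iff[OF x u] by (auto simp: is_exists_def Hom_src[OF u] Hom_tgt[OF u])
  then show ?thesis by blast
qed

lemma
  assumes u: "u \<in> Hom E A B" and x: "\<phi> \<in> fibre P A"
  shows ex_fibre: "ex P u \<phi> \<in> fibre P B"
    and ex_le: "\<chi> \<in> fibre P B \<Longrightarrow> le P B (ex P u \<phi>) \<chi> \<longleftrightarrow> ent \<phi> u \<chi>"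
  using someI_ex[OF exists_exists[OF u x]] ent_id_iff[OF x u]
  by (auto simp: ex_def is_exists_def Hom_src[OF u] Hom_tgt[OF u])

text \<open>The clause on which all later reasoning rests: an existential holds iff it has a witness
  on some cover. The substance is the left-to-right direction, which contains Beck-Chevalley and
  Frobenius for \<open>ex\<close>; both come out of implication and universal quantification,
  avoiding a computation with adjoints.\<close>

lemma ent_ex:
  assumes u: "u \<in> Hom E A B" and x: "\<phi> \<in> fibre P A" and b: "b \<in> Hom E (ob \<theta>) B"
  shows "ent \<theta> b (ex P u \<phi>) \<longleftrightarrow> (\<exists>f \<theta>' a. covers f \<theta>' \<theta> \<and> a \<in> Hom E (ob \<theta>') A \<and> u \<cdot> a = b \<cdot> f \<and> ent \<theta>' a \<phi>)"
    (is "?l \<longleftrightarrow> ?r")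
proof
  note exf = ex_fibre[OF u x]
  have oe: "ob (ex P u \<phi>) = B" "ex P u \<phi> \<in> Pred" using exf by (auto simp: fibre_def)
  have unit: "ent \<phi> u (ex P u \<phi>)" using ex_le[OF u x exf] le_refl[OF exf] by blast
  show ?l if r: ?r
  proof -
    obtain f \<theta>' a where c: "covers f \<theta>' \<theta>" and ua: "u \<cdot> a = b \<cdot> f" and e: "ent \<theta>' a \<phi>" using r by blast
    have "ent \<theta>' (b \<cdot> f) (ex P u \<phi>)" using ent_comp[OF e unit] ua by simp
    then show ?l using covers_local[OF c] b oe by simp
  qed
  show ?r if l: ?l
  proof -
    have t: "\<theta> \<in> Pred" using ent_dom[OF l] .
    have tf: "\<theta> \<in> fibre P (ob \<theta>)" using t by (simp add: fibre_def)
    obtain p q where pb: "is_pullback E b u p q" using pullback_exists[OF b u] .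
    note h = pullback_Hom[OF pb b u]
    let ?X = "src E p"
    have pt: "reindex P p \<theta> \<in> fibre P ?X" and qx: "reindex P q \<phi> \<in> fibre P ?X"
      using reindex_fibre h x tf by blast+
    \<comment> \<open>The candidate cover: pairs of an element of the stage and an \<open>a\<close>
      with \<open>u a = b\<close>, restricted to where \<open>\<theta>\<close> and
      \<open>\<phi>\<close> hold.\<close>
    let ?t = "meet P ?X (reindex P p \<theta>) (reindex P q \<phi>)"
    have mt: "?t \<in> fibre P ?X" using meet_fibre[OF pt qx] .
    have ot: "ob ?t = ?X" "?t \<in> Pred" using mt by (auto simp: fibre_def)
    have I: "idt E ?X \<in> Hom E ?X ?X" using id_hom Hom_Obj h by blast
    have ent_t: "ent \<theta>' k ?t \<longleftrightarrow> ent \<theta>' (p \<cdot> k) \<theta> \<and> ent \<theta>' (q \<cdot> k) \<phi>" if "k \<in> Hom E (ob \<theta>') ?X" for \<theta>' k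
      using ent_meet[OF pt qx] ent_reindex[OF h(1) tf that] ent_reindex[OF h(2) x that] by simp
    have tp: "ent ?t p \<theta>" and tq: "ent ?t q \<phi>"
      using ent_t[of "idt E ?X" ?t] ot I ent_refl[OF ot(2)] comp_id h by auto
    have "covers p ?t \<theta>"
      unfolding covers_def
    proof (intro conjI allI impI)
      show "ent ?t p \<theta>" by fact
      fix a \<chi> assume a: "a \<in> Hom E (ob \<theta>) (ob \<chi>)" and e: "ent ?t (a \<cdot> p) \<chi>"
      have cf: "\<chi> \<in> fibre P (ob \<chi>)" using ent_cod[OF e] by (simp add: fibre_def)
      have af: "reindex P a \<chi> \<in> fibre P (ob \<theta>)" using reindex_fibre[OF a cf] .
      let ?k = "imp P (ob \<theta>) \<theta> (reindex P a \<chi>)"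
      have kf: "?k \<in> fibre P (ob \<theta>)" using imp_fibre[OF tf af] .
      \<comment> \<open>For descent, \<open>\<omega> y\<close> says that every \<open>x\<close> in
        the context of the stage with \<open>b x = y\<close> satisfies
        \<open>\<theta> x \<longrightarrow> \<chi> (a x)\<close>. It is implied by
        \<open>\<phi>\<close> along \<open>u\<close>, hence by the existential, and evaluating it at
        the stage's own element gives \<open>\<chi>\<close>.\<close>
      obtain \<omega> where om: "is_forall P b ?k \<omega>" using forall_exists[OF b kf] by blast
      have of: "\<omega> \<in> fibre P B" using forall_fibre[OF b om] .
      have ox: "ob \<phi> = A" "\<phi> \<in> Pred" using x by (auto simp: fibre_def)
      have "ent \<phi> u \<omega>"
        unfolding ent_forall[OF b kf om ox(2) u[folded ox(1)]]
      proof (intro allI impI)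
        fix f \<theta>' a' assume f: "ent \<theta>' f \<phi>" and a': "a' \<in> Hom E (ob \<theta>') (ob \<theta>)" and ba: "b \<cdot> a' = u \<cdot> f"
        note fh = ent_hom[OF f, unfolded ox]
        show "ent \<theta>' a' ?k"
          unfolding ent_imp[OF tf af ent_dom[OF f] a']
        proof (intro allI impI)
          fix g \<theta>'' assume g: "ent \<theta>'' g \<theta>'" and ag: "ent \<theta>'' (a' \<cdot> g) \<theta>"
          note gh = ent_hom[OF g]
          have "b \<cdot> (a' \<cdot> g) = u \<cdot> (f \<cdot> g)"
            using assoc[OF b a' gh] assoc[OF u fh gh] ba by simp
          then obtain k where k: "k \<in> Hom E (ob \<theta>'') ?X" "p \<cdot> k = a' \<cdot> g" "q \<cdot> k = f \<cdot> g"
            using pullback_lift[OF pb b u comp_hom[OF a' gh] comp_hom[OF fh gh]] by metis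
          have "ent \<theta>'' k ?t" using ent_t[OF k(1)] k(2,3) ag ent_comp[OF g f] by simp
          then have "ent \<theta>'' (a \<cdot> p \<cdot> k) \<chi>" using ent_comp e by blast
          then have "ent \<theta>'' (a \<cdot> (a' \<cdot> g)) \<chi>" using assoc[OF a h(1) k(1)] k(2) by simp
          then show "ent \<theta>'' (a' \<cdot> g) (reindex P a \<chi>)"
            using ent_reindex[OF a cf comp_hom[OF a' gh]] by simp
        qed
      qed
      then have "le P B (ex P u \<phi>) \<omega>" using ex_le[OF u x of] by blast
      then have "ent \<theta> b \<omega>" using le_ent_mono l by blast
      then have "ent \<theta> (idt E (ob \<theta>)) ?k"
        using ent_forall[OF b kf om t b] ent_refl[OF t] id_hom[OF proj_ob[OF t]] by blast
      then have "ent \<theta> (idt E (ob \<theta>)) (reindex P a \<chi>)"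
        using ent_imp[OF tf af t id_hom[OF proj_ob[OF t]]] ent_refl[OF t] comp_id[OF id_hom[OF proj_ob[OF t]]] by metis
      then show "ent \<theta> a \<chi>"
        using ent_reindex[OF a cf id_hom[OF proj_ob[OF t]]] comp_id[OF a] by simp
    qed
    then show ?r using h tq ot by metis
  qed
qed

end

context preorder_fib begin

section \<open>Relations at a stage\<close>

text \<open>Typing is part of the relation, so later statements can quantify over all arrows
  \<open>c\<close> and \<open>d\<close>; on arrows of the wrong type \<open>tuple\<close> is an
  unspecified value.\<close>

definition rl :: "'p \<Rightarrow> 'o \<Rightarrow> 'o \<Rightarrow> 'p \<Rightarrow> 'a \<Rightarrow> 'a \<Rightarrow> bool" where
  "rl \<phi> A B \<theta> c d \<longleftrightarrow> c \<in> Hom E (ob \<theta>) A \<and> d \<in> Hom E (ob \<theta>) B \<and> ent \<theta> (tuple E c d) \<phi>"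

definition eqv :: "'o \<times> 'p \<Rightarrow> 'p \<Rightarrow> 'a \<Rightarrow> 'a \<Rightarrow> bool" where
  "eqv X = rl (snd X) (fst X) (fst X)"

lemma rl_hom: "rl \<phi> A B \<theta> c d \<Longrightarrow> c \<in> Hom E (ob \<theta>) A" "rl \<phi> A B \<theta> c d \<Longrightarrow> d \<in> Hom E (ob \<theta>) B"
  "rl \<phi> A B \<theta> c d \<Longrightarrow> \<theta> \<in> Pred"
  by (auto simp: rl_def ent_dom)

lemma eqv_hom: "eqv X \<theta> a b \<Longrightarrow> a \<in> Hom E (ob \<theta>) (fst X)" "eqv X \<theta> a b \<Longrightarrow> b \<in> Hom E (ob \<theta>) (fst X)"
  "eqv X \<theta> a b \<Longrightarrow> \<theta> \<in> Pred"
  by (auto simp: eqv_def rl_hom)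

lemma rl_restrict:
  assumes "ent \<theta>' f \<theta>" "rl \<phi> A B \<theta> c d"
  shows "rl \<phi> A B \<theta>' (c \<cdot> f) (d \<cdot> f)"
proof -
  have c: "c \<in> Hom E (ob \<theta>) A" and d: "d \<in> Hom E (ob \<theta>) B" and e: "ent \<theta> (tuple E c d) \<phi>"
    using assms(2) by (auto simp: rl_def)
  show ?thesis
    using ent_comp[OF assms(1) e] tuple_comp[OF c d ent_hom[OF assms(1)]]
      ent_restrict[OF assms(1) c] ent_restrict[OF assms(1) d] by (simp add: rl_def)
qed

lemma rl_local:
  assumes "covers f \<theta>' \<theta>" "rl \<phi> A B \<theta>' (c \<cdot> f) (d \<cdot> f)"
    and c: "c \<in> Hom E (ob \<theta>) A" and d: "d \<in> Hom E (ob \<theta>) B" and "\<phi> \<in> fibre P (prd E A B)"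
  shows "rl \<phi> A B \<theta> c d"
proof -
  have "ent \<theta>' (tuple E c d \<cdot> f) \<phi>"
    using assms(2) tuple_comp[OF c d covers_hom[OF assms(1)]] by (simp add: rl_def)
  then have "ent \<theta> (tuple E c d) \<phi>"
    using covers_local[OF assms(1)] tuple_hom[OF c d] assms(5) by (simp add: fibre_def)
  then show ?thesis using c d by (simp add: rl_def)
qed

lemma rel_fibre:
  assumes "\<phi> \<in> fibre P (prd E A B)" "t \<in> Hom E \<Gamma> A" "u \<in> Hom E \<Gamma> B"
  shows "rel P \<phi> t u \<in> fibre P \<Gamma>"
  unfolding rel_def using reindex_fibre[OF tuple_hom[OF assms(2,3)] assms(1)] .

lemma ent_rel:
  assumes f: "\<phi> \<in> fibre P (prd E A B)" and t: "t \<in> Hom E \<Gamma> A" and u: "u \<in> Hom E \<Gamma> B"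
    and a: "a \<in> Hom E (ob \<theta>) \<Gamma>" and "t \<cdot> a = c" "u \<cdot> a = d"
  shows "ent \<theta> a (rel P \<phi> t u) \<longleftrightarrow> rl \<phi> A B \<theta> c d"
  using ent_reindex[OF tuple_hom[OF t u] f a] tuple_comp[OF t u a] comp_hom[OF t a] comp_hom[OF u a] assms(5,6)
  by (simp add: rel_def rl_def)

text \<open>Contexts in the definitions are iterated products. This splits a quantifier over such a
  context into quantifiers over its variables.\<close>

lemma all_prd:
  assumes "A \<in> Obj E" "B \<in> Obj E"
  shows "(\<forall>a\<in>Hom E X (prd E A B). Q a) \<longleftrightarrow> (\<forall>c\<in>Hom E X A. \<forall>d\<in>Hom E X B. Q (tuple E c d))"
  using tuple_cases[OF _ assms] tuple_hom by metis

lemma le_ent_ball: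
  assumes "x \<in> fibre P A" "y \<in> fibre P A"
  shows "le P A x y \<longleftrightarrow> (\<forall>\<theta>. \<forall>a\<in>Hom E (ob \<theta>) A. ent \<theta> a x \<longrightarrow> ent \<theta> a y)"
  using le_ent_all[OF assms] ent_hom assms(1) by (auto simp: fibre_def)

lemma fib_iso_rl:
  assumes "\<phi> \<in> fibre P (prd E A B)" "\<psi> \<in> fibre P (prd E A B)" "A \<in> Obj E" "B \<in> Obj E"
  shows "fib_iso P (prd E A B) \<phi> \<psi> \<longleftrightarrow> (\<forall>\<theta> c d. rl \<phi> A B \<theta> c d \<longleftrightarrow> rl \<psi> A B \<theta> c d)"
  unfolding fib_iso_def le_ent_ball[OF assms(1,2)] le_ent_ball[OF assms(2,1)] all_prd[OF assms(3,4)] rl_def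
  by blast

lemma covers_trans:
  assumes f: "covers f \<theta>' \<theta>" and g: "covers g \<theta>'' \<theta>'"
  shows "covers (f \<cdot> g) \<theta>'' \<theta>"
  unfolding covers_def
proof (intro conjI allI impI)
  show "ent \<theta>'' (f \<cdot> g) \<theta>" using ent_comp[OF covers_ent[OF g] covers_ent[OF f]] .
  fix a \<chi> assume a: "a \<in> Hom E (ob \<theta>) (ob \<chi>)" and e: "ent \<theta>'' (a \<cdot> (f \<cdot> g)) \<chi>"
  have "ent \<theta>'' (a \<cdot> f \<cdot> g) \<chi>" using e assoc[OF a covers_hom[OF f] covers_hom[OF g]] by simp
  then show "ent \<theta> a \<chi>" using covers_local[OF f covers_local[OF g]] covers_restrict[OF f a] a by blast
qed

end

context tripos_fib begin

abbreviation T :: "('o \<times> 'p, ('o \<times> 'p) \<times> ('o \<times> 'p) \<times> 'p set) cat" where "T \<equiv> tripos_to_topos P"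

text \<open>The internal conditions are entailments in contexts assembled from projections.
  Evaluated at tuples of elements they become the two laws for an ordinary partial equivalence
  relation at every stage.\<close>

lemma is_per_iff:
  "is_per P X \<longleftrightarrow> fst X \<in> Obj E \<and> snd X \<in> fibre P (prd E (fst X) (fst X)) \<and>
     (\<forall>\<theta> a b. eqv X \<theta> a b \<longrightarrow> eqv X \<theta> b a) \<and>
     (\<forall>\<theta> a b c. eqv X \<theta> a b \<longrightarrow> eqv X \<theta> b c \<longrightarrow> eqv X \<theta> a c)"
proof (cases "fst X \<in> Obj E \<and> snd X \<in> fibre P (prd E (fst X) (fst X))")
  case True
  obtain C \<rho> where X: "X = (C, \<rho>)" by (cases X)
  have C: "C \<in> Obj E" and r: "\<rho> \<in> fibre P (prd E C C)" using True X by auto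
  note p1 = pr1_hom[OF C C] and p2 = pr2_hom[OF C C]
  have CC: "prd E C C \<in> Obj E" using prd_Obj[OF C C] .
  note q1 = pr1_hom[OF CC C] and q2 = pr2_hom[OF CC C]
  \<comment> \<open>Since \<open>eqv\<close> implies typing, the bounds on the quantifiers produced
    by \<open>all_prd\<close> disappear again.\<close>
  have hX: "a \<in> Hom E (ob \<theta>) C \<and> b \<in> Hom E (ob \<theta>) C" if "eqv X \<theta> a b" for \<theta> a b
    using eqv_hom that by (auto simp: X)
  have "is_symmetric P C \<rho> \<longleftrightarrow> (\<forall>\<theta> a b. eqv X \<theta> a b \<longrightarrow> eqv X \<theta> b a)"
  proof -
    have *: "ent \<theta> (tuple E a b) (rel P \<rho> (pr1 E C C) (pr2 E C C)) \<longleftrightarrow> eqv X \<theta> a b"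
      "ent \<theta> (tuple E a b) (rel P \<rho> (pr2 E C C) (pr1 E C C)) \<longleftrightarrow> eqv X \<theta> b a"
      if a: "a \<in> Hom E (ob \<theta>) C" and b: "b \<in> Hom E (ob \<theta>) C" for \<theta> a b
      unfolding ent_rel[OF r p1 p2 tuple_hom[OF a b] pr1_tuple[OF a b] pr2_tuple[OF a b]]
        ent_rel[OF r p2 p1 tuple_hom[OF a b] pr2_tuple[OF a b] pr1_tuple[OF a b]]
      by (simp_all add: eqv_def X)
    show ?thesis
      unfolding is_symmetric_def Let_def le_ent_ball[OF rel_fibre[OF r p1 p2] rel_fibre[OF r p2 p1]] all_prd[OF C C]
      using hX by (simp add: * cong: ball_cong_simp) blast
  qed
  moreover have "is_transitive P C \<rho> \<longleftrightarrow> (\<forall>\<theta> a b c. eqv X \<theta> a b \<longrightarrow> eqv X \<theta> b c \<longrightarrow> eqv X \<theta> a c)"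
  proof -
    let ?G = "prd E (prd E C C) C"
    let ?c = "pr1 E C C \<cdot> pr1 E (prd E C C) C" and ?c' = "pr2 E C C \<cdot> pr1 E (prd E C C) C"
      and ?c'' = "pr2 E (prd E C C) C"
    have h: "?c \<in> Hom E ?G C" "?c' \<in> Hom E ?G C" "?c'' \<in> Hom E ?G C" using comp_hom p1 p2 q1 q2 by blast+
    have *: "ent \<theta> (tuple E (tuple E a b) c) (rel P \<rho> ?c ?c') \<longleftrightarrow> eqv X \<theta> a b"
        "ent \<theta> (tuple E (tuple E a b) c) (rel P \<rho> ?c' ?c'') \<longleftrightarrow> eqv X \<theta> b c"
        "ent \<theta> (tuple E (tuple E a b) c) (rel P \<rho> ?c ?c'') \<longleftrightarrow> eqv X \<theta> a c"
      if a: "a \<in> Hom E (ob \<theta>) C" and b: "b \<in> Hom E (ob \<theta>) C" and c: "c \<in> Hom E (ob \<theta>) C" for \<theta> a b c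
    proof -
      let ?t = "tuple E (tuple E a b) c"
      have t: "?t \<in> Hom E (ob \<theta>) ?G" using tuple_hom[OF tuple_hom[OF a b] c] .
      have e: "?c \<cdot> ?t = a" "?c' \<cdot> ?t = b" "?c'' \<cdot> ?t = c"
        using assoc[OF p1 q1 t] assoc[OF p2 q1 t] pr1_tuple[OF tuple_hom[OF a b] c]
          pr2_tuple[OF tuple_hom[OF a b] c] pr1_tuple[OF a b] pr2_tuple[OF a b] by simp_all
      show "ent \<theta> ?t (rel P \<rho> ?c ?c') \<longleftrightarrow> eqv X \<theta> a b" "ent \<theta> ?t (rel P \<rho> ?c' ?c'') \<longleftrightarrow> eqv X \<theta> b c"
        "ent \<theta> ?t (rel P \<rho> ?c ?c'') \<longleftrightarrow> eqv X \<theta> a c"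
        unfolding ent_rel[OF r h(1,2) t e(1,2)] ent_rel[OF r h(2,3) t e(2,3)] ent_rel[OF r h(1,3) t e(1,3)]
        by (simp_all add: eqv_def X)
    qed
    note rf = rel_fibre[OF r h(1,2)] rel_fibre[OF r h(2,3)] rel_fibre[OF r h(1,3)]
    show ?thesis
      unfolding is_transitive_def Let_def le_ent_ball[OF meet_fibre[OF rf(1,2)] rf(3)]
        ent_meet[OF rf(1,2)] all_prd[OF CC C] all_prd[OF C C]
      using hX by (simp add: * cong: ball_cong_simp) blast
  qed
  ultimately show ?thesis using C r by (simp add: is_per_def X)
qed (auto simp: is_per_def)

lemma
  assumes "is_per P X"
  shows per_Obj: "fst X \<in> Obj E" and per_fibre: "snd X \<in> fibre P (prd E (fst X) (fst X))"
    and eqv_sym: "eqv X \<theta> a b \<Longrightarrow> eqv X \<theta> b a"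
    and eqv_trans: "eqv X \<theta> a b \<Longrightarrow> eqv X \<theta> b c \<Longrightarrow> eqv X \<theta> a c"
  using assms unfolding is_per_iff by blast+

lemma eqv_restrict: "ent \<theta>' f \<theta> \<Longrightarrow> eqv X \<theta> a b \<Longrightarrow> eqv X \<theta>' (a \<cdot> f) (b \<cdot> f)"
  by (simp add: eqv_def rl_restrict)

lemma eqv_local: "is_per P X \<Longrightarrow> covers f \<theta>' \<theta> \<Longrightarrow> eqv X \<theta>' (a \<cdot> f) (b \<cdot> f) \<Longrightarrow>
    a \<in> Hom E (ob \<theta>) (fst X) \<Longrightarrow> b \<in> Hom E (ob \<theta>) (fst X) \<Longrightarrow> eqv X \<theta> a b"
  unfolding eqv_def using rl_local per_fibre by blast

text \<open>Stated for a relation of HOL, so that composites and inverse images can be checked from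
  a description of their elements without unfolding the predicate that represents them. Totality
  asks for a value on a cover only.\<close>

definition frel :: "'o \<times> 'p \<Rightarrow> 'o \<times> 'p \<Rightarrow> ('p \<Rightarrow> 'a \<Rightarrow> 'a \<Rightarrow> bool) \<Rightarrow> bool" where
  "frel X Y S \<longleftrightarrow>
     (\<forall>\<theta> c d. S \<theta> c d \<longrightarrow> eqv X \<theta> c c \<and> eqv Y \<theta> d d) \<and>
     (\<forall>\<theta> c d c' d'. S \<theta> c d \<longrightarrow> eqv X \<theta> c c' \<longrightarrow> eqv Y \<theta> d d' \<longrightarrow> S \<theta> c' d') \<and>
     (\<forall>\<theta> c d d'. S \<theta> c d \<longrightarrow> S \<theta> c d' \<longrightarrow> eqv Y \<theta> d d') \<and>
     (\<forall>\<theta> c. eqv X \<theta> c c \<longrightarrow> (\<exists>f \<theta>' d. covers f \<theta>' \<theta> \<and> S \<theta>' (c \<cdot> f) d))"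

lemma functional_relation_iff:
  assumes X: "is_per P X" and Y: "is_per P Y"
  shows "functional_relation P X Y \<phi> \<longleftrightarrow> \<phi> \<in> fibre P (prd E (fst X) (fst Y)) \<and>
     frel X Y (rl \<phi> (fst X) (fst Y))"
proof (cases "\<phi> \<in> fibre P (prd E (fst X) (fst Y))")
  case phi0: True
  obtain C \<rho> where Xe: "X = (C, \<rho>)" by (cases X)
  obtain D \<sigma> where Ye: "Y = (D, \<sigma>)" by (cases Y)
  have C: "C \<in> Obj E" and D: "D \<in> Obj E" and r: "\<rho> \<in> fibre P (prd E C C)" and s: "\<sigma> \<in> fibre P (prd E D D)"
    and phi: "\<phi> \<in> fibre P (prd E C D)"
    using per_Obj[OF X] per_Obj[OF Y] per_fibre[OF X] per_fibre[OF Y] phi0 Xe Ye by auto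
  have CD: "prd E C D \<in> Obj E" using prd_Obj[OF C D] .
  note p1 = pr1_hom[OF C D] and p2 = pr2_hom[OF C D]
  note q1 = pr1_hom[OF CD CD] and q2 = pr2_hom[OF CD CD]
  note r1 = pr1_hom[OF CD D] and r2 = pr2_hom[OF CD D]
  have eX: "rl \<rho> C C = eqv X" and eY: "rl \<sigma> D D = eqv Y" by (simp_all add: eqv_def Xe Ye)
  let ?S = "rl \<phi> C D"
  have hX: "a \<in> Hom E (ob \<theta>) C \<and> b \<in> Hom E (ob \<theta>) C" if "eqv X \<theta> a b" for \<theta> a b
    using eqv_hom that by (auto simp: Xe)
  have hY: "a \<in> Hom E (ob \<theta>) D \<and> b \<in> Hom E (ob \<theta>) D" if "eqv Y \<theta> a b" for \<theta> a b
    using eqv_hom that by (auto simp: Ye)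
  have hS: "c \<in> Hom E (ob \<theta>) C \<and> d \<in> Hom E (ob \<theta>) D" if "?S \<theta> c d" for \<theta> c d
    using rl_hom that by blast
  have 1: "le P (prd E C D) (rel P \<phi> (pr1 E C D) (pr2 E C D))
      (meet P (prd E C D) (rel P \<rho> (pr1 E C D) (pr1 E C D)) (rel P \<sigma> (pr2 E C D) (pr2 E C D))) \<longleftrightarrow>
    (\<forall>\<theta> c d. ?S \<theta> c d \<longrightarrow> eqv X \<theta> c c \<and> eqv Y \<theta> d d)"
  proof -
    note rf = rel_fibre[OF phi p1 p2] rel_fibre[OF r p1 p1] rel_fibre[OF s p2 p2]
    have *: "ent \<theta> (tuple E c d) (rel P \<phi> (pr1 E C D) (pr2 E C D)) \<longleftrightarrow> ?S \<theta> c d"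
      "ent \<theta> (tuple E c d) (rel P \<rho> (pr1 E C D) (pr1 E C D)) \<longleftrightarrow> eqv X \<theta> c c"
      "ent \<theta> (tuple E c d) (rel P \<sigma> (pr2 E C D) (pr2 E C D)) \<longleftrightarrow> eqv Y \<theta> d d"
      if c: "c \<in> Hom E (ob \<theta>) C" and d: "d \<in> Hom E (ob \<theta>) D" for \<theta> c d
      unfolding ent_rel[OF phi p1 p2 tuple_hom[OF c d] pr1_tuple[OF c d] pr2_tuple[OF c d]]
        ent_rel[OF r p1 p1 tuple_hom[OF c d] pr1_tuple[OF c d] pr1_tuple[OF c d]]
        ent_rel[OF s p2 p2 tuple_hom[OF c d] pr2_tuple[OF c d] pr2_tuple[OF c d]] eX eY by simp_all
    show ?thesis
      unfolding le_ent_ball[OF rf(1) meet_fibre[OF rf(2,3)]] ent_meet[OF rf(2,3)] all_prd[OF C D]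
      using hS by (simp add: * cong: ball_cong_simp) blast
  qed
  have 2: "(let \<Gamma> = prd E (prd E C D) (prd E C D);
          c = cmp E (pr1 E C D) (pr1 E (prd E C D) (prd E C D)); d = cmp E (pr2 E C D) (pr1 E (prd E C D) (prd E C D));
          c' = cmp E (pr1 E C D) (pr2 E (prd E C D) (prd E C D)); d' = cmp E (pr2 E C D) (pr2 E (prd E C D) (prd E C D))
      in le P \<Gamma> (meet P \<Gamma> (meet P \<Gamma> (rel P \<phi> c d) (rel P \<rho> c c')) (rel P \<sigma> d d'))
           (rel P \<phi> c' d')) \<longleftrightarrow>
     (\<forall>\<theta> c d c' d'. ?S \<theta> c d \<longrightarrow> eqv X \<theta> c c' \<longrightarrow> eqv Y \<theta> d d' \<longrightarrow> ?S \<theta> c' d')"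
  proof -
    let ?G = "prd E (prd E C D) (prd E C D)"
    let ?c = "pr1 E C D \<cdot> pr1 E (prd E C D) (prd E C D)" and ?d = "pr2 E C D \<cdot> pr1 E (prd E C D) (prd E C D)"
      and ?c' = "pr1 E C D \<cdot> pr2 E (prd E C D) (prd E C D)" and ?d' = "pr2 E C D \<cdot> pr2 E (prd E C D) (prd E C D)"
    have h: "?c \<in> Hom E ?G C" "?d \<in> Hom E ?G D" "?c' \<in> Hom E ?G C" "?d' \<in> Hom E ?G D"
      using comp_hom p1 p2 q1 q2 by blast+
    note rf = rel_fibre[OF phi h(1,2)] rel_fibre[OF r h(1,3)] rel_fibre[OF s h(2,4)] rel_fibre[OF phi h(3,4)]
    have *: "ent \<theta> (tuple E (tuple E c d) (tuple E c' d')) (rel P \<phi> ?c ?d) \<longleftrightarrow> ?S \<theta> c d"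
        "ent \<theta> (tuple E (tuple E c d) (tuple E c' d')) (rel P \<rho> ?c ?c') \<longleftrightarrow> eqv X \<theta> c c'"
        "ent \<theta> (tuple E (tuple E c d) (tuple E c' d')) (rel P \<sigma> ?d ?d') \<longleftrightarrow> eqv Y \<theta> d d'"
        "ent \<theta> (tuple E (tuple E c d) (tuple E c' d')) (rel P \<phi> ?c' ?d') \<longleftrightarrow> ?S \<theta> c' d'"
      if c: "c \<in> Hom E (ob \<theta>) C" and d: "d \<in> Hom E (ob \<theta>) D"
        and c': "c' \<in> Hom E (ob \<theta>) C" and d': "d' \<in> Hom E (ob \<theta>) D" for \<theta> c d c' d'
    proof -
      let ?t = "tuple E (tuple E c d) (tuple E c' d')"
      note t1 = tuple_hom[OF c d] and t2 = tuple_hom[OF c' d']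
      have t: "?t \<in> Hom E (ob \<theta>) ?G" using tuple_hom[OF t1 t2] .
      have e: "?c \<cdot> ?t = c" "?d \<cdot> ?t = d" "?c' \<cdot> ?t = c'" "?d' \<cdot> ?t = d'"
        using assoc[OF p1 q1 t] assoc[OF p2 q1 t] assoc[OF p1 q2 t] assoc[OF p2 q2 t]
          pr1_tuple[OF t1 t2] pr2_tuple[OF t1 t2] pr1_tuple[OF c d] pr2_tuple[OF c d]
          pr1_tuple[OF c' d'] pr2_tuple[OF c' d'] by simp_all
      show "ent \<theta> ?t (rel P \<phi> ?c ?d) \<longleftrightarrow> ?S \<theta> c d" "ent \<theta> ?t (rel P \<rho> ?c ?c') \<longleftrightarrow> eqv X \<theta> c c'"
        "ent \<theta> ?t (rel P \<sigma> ?d ?d') \<longleftrightarrow> eqv Y \<theta> d d'" "ent \<theta> ?t (rel P \<phi> ?c' ?d') \<longleftrightarrow> ?S \<theta> c' d'"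
        unfolding ent_rel[OF phi h(1,2) t e(1,2)] ent_rel[OF r h(1,3) t e(1,3)]
          ent_rel[OF s h(2,4) t e(2,4)] ent_rel[OF phi h(3,4) t e(3,4)] eX eY by simp_all
    qed
    show ?thesis
      unfolding Let_def le_ent_ball[OF meet_fibre[OF meet_fibre[OF rf(1,2)] rf(3)] rf(4)]
        ent_meet[OF meet_fibre[OF rf(1,2)] rf(3)] ent_meet[OF rf(1,2)] all_prd[OF CD CD] all_prd[OF C D]
      using hS hX hY by (simp add: * cong: ball_cong_simp) blast
  qed
  have 3: "(let \<Gamma> = prd E (prd E C D) D;
          c = cmp E (pr1 E C D) (pr1 E (prd E C D) D); d = cmp E (pr2 E C D) (pr1 E (prd E C D) D);
          d' = pr2 E (prd E C D) D
      in le P \<Gamma> (meet P \<Gamma> (rel P \<phi> c d) (rel P \<phi> c d')) (rel P \<sigma> d d')) \<longleftrightarrow>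
     (\<forall>\<theta> c d d'. ?S \<theta> c d \<longrightarrow> ?S \<theta> c d' \<longrightarrow> eqv Y \<theta> d d')"
  proof -
    let ?G = "prd E (prd E C D) D"
    let ?c = "pr1 E C D \<cdot> pr1 E (prd E C D) D" and ?d = "pr2 E C D \<cdot> pr1 E (prd E C D) D"
      and ?d' = "pr2 E (prd E C D) D"
    have h: "?c \<in> Hom E ?G C" "?d \<in> Hom E ?G D" "?d' \<in> Hom E ?G D" using comp_hom p1 p2 r1 r2 by blast+
    note rf = rel_fibre[OF phi h(1,2)] rel_fibre[OF phi h(1,3)] rel_fibre[OF s h(2,3)]
    have *: "ent \<theta> (tuple E (tuple E c d) d') (rel P \<phi> ?c ?d) \<longleftrightarrow> ?S \<theta> c d"
        "ent \<theta> (tuple E (tuple E c d) d') (rel P \<phi> ?c ?d') \<longleftrightarrow> ?S \<theta> c d'"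
        "ent \<theta> (tuple E (tuple E c d) d') (rel P \<sigma> ?d ?d') \<longleftrightarrow> eqv Y \<theta> d d'"
      if c: "c \<in> Hom E (ob \<theta>) C" and d: "d \<in> Hom E (ob \<theta>) D" and d': "d' \<in> Hom E (ob \<theta>) D" for \<theta> c d d'
    proof -
      let ?t = "tuple E (tuple E c d) d'"
      note t1 = tuple_hom[OF c d]
      have t: "?t \<in> Hom E (ob \<theta>) ?G" using tuple_hom[OF t1 d'] .
      have e: "?c \<cdot> ?t = c" "?d \<cdot> ?t = d" "?d' \<cdot> ?t = d'"
        using assoc[OF p1 r1 t] assoc[OF p2 r1 t] pr1_tuple[OF t1 d'] pr2_tuple[OF t1 d']
          pr1_tuple[OF c d] pr2_tuple[OF c d] by simp_all
      show "ent \<theta> ?t (rel P \<phi> ?c ?d) \<longleftrightarrow> ?S \<theta> c d" "ent \<theta> ?t (rel P \<phi> ?c ?d') \<longleftrightarrow> ?S \<theta> c d'"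
        "ent \<theta> ?t (rel P \<sigma> ?d ?d') \<longleftrightarrow> eqv Y \<theta> d d'"
        unfolding ent_rel[OF phi h(1,2) t e(1,2)] ent_rel[OF phi h(1,3) t e(1,3)]
          ent_rel[OF s h(2,3) t e(2,3)] eY by simp_all
    qed
    show ?thesis
      unfolding Let_def le_ent_ball[OF meet_fibre[OF rf(1,2)] rf(3)]
        ent_meet[OF rf(1,2)] all_prd[OF CD D] all_prd[OF C D]
      using hS by (simp add: * cong: ball_cong_simp) blast
  qed
  have 4: "le P C (rel P \<rho> (idt E C) (idt E C)) (ex P (pr1 E C D) \<phi>) \<longleftrightarrow>
     (\<forall>\<theta> c. eqv X \<theta> c c \<longrightarrow> (\<exists>f \<theta>' d. covers f \<theta>' \<theta> \<and> ?S \<theta>' (c \<cdot> f) d))"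
  proof -
    note I = id_hom[OF C]
    have a: "ent \<theta> c (rel P \<rho> (idt E C) (idt E C)) \<longleftrightarrow> eqv X \<theta> c c" if c: "c \<in> Hom E (ob \<theta>) C" for \<theta> c
      using ent_rel[OF r I I c id_comp[OF c] id_comp[OF c]] eX by simp
    have b: "ent \<theta> c (ex P (pr1 E C D) \<phi>) \<longleftrightarrow> (\<exists>f \<theta>' d. covers f \<theta>' \<theta> \<and> ?S \<theta>' (c \<cdot> f) d)"
      if c: "c \<in> Hom E (ob \<theta>) C" for \<theta> c
      unfolding ent_ex[OF p1 phi c]
    proof
      assume "\<exists>f \<theta>' a. covers f \<theta>' \<theta> \<and> a \<in> Hom E (ob \<theta>') (prd E C D) \<and> pr1 E C D \<cdot> a = c \<cdot> f \<and> ent \<theta>' a \<phi>"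
      then obtain f \<theta>' a where f: "covers f \<theta>' \<theta>" and a: "a \<in> Hom E (ob \<theta>') (prd E C D)" 
        and e: "pr1 E C D \<cdot> a = c \<cdot> f" "ent \<theta>' a \<phi>" by blast
      obtain d where "d \<in> Hom E (ob \<theta>') D" "a = tuple E (c \<cdot> f) d" using tuple_cases[OF a C D] e by metis
      then show "\<exists>f \<theta>' d. covers f \<theta>' \<theta> \<and> ?S \<theta>' (c \<cdot> f) d" using f e covers_restrict[OF f c] unfolding rl_def by blast
    next
      assume "\<exists>f \<theta>' d. covers f \<theta>' \<theta> \<and> ?S \<theta>' (c \<cdot> f) d"
      then obtain f \<theta>' d where "covers f \<theta>' \<theta>" "?S \<theta>' (c \<cdot> f) d" by blast
      then show "\<exists>f \<theta>' a. covers f \<theta>' \<theta> \<and> a \<in> Hom E (ob \<theta>') (prd E C D) \<and> pr1 E C D \<cdot> a = c \<cdot> f \<and> ent \<theta>' a \<phi>"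
        unfolding rl_def using tuple_hom pr1_tuple by blast
    qed
    show ?thesis
      unfolding le_ent_ball[OF rel_fibre[OF r I I] ex_fibre[OF p1 phi]]
      using hX by (simp add: a b cong: ball_cong_simp) blast
  qed
  show ?thesis
    using 1 2 3 4 phi unfolding functional_relation_def Xe Ye frel_def Let_def prod.case fst_conv snd_conv by auto
qed (cases X; cases Y; simp add: functional_relation_def Let_def)

section \<open>The category of partial equivalence relations\<close>

definition mk :: "'o \<times> 'p \<Rightarrow> 'o \<times> 'p \<Rightarrow> 'p \<Rightarrow> ('o \<times> 'p) \<times> ('o \<times> 'p) \<times> 'p set" where
  "mk X Y \<phi> = (X, Y, eqclass P (prd E (fst X) (fst Y)) \<phi>)"

text \<open>Arrows are equivalence classes, and one representative is fixed so that an arrow can be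
  applied to elements. By \<open>ap_mk\<close> the relation \<open>ap\<close> does not depend on
  which one.\<close>

definition pred :: "('o \<times> 'p) \<times> ('o \<times> 'p) \<times> 'p set \<Rightarrow> 'p" where
  "pred F = (SOME \<phi>. \<phi> \<in> snd (snd F))"

definition ap :: "('o \<times> 'p) \<times> ('o \<times> 'p) \<times> 'p set \<Rightarrow> 'p \<Rightarrow> 'a \<Rightarrow> 'a \<Rightarrow> bool" where
  "ap F = rl (pred F) (fst (fst F)) (fst (fst (snd F)))"

lemma T_Obj: "X \<in> Obj T \<longleftrightarrow> is_per P X"
  by (simp add: tripos_to_topos_def)

lemma T_Hom: "F \<in> Hom T X Y \<longleftrightarrow> is_per P X \<and> is_per P Y \<and> (\<exists>\<phi>. functional_relation P X Y \<phi> \<and> F = mk X Y \<phi>)"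
  by (cases F) (simp add: Hom_def tripos_to_topos_def mk_def del: split_paired_Ex, blast)

lemma mk_hom: "is_per P X \<Longrightarrow> is_per P Y \<Longrightarrow> functional_relation P X Y \<phi> \<Longrightarrow> mk X Y \<phi> \<in> Hom T X Y"
  by (auto simp: T_Hom)

lemma fib_iso_refl: "x \<in> fibre P A \<Longrightarrow> fib_iso P A x x"
  by (simp add: fib_iso_def le_refl)

lemma fib_iso_sym: "fib_iso P A x y \<Longrightarrow> fib_iso P A y x"
  by (simp add: fib_iso_def)

lemma fib_iso_trans: "fib_iso P A x y \<Longrightarrow> fib_iso P A y z \<Longrightarrow> fib_iso P A x z"
  using le_trans by (auto simp: fib_iso_def)

lemma eqclass_eq: "fib_iso P A x y \<Longrightarrow> eqclass P A x = eqclass P A y"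
  unfolding eqclass_def using fib_iso_trans fib_iso_sym by blast

lemma pred_mk:
  assumes "\<phi> \<in> fibre P (prd E (fst X) (fst Y))"
  shows "fib_iso P (prd E (fst X) (fst Y)) \<phi> (pred (mk X Y \<phi>))"
proof -
  have "\<phi> \<in> snd (snd (mk X Y \<phi>))" using fib_iso_refl[OF assms] by (simp add: mk_def eqclass_def)
  then have "pred (mk X Y \<phi>) \<in> snd (snd (mk X Y \<phi>))" unfolding pred_def by (rule someI)
  then show ?thesis by (simp add: mk_def eqclass_def)
qed

lemma ap_mk:
  assumes "\<phi> \<in> fibre P (prd E (fst X) (fst Y))" "fst X \<in> Obj E" "fst Y \<in> Obj E"
  shows "ap (mk X Y \<phi>) = rl \<phi> (fst X) (fst Y)"
proof -
  have "pred (mk X Y \<phi>) \<in> fibre P (prd E (fst X) (fst Y))"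
    using pred_mk[OF assms(1)] by (auto simp: fib_iso_def le_def)
  then have "rl (pred (mk X Y \<phi>)) (fst X) (fst Y) = rl \<phi> (fst X) (fst Y)"
    using pred_mk[OF assms(1)] fib_iso_rl[OF assms(1) _ assms(2,3)] by (intro ext) blast
  then show ?thesis by (simp add: ap_def mk_def)
qed

lemma
  assumes "F \<in> Hom T X Y"
  shows hom_per: "is_per P X" "is_per P Y"
    and hom_mk: "F = mk X Y (pred F)"
    and pred_fibre: "pred F \<in> fibre P (prd E (fst X) (fst Y))"
    and ap_rl: "ap F = rl (pred F) (fst X) (fst Y)"
    and ap_frel: "frel X Y (ap F)"
proof -
  show X: "is_per P X" and Y: "is_per P Y" using assms by (auto simp: T_Hom)
  obtain \<phi> where f: "functional_relation P X Y \<phi>" and F: "F = mk X Y \<phi>" using assms by (auto simp: T_Hom)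
  have phi: "\<phi> \<in> fibre P (prd E (fst X) (fst Y))" and fr: "frel X Y (rl \<phi> (fst X) (fst Y))"
    using f functional_relation_iff[OF X Y] by blast+
  note iso = pred_mk[OF phi, folded F]
  show "pred F \<in> fibre P (prd E (fst X) (fst Y))" using iso by (auto simp: fib_iso_def le_def)
  show "F = mk X Y (pred F)" using eqclass_eq[OF iso] F by (simp add: mk_def)
  show "ap F = rl (pred F) (fst X) (fst Y)" using F by (simp add: ap_def mk_def)
  show "frel X Y (ap F)" using ap_mk[OF phi per_Obj[OF X] per_Obj[OF Y]] fr F by simp
qed

lemma
  assumes "F \<in> Hom T X Y"
  shows ap_hom: "ap F \<theta> c d \<Longrightarrow> c \<in> Hom E (ob \<theta>) (fst X)" "ap F \<theta> c d \<Longrightarrow> d \<in> Hom E (ob \<theta>) (fst Y)"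
    and ap_eqv: "ap F \<theta> c d \<Longrightarrow> eqv X \<theta> c c" "ap F \<theta> c d \<Longrightarrow> eqv Y \<theta> d d"
    and ap_ext: "ap F \<theta> c d \<Longrightarrow> eqv X \<theta> c c' \<Longrightarrow> eqv Y \<theta> d d' \<Longrightarrow> ap F \<theta> c' d'"
    and ap_single: "ap F \<theta> c d \<Longrightarrow> ap F \<theta> c d' \<Longrightarrow> eqv Y \<theta> d d'"
    and ap_total: "eqv X \<theta> c c \<Longrightarrow> \<exists>f \<theta>' d. covers f \<theta>' \<theta> \<and> ap F \<theta>' (c \<cdot> f) d"
    and ap_local: "covers f \<theta>' \<theta> \<Longrightarrow> ap F \<theta>' (c \<cdot> f) (d \<cdot> f) \<Longrightarrow>
      c \<in> Hom E (ob \<theta>) (fst X) \<Longrightarrow> d \<in> Hom E (ob \<theta>) (fst Y) \<Longrightarrow> ap F \<theta> c d"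
proof -
  note fr = ap_frel[OF assms, unfolded frel_def]
  show "ap F \<theta> c d \<Longrightarrow> c \<in> Hom E (ob \<theta>) (fst X)" "ap F \<theta> c d \<Longrightarrow> d \<in> Hom E (ob \<theta>) (fst Y)"
    unfolding ap_rl[OF assms] using rl_hom by blast+
  show "ap F \<theta> c d \<Longrightarrow> eqv X \<theta> c c" "ap F \<theta> c d \<Longrightarrow> eqv Y \<theta> d d" using fr[THEN conjunct1] by blast+
  show "ap F \<theta> c d \<Longrightarrow> eqv X \<theta> c c' \<Longrightarrow> eqv Y \<theta> d d' \<Longrightarrow> ap F \<theta> c' d'"
    using fr[THEN conjunct2, THEN conjunct1] by blast
  show "ap F \<theta> c d \<Longrightarrow> ap F \<theta> c d' \<Longrightarrow> eqv Y \<theta> d d'"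
    using fr[THEN conjunct2, THEN conjunct2, THEN conjunct1] by blast
  show "eqv X \<theta> c c \<Longrightarrow> \<exists>f \<theta>' d. covers f \<theta>' \<theta> \<and> ap F \<theta>' (c \<cdot> f) d"
    using fr[THEN conjunct2, THEN conjunct2, THEN conjunct2] by blast
  show "covers f \<theta>' \<theta> \<Longrightarrow> ap F \<theta>' (c \<cdot> f) (d \<cdot> f) \<Longrightarrow>
      c \<in> Hom E (ob \<theta>) (fst X) \<Longrightarrow> d \<in> Hom E (ob \<theta>) (fst Y) \<Longrightarrow> ap F \<theta> c d"
    unfolding ap_rl[OF assms] using rl_local[OF _ _ _ _ pred_fibre[OF assms]] by blast
qed

lemma ap_restrict: "ent \<theta>' f \<theta> \<Longrightarrow> ap F \<theta> c d \<Longrightarrow> ap F \<theta>' (c \<cdot> f) (d \<cdot> f)"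
  by (simp add: ap_def rl_restrict)

lemma ap_ext1: "F \<in> Hom T X Y \<Longrightarrow> ap F \<theta> c d \<Longrightarrow> eqv X \<theta> c c' \<Longrightarrow> ap F \<theta> c' d"
  using ap_ext ap_eqv by blast

lemma ap_ext2: "F \<in> Hom T X Y \<Longrightarrow> ap F \<theta> c d \<Longrightarrow> eqv Y \<theta> d d' \<Longrightarrow> ap F \<theta> c d'"
  using ap_ext ap_eqv by blast

lemma mk_homI:
  assumes "is_per P X" "is_per P Y" "\<phi> \<in> fibre P (prd E (fst X) (fst Y))" "frel X Y (rl \<phi> (fst X) (fst Y))"
  shows "mk X Y \<phi> \<in> Hom T X Y" "ap (mk X Y \<phi>) = rl \<phi> (fst X) (fst Y)"
  using assms mk_hom functional_relation_iff ap_mk per_Obj by blast+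

text \<open>One inclusion suffices: where \<open>G\<close> relates \<open>c\<close> to
  \<open>d\<close>, totality of \<open>F\<close> gives a local value \<open>d'\<close> at
  \<open>c\<close>, and single-valuedness of the larger relation \<open>G\<close> identifies
  \<open>d'\<close> with \<open>d\<close>.\<close>

lemma T_hom_eqI:
  assumes F: "F \<in> Hom T X Y" and G: "G \<in> Hom T X Y" and le: "\<And>\<theta> c d. ap F \<theta> c d \<Longrightarrow> ap G \<theta> c d"
  shows "F = G"
proof -
  note X = hom_per(1)[OF F] and Y = hom_per(2)[OF F]
  have "ap F \<theta> c d" if g: "ap G \<theta> c d" for \<theta> c d
  proof -
    obtain f \<theta>' d' where f: "covers f \<theta>' \<theta>" and a: "ap F \<theta>' (c \<cdot> f) d'"
      using ap_total[OF F ap_eqv(1)[OF G g]] by blast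
    have "eqv Y \<theta>' d' (d \<cdot> f)"
      using ap_single[OF G le[OF a] ap_restrict[OF covers_ent[OF f] g]] .
    then show ?thesis using ap_local[OF F f ap_ext2[OF F a]] ap_hom[OF G g] by blast
  qed
  then have "rl (pred F) (fst X) (fst Y) = rl (pred G) (fst X) (fst Y)"
    using le unfolding ap_rl[OF F] ap_rl[OF G] by (intro ext) blast
  then have "fib_iso P (prd E (fst X) (fst Y)) (pred F) (pred G)"
    using fib_iso_rl[OF pred_fibre[OF F] pred_fibre[OF G] per_Obj[OF X] per_Obj[OF Y]] by simp
  then have "mk X Y (pred F) = mk X Y (pred G)" using eqclass_eq by (simp add: mk_def)
  then show ?thesis by (rule trans[OF hom_mk[OF F] trans[OF _ hom_mk[OF G, symmetric]]])
qed

lemma rl_comp: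
  assumes A: "A \<in> Obj E" and B: "B \<in> Obj E" and K: "K \<in> Obj E"
    and phi: "\<phi> \<in> fibre P (prd E A B)" and psi: "\<psi> \<in> fibre P (prd E B K)"
  shows "rel_comp P A B K \<psi> \<phi> \<in> fibre P (prd E A K)" (is ?fib)
    and "rl (rel_comp P A B K \<psi> \<phi>) A K \<theta> c k \<longleftrightarrow> c \<in> Hom E (ob \<theta>) A \<and> k \<in> Hom E (ob \<theta>) K \<and>
      (\<exists>f \<theta>' d. covers f \<theta>' \<theta> \<and> rl \<phi> A B \<theta>' (c \<cdot> f) d \<and> rl \<psi> B K \<theta>' d (k \<cdot> f))" (is "?l \<longleftrightarrow> ?r")
proof -
  let ?G = "prd E (prd E A B) K"
  have AB: "prd E A B \<in> Obj E" using prd_Obj[OF A B] .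
  note p1 = pr1_hom[OF A B] and p2 = pr2_hom[OF A B] and q1 = pr1_hom[OF AB K] and q2 = pr2_hom[OF AB K]
  let ?c = "pr1 E A B \<cdot> pr1 E (prd E A B) K" and ?d = "pr2 E A B \<cdot> pr1 E (prd E A B) K" and ?k = "pr2 E (prd E A B) K"
  have h: "?c \<in> Hom E ?G A" "?d \<in> Hom E ?G B" "?k \<in> Hom E ?G K" using comp_hom p1 p2 q1 q2 by blast+
  let ?m = "meet P ?G (rel P \<phi> ?c ?d) (rel P \<psi> ?d ?k)"
  note rf = rel_fibre[OF phi h(1,2)] rel_fibre[OF psi h(2,3)]
  have m: "?m \<in> fibre P ?G" using meet_fibre[OF rf] .
  have ck: "tuple E ?c ?k \<in> Hom E ?G (prd E A K)" using tuple_hom[OF h(1,3)] .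
  have rc: "rel_comp P A B K \<psi> \<phi> = ex P (tuple E ?c ?k) ?m" by (simp add: rel_comp_def Let_def)
  show ?fib unfolding rc using ex_fibre[OF ck m] .
  have *: "ent \<theta> (tuple E (tuple E a b) x) ?m \<longleftrightarrow> rl \<phi> A B \<theta> a b \<and> rl \<psi> B K \<theta> b x"
      "tuple E ?c ?k \<cdot> tuple E (tuple E a b) x = tuple E a x"
    if a: "a \<in> Hom E (ob \<theta>) A" and b: "b \<in> Hom E (ob \<theta>) B" and x: "x \<in> Hom E (ob \<theta>) K" for \<theta> a b x
  proof -
    let ?t = "tuple E (tuple E a b) x"
    note t1 = tuple_hom[OF a b]
    have t: "?t \<in> Hom E (ob \<theta>) ?G" using tuple_hom[OF t1 x] .
    have e: "?c \<cdot> ?t = a" "?d \<cdot> ?t = b" "?k \<cdot> ?t = x"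
      using assoc[OF p1 q1 t] assoc[OF p2 q1 t] pr1_tuple[OF t1 x] pr2_tuple[OF t1 x]
        pr1_tuple[OF a b] pr2_tuple[OF a b] by simp_all
    show "ent \<theta> ?t ?m \<longleftrightarrow> rl \<phi> A B \<theta> a b \<and> rl \<psi> B K \<theta> b x"
      unfolding ent_meet[OF rf] ent_rel[OF phi h(1,2) t e(1,2)] ent_rel[OF psi h(2,3) t e(2,3)] ..
    show "tuple E ?c ?k \<cdot> ?t = tuple E a x" using tuple_comp[OF h(1,3) t] e by simp
  qed
  show "?l \<longleftrightarrow> ?r"
  proof
    assume l: ?l
    then have c: "c \<in> Hom E (ob \<theta>) A" and k: "k \<in> Hom E (ob \<theta>) K" and e: "ent \<theta> (tuple E c k) (ex P (tuple E ?c ?k) ?m)"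
      by (auto simp: rl_def rc)
    obtain f \<theta>' a where f: "covers f \<theta>' \<theta>" and a: "a \<in> Hom E (ob \<theta>') ?G"
      and ae: "tuple E ?c ?k \<cdot> a = tuple E c k \<cdot> f" and em: "ent \<theta>' a ?m"
      using e ent_ex[OF ck m tuple_hom[OF c k]] by blast
    obtain y x where y: "y \<in> Hom E (ob \<theta>') (prd E A B)" and x: "x \<in> Hom E (ob \<theta>') K" and ayx: "a = tuple E y x"
      using tuple_cases[OF a AB K] by metis
    obtain u v where u: "u \<in> Hom E (ob \<theta>') A" and v: "v \<in> Hom E (ob \<theta>') B" and yuv: "y = tuple E u v"
      using tuple_cases[OF y A B] by metis
    have "tuple E u x = tuple E (c \<cdot> f) (k \<cdot> f)"
      using ae *(2)[OF u v x] ayx yuv tuple_comp[OF c k covers_hom[OF f]] by simp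
    then have "u = c \<cdot> f" "x = k \<cdot> f"
      using tuple_inj[OF _ u x covers_restrict[OF f c] covers_restrict[OF f k]] by blast+
    then show ?r using c k f em *(1)[OF u v x] ayx yuv by blast
  next
    assume ?r
    then obtain f \<theta>' d where c: "c \<in> Hom E (ob \<theta>) A" and k: "k \<in> Hom E (ob \<theta>) K" and f: "covers f \<theta>' \<theta>"
      and 1: "rl \<phi> A B \<theta>' (c \<cdot> f) d" and 2: "rl \<psi> B K \<theta>' d (k \<cdot> f)" by blast
    let ?t = "tuple E (tuple E (c \<cdot> f) d) (k \<cdot> f)"
    have t: "?t \<in> Hom E (ob \<theta>') ?G" using tuple_hom[OF tuple_hom[OF rl_hom(1)[OF 1] rl_hom(2)[OF 1]] rl_hom(2)[OF 2]] .
    note ** = *[OF rl_hom(1)[OF 1] rl_hom(2)[OF 1] rl_hom(2)[OF 2]]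
    have "ent \<theta>' ?t ?m" using **(1) 1 2 by blast
    moreover have "tuple E ?c ?k \<cdot> ?t = tuple E c k \<cdot> f" using **(2) tuple_comp[OF c k covers_hom[OF f]] by simp
    ultimately have "ent \<theta> (tuple E c k) (rel_comp P A B K \<psi> \<phi>)"
      unfolding rc ent_ex[OF ck m tuple_hom[OF c k]] using f t by blast
    then show ?l using c k by (simp add: rl_def)
  qed
qed

lemma T_id: "X \<in> Obj T \<Longrightarrow> idt T X = mk X X (snd X)"
  by (simp add: tripos_to_topos_def mk_def)

lemma
  assumes X: "X \<in> Obj T"
  shows T_id_hom: "idt T X \<in> Hom T X X" and ap_id: "ap (idt T X) = eqv X"
proof -
  have p: "is_per P X" using X by (simp add: T_Obj)
  have "frel X X (eqv X)"
    unfolding frel_def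
  proof (intro conjI allI impI)
    fix \<theta> c assume e: "eqv X \<theta> c c"
    show "\<exists>f \<theta>' d. covers f \<theta>' \<theta> \<and> eqv X \<theta>' (c \<cdot> f) d"
      using covers_refl[OF eqv_hom(3)[OF e]] e comp_id[OF eqv_hom(1)[OF e]] by metis
  qed (use eqv_sym[OF p] eqv_trans[OF p] in blast)+
  then show "idt T X \<in> Hom T X X" "ap (idt T X) = eqv X"
    using mk_homI[OF p p per_fibre[OF p]] T_id[OF X] by (simp_all add: eqv_def)
qed

text \<open>Composition is defined as a union over all pairs of representatives. The point is that
  this union is a single class and that its elements are those of the relational composite.\<close>

lemma
  assumes F: "F \<in> Hom T X Y" and G: "G \<in> Hom T Y Z"
  shows T_comp_hom: "cmp T G F \<in> Hom T X Z"
    and ap_comp: "ap (cmp T G F) \<theta> c k \<longleftrightarrow> c \<in> Hom E (ob \<theta>) (fst X) \<and> k \<in> Hom E (ob \<theta>) (fst Z) \<and>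
      (\<exists>f \<theta>' d. covers f \<theta>' \<theta> \<and> ap F \<theta>' (c \<cdot> f) d \<and> ap G \<theta>' d (k \<cdot> f))"
proof -
  note X = hom_per(1)[OF F] and Y = hom_per(2)[OF F] and Z = hom_per(2)[OF G]
  note oX = per_Obj[OF X] and oY = per_Obj[OF Y] and oZ = per_Obj[OF Z]
  let ?rc = "\<lambda>\<psi> \<phi>. rel_comp P (fst X) (fst Y) (fst Z) \<psi> \<phi>"
  let ?R = "?rc (pred G) (pred F)"
  note rc = rl_comp[OF oX oY oZ]
  have Rf: "?R \<in> fibre P (prd E (fst X) (fst Z))" using rc(1) pred_fibre F G by blast
  have Ff: "snd (snd F) = eqclass P (prd E (fst X) (fst Y)) (pred F)"
    and Gf: "snd (snd G) = eqclass P (prd E (fst Y) (fst Z)) (pred G)"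
    using hom_mk[OF F] hom_mk[OF G] by (metis mk_def snd_conv)+
  \<comment> \<open>Isomorphic representatives have the same elements, hence so do their
    composites.\<close>
  have iso: "eqclass P (prd E (fst X) (fst Z)) (?rc \<psi> \<phi>) = eqclass P (prd E (fst X) (fst Z)) ?R"
    if p: "\<phi> \<in> snd (snd F)" and q: "\<psi> \<in> snd (snd G)" for \<phi> \<psi>
  proof -
    have i1: "fib_iso P (prd E (fst X) (fst Y)) (pred F) \<phi>" and i2: "fib_iso P (prd E (fst Y) (fst Z)) (pred G) \<psi>"
      using p q Ff Gf by (auto simp: eqclass_def)
    then have f1: "\<phi> \<in> fibre P (prd E (fst X) (fst Y))" and f2: "\<psi> \<in> fibre P (prd E (fst Y) (fst Z))"
      by (auto simp: fib_iso_def le_def)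
    have e: "rl \<phi> (fst X) (fst Y) = rl (pred F) (fst X) (fst Y)" "rl \<psi> (fst Y) (fst Z) = rl (pred G) (fst Y) (fst Z)"
      using i1[unfolded fib_iso_rl[OF pred_fibre[OF F] f1 oX oY]] i2[unfolded fib_iso_rl[OF pred_fibre[OF G] f2 oY oZ]]
      by (auto intro!: ext)
    have "rl (?rc \<psi> \<phi>) (fst X) (fst Z) \<theta> c k \<longleftrightarrow> rl ?R (fst X) (fst Z) \<theta> c k" for \<theta> c k
      unfolding rc(2)[OF f1 f2] rc(2)[OF pred_fibre[OF F] pred_fibre[OF G]] e ..
    then show ?thesis using eqclass_eq fib_iso_rl[OF rc(1)[OF f1 f2] Rf oX oZ] by blast
  qed
  have FG: "F = (X, Y, snd (snd F))" "G = (Y, Z, snd (snd G))"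
    using arg_cong[OF hom_mk[OF F], of fst] arg_cong[OF hom_mk[OF F], of "\<lambda>x. fst (snd x)"]
      arg_cong[OF hom_mk[OF G], of fst] arg_cong[OF hom_mk[OF G], of "\<lambda>x. fst (snd x)"]
    by (simp_all add: mk_def prod_eq_iff)
  have ne: "pred F \<in> snd (snd F)" "pred G \<in> snd (snd G)"
    unfolding Ff Gf using fib_iso_refl pred_fibre[OF F] pred_fibre[OF G] by (auto simp: eqclass_def)
  have "cmp T G F = (X, Z, \<Union>\<phi>\<in>snd (snd F). \<Union>\<psi>\<in>snd (snd G). eqclass P (prd E (fst X) (fst Z)) (?rc \<psi> \<phi>))"
    by (rule trans[OF arg_cong2[where f = "cmp T", OF FG(2,1)]]) (simp add: tripos_to_topos_def)
  also have "\<dots> = mk X Z ?R"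
  proof -
    \<comment> \<open>All members of the double union are the same class, and the index sets are
      inhabited by \<open>pred F\<close> and \<open>pred G\<close>.\<close>
    have "(\<Union>\<phi>\<in>snd (snd F). \<Union>\<psi>\<in>snd (snd G). eqclass P (prd E (fst X) (fst Z)) (?rc \<psi> \<phi>)) =
      (\<Union>\<phi>\<in>snd (snd F). \<Union>\<psi>\<in>snd (snd G). eqclass P (prd E (fst X) (fst Z)) ?R)"
      using iso by (intro SUP_cong refl)
    then show ?thesis using ne unfolding mk_def by auto
  qed
  finally have cm: "cmp T G F = mk X Z ?R" .
  have app: "rl ?R (fst X) (fst Z) \<theta> c k \<longleftrightarrow> c \<in> Hom E (ob \<theta>) (fst X) \<and> k \<in> Hom E (ob \<theta>) (fst Z) \<and>
      (\<exists>f \<theta>' d. covers f \<theta>' \<theta> \<and> ap F \<theta>' (c \<cdot> f) d \<and> ap G \<theta>' d (k \<cdot> f))" for \<theta> c k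
    using rc(2)[OF pred_fibre[OF F] pred_fibre[OF G]] by (simp add: ap_rl[OF F] ap_rl[OF G])
  let ?S = "rl ?R (fst X) (fst Z)"
  have elim: "\<exists>f \<theta>' d. covers f \<theta>' \<theta> \<and> ap F \<theta>' (c \<cdot> f) d \<and> ap G \<theta>' d (k \<cdot> f)" if "?S \<theta> c k" for \<theta> c k
    using that app by blast
  have "frel X Z ?S"
    unfolding frel_def
  proof (intro conjI allI impI)
    fix \<theta> c k assume S: "?S \<theta> c k"
    then obtain f \<theta>' d where f: "covers f \<theta>' \<theta>" and a: "ap F \<theta>' (c \<cdot> f) d" "ap G \<theta>' d (k \<cdot> f)" using elim by blast
    show "eqv X \<theta> c c" using eqv_local[OF X f ap_eqv(1)[OF F a(1)]] rl_hom[OF S] by blast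
    show "eqv Z \<theta> k k" using eqv_local[OF Z f ap_eqv(2)[OF G a(2)]] rl_hom[OF S] by blast
  next
    fix \<theta> c k c' k' assume S: "?S \<theta> c k" and e: "eqv X \<theta> c c'" "eqv Z \<theta> k k'"
    then obtain f \<theta>' d where f: "covers f \<theta>' \<theta>" and a: "ap F \<theta>' (c \<cdot> f) d" "ap G \<theta>' d (k \<cdot> f)" using elim by blast
    have "ap F \<theta>' (c' \<cdot> f) d" using ap_ext1[OF F a(1) eqv_restrict[OF covers_ent[OF f] e(1)]] .
    moreover have "ap G \<theta>' d (k' \<cdot> f)" using ap_ext2[OF G a(2) eqv_restrict[OF covers_ent[OF f] e(2)]] .
    ultimately show "?S \<theta> c' k'" using app f eqv_hom(2)[OF e(1)] eqv_hom(2)[OF e(2)] by blast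
  next
    fix \<theta> c k k' assume S: "?S \<theta> c k" and S': "?S \<theta> c k'"
    obtain f \<theta>' d where f: "covers f \<theta>' \<theta>" and a: "ap F \<theta>' (c \<cdot> f) d" "ap G \<theta>' d (k \<cdot> f)" using elim[OF S] by blast
    obtain g \<theta>'' d' where g: "covers g \<theta>'' \<theta>'" and b: "ap F \<theta>'' (c \<cdot> f \<cdot> g) d'" "ap G \<theta>'' d' (k' \<cdot> f \<cdot> g)"
      using elim[OF rl_restrict[OF covers_ent[OF f] S']] by blast
    have "eqv Y \<theta>'' (d \<cdot> g) d'" using ap_single[OF F ap_restrict[OF covers_ent[OF g] a(1)] b(1)] .
    then have "ap G \<theta>'' d' (k \<cdot> f \<cdot> g)" using ap_ext1[OF G ap_restrict[OF covers_ent[OF g] a(2)]] by blast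
    then have "eqv Z \<theta>'' (k \<cdot> f \<cdot> g) (k' \<cdot> f \<cdot> g)" using ap_single[OF G _ b(2)] by blast
    then have "eqv Z \<theta>' (k \<cdot> f) (k' \<cdot> f)"
      using eqv_local[OF Z g] covers_restrict[OF f] rl_hom(2)[OF S] rl_hom(2)[OF S'] by blast
    then show "eqv Z \<theta> k k'" using eqv_local[OF Z f] rl_hom(2)[OF S] rl_hom(2)[OF S'] by blast
  next
    fix \<theta> c assume e: "eqv X \<theta> c c"
    obtain f \<theta>' d where f: "covers f \<theta>' \<theta>" and a: "ap F \<theta>' (c \<cdot> f) d" using ap_total[OF F e] by blast
    obtain g \<theta>'' k where g: "covers g \<theta>'' \<theta>'" and b: "ap G \<theta>'' (d \<cdot> g) k" using ap_total[OF G ap_eqv(2)[OF F a]] by blast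
    have t: "\<theta>'' \<in> Pred" using covers_ent[OF g] ent_dom by blast
    have a': "ap F \<theta>'' (c \<cdot> f \<cdot> g) (d \<cdot> g)" using ap_restrict[OF covers_ent[OF g] a] .
    have "?S \<theta>'' (c \<cdot> f \<cdot> g) k"
      unfolding app using covers_refl[OF t] a' b ap_hom[OF F a'] ap_hom[OF G b] comp_id by metis
    moreover have "c \<cdot> f \<cdot> g = c \<cdot> (f \<cdot> g)" using assoc[OF eqv_hom(1)[OF e] covers_hom[OF f] covers_hom[OF g]] by simp
    ultimately show "\<exists>f \<theta>' d. covers f \<theta>' \<theta> \<and> ?S \<theta>' (c \<cdot> f) d" using covers_trans[OF f g] by metis
  qed
  then have "mk X Z ?R \<in> Hom T X Z" "ap (mk X Z ?R) = ?S" using mk_homI[OF X Z Rf] by blast+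
  then show "cmp T G F \<in> Hom T X Z" "ap (cmp T G F) \<theta> c k \<longleftrightarrow> c \<in> Hom E (ob \<theta>) (fst X) \<and> k \<in> Hom E (ob \<theta>) (fst Z) \<and>
      (\<exists>f \<theta>' d. covers f \<theta>' \<theta> \<and> ap F \<theta>' (c \<cdot> f) d \<and> ap G \<theta>' d (k \<cdot> f))"
    using cm app by simp_all
qed

lemma ap_compI:
  assumes F: "F \<in> Hom T X Y" and G: "G \<in> Hom T Y Z" and a: "ap F \<theta> c d" and b: "ap G \<theta> d k"
  shows "ap (cmp T G F) \<theta> c k"
proof -
  have t: "\<theta> \<in> Pred" using eqv_hom(3) ap_eqv(1)[OF F a] .
  show ?thesis unfolding ap_comp[OF F G]
    using covers_refl[OF t] a b ap_hom[OF F a] ap_hom[OF G b] comp_id by metis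
qed

lemma T_category: "is_category T"
proof -
  have 1: "F \<in> Hom T (src T F) (tgt T F)" if "F \<in> Arr T" for F using that by (rule Arr_Hom)
  have 2: "cmp T F (idt T X) = F" "cmp T (idt T Y) F = F" if F: "F \<in> Hom T X Y" for F X Y
  proof -
    note X = hom_per(1)[OF F] and Y = hom_per(2)[OF F]
    have iX: "idt T X \<in> Hom T X X" "ap (idt T X) = eqv X" and iY: "idt T Y \<in> Hom T Y Y" "ap (idt T Y) = eqv Y"
      using T_id_hom ap_id X Y T_Obj by blast+
    show "cmp T F (idt T X) = F"
    proof (rule T_hom_eqI[symmetric, OF F T_comp_hom[OF iX(1) F]])
      fix \<theta> c d assume a: "ap F \<theta> c d"
      then show "ap (cmp T F (idt T X)) \<theta> c d"
        using ap_compI[OF iX(1) F _ a] ap_eqv(1)[OF F a] iX(2) by simp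
    qed
    show "cmp T (idt T Y) F = F"
    proof (rule T_hom_eqI[symmetric, OF F T_comp_hom[OF F iY(1)]])
      fix \<theta> c d assume a: "ap F \<theta> c d"
      then show "ap (cmp T (idt T Y) F) \<theta> c d"
        using ap_compI[OF F iY(1) a] ap_eqv(2)[OF F a] iY(2) by simp
    qed
  qed
  have 3: "cmp T H (cmp T G F) = cmp T (cmp T H G) F"
    if F: "F \<in> Hom T X Y" and G: "G \<in> Hom T Y Z" and H: "H \<in> Hom T Z W" for F G H X Y Z W
  proof (rule T_hom_eqI)
    note GF = T_comp_hom[OF F G] and HG = T_comp_hom[OF G H]
    show l: "cmp T H (cmp T G F) \<in> Hom T X W" and r: "cmp T (cmp T H G) F \<in> Hom T X W"
      using T_comp_hom GF HG F H by blast+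
    fix \<theta> c k assume a: "ap (cmp T H (cmp T G F)) \<theta> c k"
    obtain f \<theta>' z where f: "covers f \<theta>' \<theta>" and b: "ap (cmp T G F) \<theta>' (c \<cdot> f) z" "ap H \<theta>' z (k \<cdot> f)"
      using a unfolding ap_comp[OF GF H] by blast
    obtain g \<theta>'' y where g: "covers g \<theta>'' \<theta>'" and d: "ap F \<theta>'' (c \<cdot> f \<cdot> g) y" "ap G \<theta>'' y (z \<cdot> g)"
      using b(1) unfolding ap_comp[OF F G] by blast
    have "ap H \<theta>'' (z \<cdot> g) (k \<cdot> f \<cdot> g)" using ap_restrict[OF covers_ent[OF g] b(2)] .
    then have "ap (cmp T (cmp T H G) F) \<theta>'' (c \<cdot> f \<cdot> g) (k \<cdot> f \<cdot> g)"
      using ap_compI[OF F HG d(1) ap_compI[OF G H d(2)]] by blast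
    then have "ap (cmp T (cmp T H G) F) \<theta>' (c \<cdot> f) (k \<cdot> f)"
      using ap_local[OF r g] ap_hom[OF GF b(1)] ap_hom[OF H b(2)] by blast
    then show "ap (cmp T (cmp T H G) F) \<theta> c k" using ap_local[OF r f] ap_hom[OF l a] by blast
  qed
  show ?thesis
    unfolding is_category_def
  proof (intro conjI ballI impI)
    fix F assume F: "F \<in> Arr T"
    show "src T F \<in> Obj T" "tgt T F \<in> Obj T" using hom_per[OF 1[OF F]] T_Obj by blast+
    show "cmp T F (idt T (src T F)) = F" "cmp T (idt T (tgt T F)) F = F" using 2[OF 1[OF F]] by blast+
    fix G assume G: "G \<in> Arr T" and e: "src T G = tgt T F"
    have G': "G \<in> Hom T (tgt T F) (tgt T G)" using 1[OF G] e by simp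
    show "cmp T G F \<in> Hom T (src T F) (tgt T G)" using T_comp_hom[OF 1[OF F] G'] .
    fix H assume H: "H \<in> Arr T" and e': "src T H = tgt T G"
    have H': "H \<in> Hom T (tgt T G) (tgt T H)" using 1[OF H] e' by simp
    show "cmp T H (cmp T G F) = cmp T (cmp T H G) F" using 3[OF 1[OF F] G' H'] .
  qed (use T_id_hom in blast)
qed

end

sublocale tripos_fib \<subseteq> T: category T
  by (unfold_locales) (rule T_category)

context tripos_fib begin

section \<open>Constant objects\<close>

lemma equality_fibre: "I \<in> Obj E \<Longrightarrow> equality P I \<in> fibre P (prd E I I)"
  unfolding equality_def using ex_fibre[OF diag_hom top_fibre] .

text \<open>As \<open>equality\<close> is an existential along the diagonal, equality of elements of
  a constant object means equality of arrows on a cover, not of the arrows themselves.\<close>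

lemma eqv_const:
  assumes I: "I \<in> Obj E"
  shows "eqv (const_obj P I) \<theta> a b \<longleftrightarrow> a \<in> Hom E (ob \<theta>) I \<and> b \<in> Hom E (ob \<theta>) I \<and>
    (\<exists>f \<theta>'. covers f \<theta>' \<theta> \<and> a \<cdot> f = b \<cdot> f)"
proof -
  have "ent \<theta> (tuple E a b) (equality P I) \<longleftrightarrow> (\<exists>f \<theta>'. covers f \<theta>' \<theta> \<and> a \<cdot> f = b \<cdot> f)"
    if a: "a \<in> Hom E (ob \<theta>) I" and b: "b \<in> Hom E (ob \<theta>) I"
    unfolding equality_def ent_ex[OF diag_hom[OF I] top_fibre[OF I] tuple_hom[OF a b]]
  proof
    assume "\<exists>f \<theta>' x. covers f \<theta>' \<theta> \<and> x \<in> Hom E (ob \<theta>') I \<and> diag I \<cdot> x = tuple E a b \<cdot> f \<and> ent \<theta>' x (top_of P I)"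
    then obtain f \<theta>' x where f: "covers f \<theta>' \<theta>" and x: "x \<in> Hom E (ob \<theta>') I"
      and "diag I \<cdot> x = tuple E a b \<cdot> f" by blast
    then have "tuple E x x = tuple E (a \<cdot> f) (b \<cdot> f)"
      using diag_comp[OF x] tuple_comp[OF a b covers_hom[OF f]] by simp
    then show "\<exists>f \<theta>'. covers f \<theta>' \<theta> \<and> a \<cdot> f = b \<cdot> f"
      using f tuple_inj[OF _ x x covers_restrict[OF f a] covers_restrict[OF f b]] by metis
  next
    assume "\<exists>f \<theta>'. covers f \<theta>' \<theta> \<and> a \<cdot> f = b \<cdot> f"
    then obtain f \<theta>' where f: "covers f \<theta>' \<theta>" and e: "a \<cdot> f = b \<cdot> f" by blast
    have af: "a \<cdot> f \<in> Hom E (ob \<theta>') I" using covers_restrict[OF f a] .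
    have "diag I \<cdot> (a \<cdot> f) = tuple E a b \<cdot> f"
      using diag_comp[OF af] tuple_comp[OF a b covers_hom[OF f]] e by simp
    moreover have "ent \<theta>' (a \<cdot> f) (top_of P I)"
      using ent_top[OF top_exists[OF I] _ af] ent_dom covers_ent[OF f] by blast
    ultimately show "\<exists>f \<theta>' x. covers f \<theta>' \<theta> \<and> x \<in> Hom E (ob \<theta>') I \<and> diag I \<cdot> x = tuple E a b \<cdot> f \<and> ent \<theta>' x (top_of P I)"
      using f af by blast
  qed
  then show ?thesis by (auto simp: eqv_def rl_def const_obj_def)
qed

lemma fst_const_obj: "fst (const_obj P I) = I"
  by (simp add: const_obj_def)

lemma eqv_const_refl: "I \<in> Obj E \<Longrightarrow> \<theta> \<in> Pred \<Longrightarrow> a \<in> Hom E (ob \<theta>) I \<Longrightarrow> eqv (const_obj P I) \<theta> a a"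
  using eqv_const covers_refl by blast

lemma const_per:
  assumes I: "I \<in> Obj E"
  shows "is_per P (const_obj P I)"
  unfolding is_per_iff
proof (intro conjI allI impI)
  show "fst (const_obj P I) \<in> Obj E" "snd (const_obj P I) \<in> fibre P (prd E (fst (const_obj P I)) (fst (const_obj P I)))"
    using I equality_fibre[OF I] by (simp_all add: const_obj_def)
  fix \<theta> a b assume ab: "eqv (const_obj P I) \<theta> a b"
  then show "eqv (const_obj P I) \<theta> b a" unfolding eqv_const[OF I] by metis
  fix c assume bc: "eqv (const_obj P I) \<theta> b c"
  obtain f \<theta>' where f: "covers f \<theta>' \<theta>" and e: "a \<cdot> f = b \<cdot> f" using ab eqv_const[OF I] by blast
  have "eqv (const_obj P I) \<theta>' (b \<cdot> f) (c \<cdot> f)" using eqv_restrict[OF covers_ent[OF f] bc] .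
  then obtain g \<theta>'' where g: "covers g \<theta>'' \<theta>'" and e': "b \<cdot> f \<cdot> g = c \<cdot> f \<cdot> g" using eqv_const[OF I] by blast
  have h: "a \<in> Hom E (ob \<theta>) I" "c \<in> Hom E (ob \<theta>) I" using ab bc eqv_const[OF I] by blast+
  have "a \<cdot> (f \<cdot> g) = c \<cdot> (f \<cdot> g)"
    using assoc[OF h(1) covers_hom[OF f] covers_hom[OF g]] assoc[OF h(2) covers_hom[OF f] covers_hom[OF g]] e e' by simp
  then show "eqv (const_obj P I) \<theta> a c" using eqv_const[OF I] covers_trans[OF f g] h by blast
qed

lemma eqv_const_app:
  assumes n: "n \<in> Hom E I J" and e: "eqv (const_obj P I) \<theta> a b"
  shows "eqv (const_obj P J) \<theta> (n \<cdot> a) (n \<cdot> b)"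
proof -
  note IJ = Hom_Obj[OF n]
  obtain f \<theta>' where f: "covers f \<theta>' \<theta>" and ab: "a \<cdot> f = b \<cdot> f"
    and a: "a \<in> Hom E (ob \<theta>) I" and b: "b \<in> Hom E (ob \<theta>) I" using e eqv_const[OF IJ(1)] by blast
  have "n \<cdot> a \<cdot> f = n \<cdot> b \<cdot> f" using assoc[OF n a covers_hom[OF f]] assoc[OF n b covers_hom[OF f]] ab by simp
  then show ?thesis unfolding eqv_const[OF IJ(2)] using f comp_hom[OF n a] comp_hom[OF n b] by blast
qed

section \<open>Graphs, restrictions and images in the category of partial equivalence relations\<close>

text \<open>Arrows tracked by an arrow of the base. They serve to turn an element at a stage into an
  arrow of the topos, and to map a carrier into a power object.\<close>

lemma graph_exists:
  assumes X: "is_per P X" and Y: "is_per P Y" and t: "t \<in> Hom E (fst X) (fst Y)"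
    and ext: "\<And>\<theta> a b. eqv X \<theta> a b \<Longrightarrow> eqv Y \<theta> (t \<cdot> a) (t \<cdot> b)"
  obtains F where "F \<in> Hom T X Y" "\<And>\<theta> c d. ap F \<theta> c d \<longleftrightarrow> eqv X \<theta> c c \<and> eqv Y \<theta> (t \<cdot> c) d"
proof -
  let ?C = "fst X" and ?D = "fst Y"
  note C = per_Obj[OF X] and D = per_Obj[OF Y] and r = per_fibre[OF X] and s = per_fibre[OF Y]
  note p1 = pr1_hom[OF C D] and p2 = pr2_hom[OF C D]
  note tp = comp_hom[OF t p1]
  note rf = rel_fibre[OF r p1 p1] rel_fibre[OF s tp p2]
  let ?\<phi> = "meet P (prd E ?C ?D) (rel P (snd X) (pr1 E ?C ?D) (pr1 E ?C ?D)) (rel P (snd Y) (t \<cdot> pr1 E ?C ?D) (pr2 E ?C ?D))"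
  have S: "rl ?\<phi> ?C ?D \<theta> c d \<longleftrightarrow> eqv X \<theta> c c \<and> eqv Y \<theta> (t \<cdot> c) d" for \<theta> c d
  proof (cases "c \<in> Hom E (ob \<theta>) ?C \<and> d \<in> Hom E (ob \<theta>) ?D")
    case True
    then have c: "c \<in> Hom E (ob \<theta>) ?C" and d: "d \<in> Hom E (ob \<theta>) ?D" by auto
    have e: "t \<cdot> pr1 E ?C ?D \<cdot> tuple E c d = t \<cdot> c"
      using assoc[OF t p1 tuple_hom[OF c d]] pr1_tuple[OF c d] by simp
    show ?thesis
      unfolding rl_def ent_meet[OF rf] ent_rel[OF r p1 p1 tuple_hom[OF c d] pr1_tuple[OF c d] pr1_tuple[OF c d]]
        ent_rel[OF s tp p2 tuple_hom[OF c d] e pr2_tuple[OF c d]]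
      using c d by (simp add: eqv_def rl_def)
  next
    case False
    then show ?thesis
      using rl_hom(1,2)[of ?\<phi> ?C ?D \<theta> c d] eqv_hom(1)[of X \<theta> c c] eqv_hom(2)[of Y \<theta> "t \<cdot> c" d] by blast
  qed
  have "frel X Y (rl ?\<phi> ?C ?D)"
    unfolding frel_def S
  proof (intro conjI allI impI)
    fix \<theta> c d c' d' assume 1: "eqv X \<theta> c c \<and> eqv Y \<theta> (t \<cdot> c) d" and 2: "eqv X \<theta> c c'" and 3: "eqv Y \<theta> d d'"
    show "eqv X \<theta> c' c'" using eqv_trans[OF X eqv_sym[OF X 2] 2] .
    show "eqv Y \<theta> (t \<cdot> c') d'"
      using eqv_trans[OF Y eqv_trans[OF Y eqv_sym[OF Y ext[OF 2]]] 3] 1 by blast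
  next
    fix \<theta> c assume e: "eqv X \<theta> c c"
    have "covers (idt E (ob \<theta>)) \<theta> \<theta>" using covers_refl eqv_hom(3)[OF e] .
    moreover have "eqv Y \<theta> (t \<cdot> c) (t \<cdot> c)" using ext[OF e] .
    ultimately show "\<exists>f \<theta>' d. covers f \<theta>' \<theta> \<and> eqv X \<theta>' (c \<cdot> f) (c \<cdot> f) \<and> eqv Y \<theta>' (t \<cdot> (c \<cdot> f)) d"
      using e comp_id[OF eqv_hom(1)[OF e]] by metis
  qed (use eqv_sym[OF Y] eqv_trans[OF Y] in blast)+
  from mk_homI[OF X Y meet_fibre[OF rf] this] show thesis using that S by metis
qed

lemma
  assumes n: "n \<in> Hom E I J"
  shows const_arr_hom: "const_arr P n \<in> Hom T (const_obj P I) (const_obj P J)"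
    and ap_const_arr: "ap (const_arr P n) \<theta> i j \<longleftrightarrow>
      i \<in> Hom E (ob \<theta>) I \<and> eqv (const_obj P J) \<theta> (n \<cdot> i) j"
proof -
  note IJ = Hom_Obj[OF n]
  note X = const_per[OF IJ(1)] and Y = const_per[OF IJ(2)]
  note p1 = pr1_hom[OF IJ] and p2 = pr2_hom[OF IJ]
  note np = comp_hom[OF n p1]
  let ?\<phi> = "rel P (equality P J) (n \<cdot> pr1 E I J) (pr2 E I J)"
  have F: "?\<phi> \<in> fibre P (prd E I J)" using rel_fibre[OF equality_fibre[OF IJ(2)] np p2] .
  have S: "rl ?\<phi> I J \<theta> i j \<longleftrightarrow> i \<in> Hom E (ob \<theta>) I \<and> eqv (const_obj P J) \<theta> (n \<cdot> i) j" for \<theta> i j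
  proof (cases "i \<in> Hom E (ob \<theta>) I \<and> j \<in> Hom E (ob \<theta>) J")
    case True
    then have c: "i \<in> Hom E (ob \<theta>) I" and d: "j \<in> Hom E (ob \<theta>) J" by auto
    have e: "n \<cdot> pr1 E I J \<cdot> tuple E i j = n \<cdot> i"
      using assoc[OF n p1 tuple_hom[OF c d]] pr1_tuple[OF c d] by simp
    show ?thesis
      unfolding rl_def ent_rel[OF equality_fibre[OF IJ(2)] np p2 tuple_hom[OF c d] e pr2_tuple[OF c d]]
      using c d by (simp add: eqv_def const_obj_def rl_def)
  qed (use eqv_hom[of "const_obj P J"] rl_hom in \<open>auto simp: fst_const_obj\<close>)
  have "frel (const_obj P I) (const_obj P J) (rl ?\<phi> I J)"
    unfolding frel_def S
  proof (intro conjI allI impI)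
    fix \<theta> i j assume a: "i \<in> Hom E (ob \<theta>) I \<and> eqv (const_obj P J) \<theta> (n \<cdot> i) j"
    then show "eqv (const_obj P I) \<theta> i i" using eqv_const_refl[OF IJ(1)] eqv_hom(3) by blast
    show "eqv (const_obj P J) \<theta> j j" using a eqv_sym[OF Y] eqv_trans[OF Y] by blast
    fix i' assume i': "eqv (const_obj P I) \<theta> i i'"
    then show "i' \<in> Hom E (ob \<theta>) I" using eqv_hom[OF i'] by (simp add: fst_const_obj)
    fix j' assume "eqv (const_obj P J) \<theta> j j'"
    then show "eqv (const_obj P J) \<theta> (n \<cdot> i') j'"
      using a eqv_const_app[OF n i'] eqv_sym[OF Y] eqv_trans[OF Y] by blast
  next
    fix \<theta> i assume e: "eqv (const_obj P I) \<theta> i i"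
    then have i: "i \<in> Hom E (ob \<theta>) I" using eqv_hom[OF e] by (simp add: fst_const_obj)
    have "covers (idt E (ob \<theta>)) \<theta> \<theta>" using covers_refl eqv_hom(3)[OF e] .
    moreover have "eqv (const_obj P J) \<theta> (n \<cdot> i) (n \<cdot> i)" using eqv_const_app[OF n e] .
    ultimately show "\<exists>f \<theta>' d. covers f \<theta>' \<theta> \<and> i \<cdot> f \<in> Hom E (ob \<theta>') I \<and> eqv (const_obj P J) \<theta>' (n \<cdot> (i \<cdot> f)) d"
      using i comp_id[OF i] by metis
  qed (use eqv_sym[OF Y] eqv_trans[OF Y] in blast)
  note mk = mk_homI[OF X Y, unfolded fst_const_obj, OF F this]
  have "const_arr P n = mk (const_obj P I) (const_obj P J) ?\<phi>"
    by (simp add: const_arr_def Let_def mk_def Hom_src[OF n] Hom_tgt[OF n] fst_const_obj)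
  then show "const_arr P n \<in> Hom T (const_obj P I) (const_obj P J)"
    "ap (const_arr P n) \<theta> i j \<longleftrightarrow> i \<in> Hom E (ob \<theta>) I \<and> eqv (const_obj P J) \<theta> (n \<cdot> i) j"
    using mk S by simp_all
qed

text \<open>Extensionality only: \<open>restr\<close> conjoins the predicate with the partial
  equivalence relation, which supplies strictness.\<close>

definition ext_pred :: "'o \<times> 'p \<Rightarrow> 'p \<Rightarrow> bool" where
  "ext_pred X \<phi> \<longleftrightarrow> \<phi> \<in> fibre P (fst X) \<and> (\<forall>\<theta> a b. eqv X \<theta> a b \<longrightarrow> ent \<theta> a \<phi> \<longrightarrow> ent \<theta> b \<phi>)"

text \<open>The predicate is imposed on the first argument; for extensional \<open>\<phi>\<close> it
  then holds of the second as well.\<close>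

definition restr :: "'o \<times> 'p \<Rightarrow> 'p \<Rightarrow> 'o \<times> 'p" where
  "restr X \<phi> = (fst X, meet P (prd E (fst X) (fst X)) (snd X) (reindex P (pr1 E (fst X) (fst X)) \<phi>))"

definition incl :: "'o \<times> 'p \<Rightarrow> 'p \<Rightarrow> ('o \<times> 'p) \<times> ('o \<times> 'p) \<times> 'p set" where
  "incl X \<phi> = mk (restr X \<phi>) X (snd (restr X \<phi>))"

lemma fst_restr: "fst (restr X \<phi>) = fst X"
  by (simp add: restr_def)

lemma
  assumes X: "is_per P X" and ep: "ext_pred X \<phi>"
  shows eqv_restr: "eqv (restr X \<phi>) \<theta> a b \<longleftrightarrow> eqv X \<theta> a b \<and> ent \<theta> a \<phi>"
    and restr_per: "is_per P (restr X \<phi>)"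
    and incl_hom: "incl X \<phi> \<in> Hom T (restr X \<phi>) X"
    and ap_incl: "ap (incl X \<phi>) \<theta> a b \<longleftrightarrow> eqv X \<theta> a b \<and> ent \<theta> a \<phi>"
proof -
  note C = per_Obj[OF X] and r = per_fibre[OF X]
  have f: "\<phi> \<in> fibre P (fst X)" and ext: "\<And>\<theta> a b. eqv X \<theta> a b \<Longrightarrow> ent \<theta> a \<phi> \<Longrightarrow> ent \<theta> b \<phi>"
    using ep by (auto simp: ext_pred_def)
  note p1 = pr1_hom[OF C C]
  note rf = reindex_fibre[OF p1 f]
  have mf: "snd (restr X \<phi>) \<in> fibre P (prd E (fst X) (fst X))" using meet_fibre[OF r rf] by (simp add: restr_def)
  have S: "eqv (restr X \<phi>) \<theta> a b \<longleftrightarrow> eqv X \<theta> a b \<and> ent \<theta> a \<phi>" for \<theta> a b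
  proof (cases "a \<in> Hom E (ob \<theta>) (fst X) \<and> b \<in> Hom E (ob \<theta>) (fst X)")
    case True
    then have a: "a \<in> Hom E (ob \<theta>) (fst X)" and b: "b \<in> Hom E (ob \<theta>) (fst X)" by auto
    show ?thesis
      using a b ent_meet[OF r rf] ent_reindex[OF p1 f tuple_hom[OF a b]] pr1_tuple[OF a b]
      by (simp add: eqv_def rl_def restr_def)
  qed (use eqv_hom[of "restr X \<phi>"] eqv_hom[of X] in \<open>auto simp: fst_restr\<close>)
  show "eqv (restr X \<phi>) \<theta> a b \<longleftrightarrow> eqv X \<theta> a b \<and> ent \<theta> a \<phi>" by (rule S)
  show per: "is_per P (restr X \<phi>)"
    unfolding is_per_iff S fst_restr
  proof (intro conjI allI impI C mf)
    fix \<theta> a b assume ab: "eqv X \<theta> a b \<and> ent \<theta> a \<phi>"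
    then show "eqv X \<theta> b a" "ent \<theta> b \<phi>" using eqv_sym[OF X] ext by blast+
    show "ent \<theta> a \<phi>" using ab by blast
    fix c assume "eqv X \<theta> b c \<and> ent \<theta> b \<phi>"
    then show "eqv X \<theta> a c" using ab eqv_trans[OF X] by blast
  qed
  have S': "rl (snd (restr X \<phi>)) (fst X) (fst X) = eqv (restr X \<phi>)" by (simp add: eqv_def fst_restr)
  have "frel (restr X \<phi>) X (eqv (restr X \<phi>))"
    unfolding frel_def S
  proof (intro conjI allI impI)
    fix \<theta> c assume e: "eqv X \<theta> c c \<and> ent \<theta> c \<phi>"
    then show "\<exists>f \<theta>' d. covers f \<theta>' \<theta> \<and> eqv X \<theta>' (c \<cdot> f) d \<and> ent \<theta>' (c \<cdot> f) \<phi>"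
      using covers_refl[OF eqv_hom(3)] comp_id[OF eqv_hom(1)] by metis
  next
    fix \<theta> c d c' d' assume 1: "eqv X \<theta> c d \<and> ent \<theta> c \<phi>"
    then show "eqv X \<theta> c c" "ent \<theta> c \<phi>" "eqv X \<theta> d d" using eqv_sym[OF X] eqv_trans[OF X] by blast+
    assume 2: "eqv X \<theta> c c' \<and> ent \<theta> c \<phi>"
    then show "ent \<theta> c' \<phi>" using ext by blast
    assume 3: "eqv X \<theta> d d'"
    show "eqv X \<theta> c' d'" using 1 2 3 eqv_sym[OF X] eqv_trans[OF X] by blast
  next
    fix \<theta> c d d' assume "eqv X \<theta> c d \<and> ent \<theta> c \<phi>" "eqv X \<theta> c d' \<and> ent \<theta> c \<phi>"
    then show "eqv X \<theta> d d'" using eqv_sym[OF X] eqv_trans[OF X] by blast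
  qed
  then have "mk (restr X \<phi>) X (snd (restr X \<phi>)) \<in> Hom T (restr X \<phi>) X"
    "ap (mk (restr X \<phi>) X (snd (restr X \<phi>))) = eqv (restr X \<phi>)"
    using mk_homI[OF per X, unfolded fst_restr, OF mf] S' by simp_all
  then show "incl X \<phi> \<in> Hom T (restr X \<phi>) X" "ap (incl X \<phi>) \<theta> a b \<longleftrightarrow> eqv X \<theta> a b \<and> ent \<theta> a \<phi>"
    using S by (simp_all add: incl_def)
qed

text \<open>Monicity quantifies over arrows, injectivity over elements at a stage. To pass from the
  first to the second, a stage is made into an object of the topos and two elements with the same
  image into parallel arrows out of it.\<close>

lemma mono_T_iff:
  assumes m: "m \<in> Hom T U A"
  shows "mono_arr T m \<longleftrightarrow> (\<forall>\<theta> d d' c. ap m \<theta> d c \<longrightarrow> ap m \<theta> d' c \<longrightarrow> eqv U \<theta> d d')"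
proof
  note U = hom_per(1)[OF m] and A = hom_per(2)[OF m]
  assume inj: "\<forall>\<theta> d d' c. ap m \<theta> d c \<longrightarrow> ap m \<theta> d' c \<longrightarrow> eqv U \<theta> d d'"
  show "mono_arr T m"
    unfolding mono_arr_def
  proof (intro conjI ballI impI)
    show "m \<in> Arr T" using m by (rule Hom_Arr)
    fix X F G assume F: "F \<in> Hom T X (src T m)" and G: "G \<in> Hom T X (src T m)" and e: "cmp T m F = cmp T m G"
    note F = F[unfolded Hom_src[OF m]] and G = G[unfolded Hom_src[OF m]]
    show "F = G"
    proof (rule T_hom_eqI[OF F G])
      fix \<theta> x d assume a: "ap F \<theta> x d"
      obtain f \<theta>' c where f: "covers f \<theta>' \<theta>" and b: "ap m \<theta>' (d \<cdot> f) c" using ap_total[OF m ap_eqv(2)[OF F a]] by blast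
      have "ap (cmp T m G) \<theta>' (x \<cdot> f) c"
        using ap_compI[OF F m ap_restrict[OF covers_ent[OF f] a] b] e by simp
      then obtain g \<theta>'' d' where g: "covers g \<theta>'' \<theta>'" and h: "ap G \<theta>'' (x \<cdot> f \<cdot> g) d'" "ap m \<theta>'' d' (c \<cdot> g)"
        unfolding ap_comp[OF G m] by blast
      have "eqv U \<theta>'' d' (d \<cdot> f \<cdot> g)" using inj h(2) ap_restrict[OF covers_ent[OF g] b] by blast
      then have "ap G \<theta>'' (x \<cdot> f \<cdot> g) (d \<cdot> f \<cdot> g)" using ap_ext2[OF G h(1)] by blast
      then have "ap G \<theta>' (x \<cdot> f) (d \<cdot> f)" using ap_local[OF G g] covers_restrict[OF f] ap_hom[OF F a] by blast
      then show "ap G \<theta> x d" using ap_local[OF G f] ap_hom[OF F a] by blast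
    qed
  qed
next
  note U = hom_per(1)[OF m] and A = hom_per(2)[OF m]
  assume mono: "mono_arr T m"
  show "\<forall>\<theta> d d' c. ap m \<theta> d c \<longrightarrow> ap m \<theta> d' c \<longrightarrow> eqv U \<theta> d d'"
  proof (intro allI impI)
    fix \<theta> d d' c assume a: "ap m \<theta> d c" and a': "ap m \<theta> d' c"
    note d = ap_hom(1)[OF m a] and d' = ap_hom(1)[OF m a'] and c = ap_hom(2)[OF m a]
    have t: "\<theta> \<in> Pred" using eqv_hom(3)[OF ap_eqv(1)[OF m a]] .
    have D: "is_per P (const_obj P (ob \<theta>))" using const_per[OF proj_ob[OF t]] .
    \<comment> \<open>The object representing the stage: the constant object on its context, cut
      down to where \<open>\<theta>\<close> holds.\<close>
    let ?D = "const_obj P (ob \<theta>)" and ?X = "restr (const_obj P (ob \<theta>)) \<theta>"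
    have local: "\<exists>g \<theta>''. covers g \<theta>'' \<theta>' \<and> x \<cdot> g = y \<cdot> g \<and> x \<in> Hom E (ob \<theta>') (ob \<theta>) \<and> y \<in> Hom E (ob \<theta>') (ob \<theta>)"
      if "eqv ?D \<theta>' x y" for \<theta>' x y
      using that eqv_const[OF proj_ob[OF t]] by blast
    have ep: "ext_pred ?D \<theta>"
      unfolding ext_pred_def
    proof (intro conjI allI impI)
      show "\<theta> \<in> fibre P (fst ?D)" using t by (simp add: fst_const_obj fibre_def)
      fix \<theta>' x y assume "eqv ?D \<theta>' x y" and e: "ent \<theta>' x \<theta>"
      then obtain g \<theta>'' where g: "covers g \<theta>'' \<theta>'" and xy: "x \<cdot> g = y \<cdot> g" and y: "y \<in> Hom E (ob \<theta>') (ob \<theta>)" using local by blast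
      show "ent \<theta>' y \<theta>" using covers_local[OF g _ y] ent_comp[OF covers_ent[OF g] e] xy by simp
    qed
    have Xp: "is_per P ?X" using restr_per[OF D ep] .
    have ex: "\<exists>F. F \<in> Hom T ?X U \<and> (\<forall>\<theta>' x z. ap F \<theta>' x z \<longleftrightarrow> eqv ?X \<theta>' x x \<and> eqv U \<theta>' (d1 \<cdot> x) z)"
      if a1: "ap m \<theta> d1 c" for d1
    proof -
      note d1 = ap_hom(1)[OF m a1]
      have e: "eqv U \<theta>' (d1 \<cdot> x) (d1 \<cdot> y)" if xy: "eqv ?X \<theta>' x y" for \<theta>' x y
      proof -
        have xy1: "eqv ?D \<theta>' x y" and ex: "ent \<theta>' x \<theta>" using xy eqv_restr[OF D ep] by blast+
        obtain g \<theta>'' where g: "covers g \<theta>'' \<theta>'" and gxy: "x \<cdot> g = y \<cdot> g"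
          and x: "x \<in> Hom E (ob \<theta>') (ob \<theta>)" and y: "y \<in> Hom E (ob \<theta>') (ob \<theta>)" using local[OF xy1] by blast
        have "eqv U \<theta>' (d1 \<cdot> x) (d1 \<cdot> x)" using eqv_restrict[OF ex ap_eqv(1)[OF m a1]] .
        then have "eqv U \<theta>'' (d1 \<cdot> x \<cdot> g) (d1 \<cdot> x \<cdot> g)" using eqv_restrict covers_ent[OF g] by blast
        moreover have "d1 \<cdot> x \<cdot> g = d1 \<cdot> y \<cdot> g"
          using assoc[OF d1 x covers_hom[OF g]] assoc[OF d1 y covers_hom[OF g]] gxy by simp
        ultimately have "eqv U \<theta>'' (d1 \<cdot> x \<cdot> g) (d1 \<cdot> y \<cdot> g)" by simp
        then show ?thesis using eqv_local[OF U g] comp_hom[OF d1 x] comp_hom[OF d1 y] by blast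
      qed
      have d1': "d1 \<in> Hom E (fst ?X) (fst U)" using d1 by (simp add: fst_restr fst_const_obj)
      show ?thesis by (rule graph_exists[OF Xp U d1' e]) blast+
    qed
    obtain F where F: "F \<in> Hom T ?X U" and apF: "\<And>\<theta>' x z. ap F \<theta>' x z \<longleftrightarrow> eqv ?X \<theta>' x x \<and> eqv U \<theta>' (d \<cdot> x) z"
      using ex[OF a] by blast
    obtain G where G: "G \<in> Hom T ?X U" and apG: "\<And>\<theta>' x z. ap G \<theta>' x z \<longleftrightarrow> eqv ?X \<theta>' x x \<and> eqv U \<theta>' (d' \<cdot> x) z"
      using ex[OF a'] by blast
    have "cmp T m F = cmp T m G"
    proof (rule T_hom_eqI[OF T_comp_hom[OF F m] T_comp_hom[OF G m]])
      fix \<theta>' x k assume s: "ap (cmp T m F) \<theta>' x k"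
      obtain f \<theta>'' z where f: "covers f \<theta>'' \<theta>'" and z: "ap F \<theta>'' (x \<cdot> f) z" "ap m \<theta>'' z (k \<cdot> f)"
        using s unfolding ap_comp[OF F m] by blast
      have x: "eqv ?X \<theta>'' (x \<cdot> f) (x \<cdot> f)" and dz: "eqv U \<theta>'' (d \<cdot> (x \<cdot> f)) z" using z(1) apF by blast+
      have ex: "ent \<theta>'' (x \<cdot> f) \<theta>" using x eqv_restr[OF D ep] by blast
      have "ap m \<theta>'' (d \<cdot> (x \<cdot> f)) (c \<cdot> (x \<cdot> f))" using ap_restrict[OF ex a] .
      then have "ap m \<theta>'' z (c \<cdot> (x \<cdot> f))" using ap_ext1[OF m _ dz] by blast
      then have ck: "eqv A \<theta>'' (c \<cdot> (x \<cdot> f)) (k \<cdot> f)" using ap_single[OF m _ z(2)] by blast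
      have b: "ap m \<theta>'' (d' \<cdot> (x \<cdot> f)) (c \<cdot> (x \<cdot> f))" using ap_restrict[OF ex a'] .
      have "ap G \<theta>'' (x \<cdot> f) (d' \<cdot> (x \<cdot> f))" using apG x ap_eqv(1)[OF m b] by blast
      then have "ap (cmp T m G) \<theta>'' (x \<cdot> f) (k \<cdot> f)"
        using ap_compI[OF G m] ap_ext2[OF m b ck] by blast
      then show "ap (cmp T m G) \<theta>' x k"
        using ap_local[OF T_comp_hom[OF G m] f] ap_hom[OF T_comp_hom[OF F m] s] by blast
    qed
    then have FG: "F = G" using T.mono_arrD[OF mono m F G] by blast
    have I: "idt E (ob \<theta>) \<in> Hom E (ob \<theta>) (ob \<theta>)" using id_hom[OF proj_ob[OF t]] .
    \<comment> \<open>The equal arrows are evaluated at the identity of the context, the generic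
      element of the stage, which returns \<open>d\<close> and \<open>d'\<close>.\<close>
    have "eqv ?X \<theta> (idt E (ob \<theta>)) (idt E (ob \<theta>))"
      unfolding eqv_restr[OF D ep] using eqv_const_refl[OF proj_ob[OF t] t I] ent_refl[OF t] by blast
    moreover have "eqv U \<theta> (d \<cdot> idt E (ob \<theta>)) d" using ap_eqv(1)[OF m a] comp_id[OF d] by simp
    ultimately have "ap F \<theta> (idt E (ob \<theta>)) d" using apF by blast
    then have "eqv U \<theta> (d' \<cdot> idt E (ob \<theta>)) d" using apG FG by blast
    then show "eqv U \<theta> d d'" using comp_id[OF d'] eqv_sym[OF U] by simp
  qed
qed

text \<open>The existential image along the second projection. Subobjects with different domains are
  compared through this predicate on the common carrier.\<close>

definition im :: "('o \<times> 'p) \<times> ('o \<times> 'p) \<times> 'p set \<Rightarrow> 'p" where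
  "im m = ex P (pr2 E (fst (fst m)) (fst (fst (snd m)))) (pred m)"

lemma
  assumes m: "m \<in> Hom T U A"
  shows im_fibre: "im m \<in> fibre P (fst A)"
    and ent_im: "ent \<theta> c (im m) \<longleftrightarrow> c \<in> Hom E (ob \<theta>) (fst A) \<and> (\<exists>f \<theta>' d. covers f \<theta>' \<theta> \<and> ap m \<theta>' d (c \<cdot> f))"
    and im_eqv: "ent \<theta> c (im m) \<Longrightarrow> eqv A \<theta> c c"
    and im_ext: "ext_pred A (im m)"
proof -
  note U = hom_per(1)[OF m] and A = hom_per(2)[OF m]
  note C = per_Obj[OF U] and D = per_Obj[OF A]
  note p2 = pr2_hom[OF C D]
  have im: "im m = ex P (pr2 E (fst U) (fst A)) (pred m)"
    using arg_cong[OF hom_mk[OF m], of fst] arg_cong[OF hom_mk[OF m], of "\<lambda>x. fst (snd x)"]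
    by (simp add: im_def mk_def)
  show f: "im m \<in> fibre P (fst A)" unfolding im using ex_fibre[OF p2 pred_fibre[OF m]] .
  show *: "ent \<theta> c (im m) \<longleftrightarrow> c \<in> Hom E (ob \<theta>) (fst A) \<and> (\<exists>f \<theta>' d. covers f \<theta>' \<theta> \<and> ap m \<theta>' d (c \<cdot> f))" for \<theta> c
  proof (cases "c \<in> Hom E (ob \<theta>) (fst A)")
    case c: True
    have "ent \<theta> c (im m) \<longleftrightarrow> (\<exists>f \<theta>' d. covers f \<theta>' \<theta> \<and> ap m \<theta>' d (c \<cdot> f))"
      unfolding im ent_ex[OF p2 pred_fibre[OF m] c]
    proof
      assume "\<exists>f \<theta>' a. covers f \<theta>' \<theta> \<and> a \<in> Hom E (ob \<theta>') (prd E (fst U) (fst A)) \<and>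
        pr2 E (fst U) (fst A) \<cdot> a = c \<cdot> f \<and> ent \<theta>' a (pred m)"
      then obtain f \<theta>' a where f: "covers f \<theta>' \<theta>" and a: "a \<in> Hom E (ob \<theta>') (prd E (fst U) (fst A))"
        and e: "pr2 E (fst U) (fst A) \<cdot> a = c \<cdot> f" "ent \<theta>' a (pred m)" by blast
      obtain d where "d \<in> Hom E (ob \<theta>') (fst U)" "a = tuple E d (c \<cdot> f)" using tuple_cases[OF a C D] e by metis
      then show "\<exists>f \<theta>' d. covers f \<theta>' \<theta> \<and> ap m \<theta>' d (c \<cdot> f)"
        using f e covers_restrict[OF f c] unfolding ap_rl[OF m] rl_def by blast
    next
      assume "\<exists>f \<theta>' d. covers f \<theta>' \<theta> \<and> ap m \<theta>' d (c \<cdot> f)"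
      then show "\<exists>f \<theta>' a. covers f \<theta>' \<theta> \<and> a \<in> Hom E (ob \<theta>') (prd E (fst U) (fst A)) \<and>
        pr2 E (fst U) (fst A) \<cdot> a = c \<cdot> f \<and> ent \<theta>' a (pred m)"
        unfolding ap_rl[OF m] rl_def using tuple_hom pr2_tuple by blast
    qed
    then show ?thesis using c by blast
  next
    case False
    then show ?thesis using ent_hom[of \<theta> c "im m"] f by (auto simp: fibre_def)
  qed
  show eq: "ent \<theta> c (im m) \<Longrightarrow> eqv A \<theta> c c" for \<theta> c
    unfolding * using eqv_local[OF A] ap_eqv(2)[OF m] by blast
  show "ext_pred A (im m)"
    unfolding ext_pred_def
  proof (intro conjI allI impI f)
    fix \<theta> a b assume e: "eqv A \<theta> a b" and "ent \<theta> a (im m)"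
    then obtain f \<theta>' d where f: "covers f \<theta>' \<theta>" and x: "ap m \<theta>' d (a \<cdot> f)" unfolding * by blast
    have "ap m \<theta>' d (b \<cdot> f)" using ap_ext2[OF m x eqv_restrict[OF covers_ent[OF f] e]] .
    then show "ent \<theta> b (im m)" unfolding * using f eqv_hom(2)[OF e] by blast
  qed
qed

lemma ent_imI: 
  assumes m: "m \<in> Hom T U A" and a: "ap m \<theta> d c" shows "ent \<theta> c (im m)"
proof -
  have "covers (idt E (ob \<theta>)) \<theta> \<theta>" using covers_refl[OF eqv_hom(3)[OF ap_eqv(1)[OF m a]]] .
  then show ?thesis unfolding ent_im[OF m] using ap_hom[OF m a] a comp_id by metis
qed

lemma ent_local_ext:
  assumes "ext_pred X \<phi>" "covers f \<theta>' \<theta>" "ent \<theta>' (c \<cdot> f) \<phi>" "c \<in> Hom E (ob \<theta>) (fst X)"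
  shows "ent \<theta> c \<phi>"
  using covers_local[OF assms(2,3)] assms by (simp add: ext_pred_def fibre_def)

section \<open>Subobjects in the category of partial equivalence relations\<close>

lemma subT_D:
  assumes "m \<in> fibre (sub T) A"
  shows "m \<in> Hom T (src T m) A" "mono_arr T m" "is_per P A"
    and "ap m \<theta> d c \<Longrightarrow> ap m \<theta> d' c \<Longrightarrow> eqv (src T m) \<theta> d d'"
proof -
  show h: "m \<in> Hom T (src T m) A" and mo: "mono_arr T m" using fibre_subD[OF assms] by simp_all
  show "is_per P A" using hom_per[OF h] by blast
  show "ap m \<theta> d c \<Longrightarrow> ap m \<theta> d' c \<Longrightarrow> eqv (src T m) \<theta> d d'" using mono_T_iff[OF h] mo by blast
qed

lemma factors_im:
  assumes m: "m \<in> Hom T U A" and n: "n \<in> Hom T V A" and "factors T n m" and e: "ent \<theta> c (im m)"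
  shows "ent \<theta> c (im n)"
proof -
  obtain g where g: "g \<in> Hom T U V" and ng: "cmp T n g = m" using T.factorsE[OF assms(3) n m] .
  obtain f \<theta>' d where f: "covers f \<theta>' \<theta>" and a: "ap m \<theta>' d (c \<cdot> f)" and c: "c \<in> Hom E (ob \<theta>) (fst A)"
    using e unfolding ent_im[OF m] by blast
  obtain f' \<theta>'' v where f': "covers f' \<theta>'' \<theta>'" and b: "ap n \<theta>'' v (c \<cdot> f \<cdot> f')"
    using a unfolding ng[symmetric] ap_comp[OF g n] by blast
  have "ent \<theta>'' (c \<cdot> f \<cdot> f') (im n)" using ent_imI[OF n b] .
  then show ?thesis
    using ent_local_ext[OF im_ext[OF n] f ent_local_ext[OF im_ext[OF n] f' _ covers_restrict[OF f c]] c] by blast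
qed

text \<open>The factorization relates \<open>d\<close> to \<open>v\<close> when \<open>m\<close> and
  \<open>n\<close> send them to a common \<open>c\<close>. Inclusion of images makes this relation
  total, monicity of \<open>n\<close> makes it single-valued.\<close>

lemma factors_if_im:
  assumes m: "m \<in> Hom T U A" and n: "n \<in> Hom T V A" and mono: "mono_arr T n"
    and le: "\<And>\<theta> c. ent \<theta> c (im m) \<Longrightarrow> ent \<theta> c (im n)"
  shows "factors T n m"
proof -
  note U = hom_per(1)[OF m] and A = hom_per(2)[OF m] and V = hom_per(1)[OF n]
  note oU = per_Obj[OF U] and oA = per_Obj[OF A] and oV = per_Obj[OF V]
  note inj = mono_T_iff[OF n, THEN iffD1, OF mono, rule_format]
  \<comment> \<open>The swap of the two factors; it transposes the graph of \<open>n\<close>, so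
    that the relation sought is a relational composite.\<close>
  let ?s = "tuple E (pr2 E (fst A) (fst V)) (pr1 E (fst A) (fst V))"
  have s: "?s \<in> Hom E (prd E (fst A) (fst V)) (prd E (fst V) (fst A))"
    using tuple_hom[OF pr2_hom[OF oA oV] pr1_hom[OF oA oV]] .
  let ?n = "reindex P ?s (pred n)"
  have nf: "?n \<in> fibre P (prd E (fst A) (fst V))" using reindex_fibre[OF s pred_fibre[OF n]] .
  have rn: "rl ?n (fst A) (fst V) \<theta> c v \<longleftrightarrow> ap n \<theta> v c" for \<theta> c v
  proof (cases "c \<in> Hom E (ob \<theta>) (fst A) \<and> v \<in> Hom E (ob \<theta>) (fst V)")
    case True
    then have c: "c \<in> Hom E (ob \<theta>) (fst A)" and v: "v \<in> Hom E (ob \<theta>) (fst V)" by auto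
    have "?s \<cdot> tuple E c v = tuple E v c"
      using tuple_comp[OF pr2_hom[OF oA oV] pr1_hom[OF oA oV] tuple_hom[OF c v]] pr1_tuple[OF c v] pr2_tuple[OF c v] by simp
    then show ?thesis
      using c v ent_reindex[OF s pred_fibre[OF n] tuple_hom[OF c v]] by (simp add: rl_def ap_rl[OF n])
  qed (use ap_hom[OF n] rl_hom in blast)
  let ?R = "rel_comp P (fst U) (fst A) (fst V) ?n (pred m)"
  let ?S = "rl ?R (fst U) (fst V)"
  note rc = rl_comp[OF oU oA oV pred_fibre[OF m] nf]
  have S: "?S \<theta> d v \<longleftrightarrow> d \<in> Hom E (ob \<theta>) (fst U) \<and> v \<in> Hom E (ob \<theta>) (fst V) \<and>
      (\<exists>f \<theta>' c. covers f \<theta>' \<theta> \<and> ap m \<theta>' (d \<cdot> f) c \<and> ap n \<theta>' (v \<cdot> f) c)" for \<theta> d v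
    unfolding rc(2) rn ap_rl[OF m] ..
  have elim: "\<exists>f \<theta>' c. covers f \<theta>' \<theta> \<and> ap m \<theta>' (d \<cdot> f) c \<and> ap n \<theta>' (v \<cdot> f) c" if "?S \<theta> d v" for \<theta> d v
    using that S by blast
  have "frel U V ?S"
    unfolding frel_def
  proof (intro conjI allI impI)
    fix \<theta> d v assume s: "?S \<theta> d v"
    then obtain f \<theta>' c where f: "covers f \<theta>' \<theta>" and a: "ap m \<theta>' (d \<cdot> f) c" "ap n \<theta>' (v \<cdot> f) c" using elim by blast
    show "eqv U \<theta> d d" using eqv_local[OF U f ap_eqv(1)[OF m a(1)]] rl_hom[OF s] by blast
    show "eqv V \<theta> v v" using eqv_local[OF V f ap_eqv(1)[OF n a(2)]] rl_hom[OF s] by blast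
    fix d' v' assume e: "eqv U \<theta> d d'" "eqv V \<theta> v v'"
    have "ap m \<theta>' (d' \<cdot> f) c" using ap_ext1[OF m a(1) eqv_restrict[OF covers_ent[OF f] e(1)]] .
    moreover have "ap n \<theta>' (v' \<cdot> f) c" using ap_ext1[OF n a(2) eqv_restrict[OF covers_ent[OF f] e(2)]] .
    ultimately show "?S \<theta> d' v'" unfolding S using f eqv_hom(2)[OF e(1)] eqv_hom(2)[OF e(2)] by blast
  next
    fix \<theta> d v v' assume s: "?S \<theta> d v" and s': "?S \<theta> d v'"
    obtain f \<theta>' c where f: "covers f \<theta>' \<theta>" and a: "ap m \<theta>' (d \<cdot> f) c" "ap n \<theta>' (v \<cdot> f) c" using elim[OF s] by blast
    obtain g \<theta>'' c' where g: "covers g \<theta>'' \<theta>'" and b: "ap m \<theta>'' (d \<cdot> f \<cdot> g) c'" "ap n \<theta>'' (v' \<cdot> f \<cdot> g) c'"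
      using elim[OF rl_restrict[OF covers_ent[OF f] s']] by blast
    have "eqv A \<theta>'' (c \<cdot> g) c'" using ap_single[OF m ap_restrict[OF covers_ent[OF g] a(1)] b(1)] .
    then have "ap n \<theta>'' (v \<cdot> f \<cdot> g) c'" using ap_ext2[OF n ap_restrict[OF covers_ent[OF g] a(2)]] by blast
    then have "eqv V \<theta>'' (v \<cdot> f \<cdot> g) (v' \<cdot> f \<cdot> g)" using inj b(2) by blast
    then have "eqv V \<theta>' (v \<cdot> f) (v' \<cdot> f)"
      using eqv_local[OF V g] covers_restrict[OF f] rl_hom(2)[OF s] rl_hom(2)[OF s'] by blast
    then show "eqv V \<theta> v v'" using eqv_local[OF V f] rl_hom(2)[OF s] rl_hom(2)[OF s'] by blast
  next
    fix \<theta> d assume e: "eqv U \<theta> d d"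
    obtain f \<theta>' c where f: "covers f \<theta>' \<theta>" and a: "ap m \<theta>' (d \<cdot> f) c" using ap_total[OF m e] by blast
    obtain g \<theta>'' v where g: "covers g \<theta>'' \<theta>'" and b: "ap n \<theta>'' v (c \<cdot> g)"
      using le[OF ent_imI[OF m a]] unfolding ent_im[OF n] by blast
    have t: "\<theta>'' \<in> Pred" using covers_ent[OF g] ent_dom by blast
    have a': "ap m \<theta>'' (d \<cdot> f \<cdot> g) (c \<cdot> g)" using ap_restrict[OF covers_ent[OF g] a] .
    have "?S \<theta>'' (d \<cdot> f \<cdot> g) v"
      unfolding S using covers_refl[OF t] a' b ap_hom[OF m a'] ap_hom[OF n b] comp_id by metis
    moreover have "d \<cdot> f \<cdot> g = d \<cdot> (f \<cdot> g)" using assoc[OF eqv_hom(1)[OF e] covers_hom[OF f] covers_hom[OF g]] by simp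
    ultimately show "\<exists>f \<theta>' v. covers f \<theta>' \<theta> \<and> ?S \<theta>' (d \<cdot> f) v" using covers_trans[OF f g] by metis
  qed
  from mk_homI[OF U V rc(1) this] have g: "mk U V ?R \<in> Hom T U V" and ag: "ap (mk U V ?R) = ?S" by blast+
  have ng: "cmp T n (mk U V ?R) = m"
  proof (rule T_hom_eqI[OF T_comp_hom[OF g n] m])
    fix \<theta> d c assume x: "ap (cmp T n (mk U V ?R)) \<theta> d c"
    note xh = ap_hom[OF T_comp_hom[OF g n] x]
    obtain f \<theta>' v where f: "covers f \<theta>' \<theta>" and a: "?S \<theta>' (d \<cdot> f) v" "ap n \<theta>' v (c \<cdot> f)"
      using x unfolding ap_comp[OF g n] ag by blast
    obtain g \<theta>'' c' where g: "covers g \<theta>'' \<theta>'" and b: "ap m \<theta>'' (d \<cdot> f \<cdot> g) c'" "ap n \<theta>'' (v \<cdot> g) c'"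
      using elim[OF a(1)] by blast
    have "eqv A \<theta>'' c' (c \<cdot> f \<cdot> g)" using ap_single[OF n b(2) ap_restrict[OF covers_ent[OF g] a(2)]] .
    then have "ap m \<theta>'' (d \<cdot> f \<cdot> g) (c \<cdot> f \<cdot> g)" using ap_ext2[OF m b(1)] by blast
    then show "ap m \<theta> d c" using ap_local[OF m f ap_local[OF m g]] covers_restrict[OF f] xh by blast
  qed
  show ?thesis using T.factorsI[OF n g ng] .
qed

lemma sub_T_le:
  assumes m: "m \<in> fibre (sub T) A" and n: "n \<in> fibre (sub T) A"
  shows "le (sub T) A m n \<longleftrightarrow> (\<forall>\<theta> c. ent \<theta> c (im m) \<longrightarrow> ent \<theta> c (im n))"
  unfolding T.sub_le using m n factors_im[OF subT_D(1)[OF m] subT_D(1)[OF n]]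
    factors_if_im[OF subT_D(1)[OF m] subT_D(1,2)[OF n]] by blast

lemma
  assumes X: "is_per P X" and ep: "ext_pred X \<phi>"
  shows incl_fibre: "incl X \<phi> \<in> fibre (sub T) X"
    and ent_im_incl: "ent \<theta> c (im (incl X \<phi>)) \<longleftrightarrow> eqv X \<theta> c c \<and> ent \<theta> c \<phi>"
proof -
  note h = incl_hom[OF X ep] and a = ap_incl[OF X ep]
  have ext: "\<And>\<theta> a b. eqv X \<theta> a b \<Longrightarrow> ent \<theta> a \<phi> \<Longrightarrow> ent \<theta> b \<phi>" using ep by (auto simp: ext_pred_def)
  have "mono_arr T (incl X \<phi>)"
    unfolding mono_T_iff[OF h] a eqv_restr[OF X ep] using eqv_sym[OF X] eqv_trans[OF X] by blast
  then show "incl X \<phi> \<in> fibre (sub T) X" using h by (rule fibre_subI)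
  show "ent \<theta> c (im (incl X \<phi>)) \<longleftrightarrow> eqv X \<theta> c c \<and> ent \<theta> c \<phi>"
  proof
    assume e: "ent \<theta> c (im (incl X \<phi>))"
    obtain f \<theta>' d where f: "covers f \<theta>' \<theta>" and b: "eqv X \<theta>' d (c \<cdot> f)" "ent \<theta>' d \<phi>" and c: "c \<in> Hom E (ob \<theta>) (fst X)"
      using e unfolding ent_im[OF h] a by blast
    show "eqv X \<theta> c c \<and> ent \<theta> c \<phi>" using im_eqv[OF h e] ent_local_ext[OF ep f ext[OF b] c] by blast
  next
    assume "eqv X \<theta> c c \<and> ent \<theta> c \<phi>"
    then show "ent \<theta> c (im (incl X \<phi>))" using ent_imI[OF h] a by blast
  qed
qed

section \<open>Meets and negation of subobjects in terms of elements\<close>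

definition falsum :: "'p \<Rightarrow> bool" where
  "falsum \<theta> \<longleftrightarrow> ent \<theta> (idt E (ob \<theta>)) (bot_of P (ob \<theta>))"

lemma falsumE: "falsum \<theta> \<Longrightarrow> c \<in> Hom E (ob \<theta>) (ob \<chi>) \<Longrightarrow> \<chi> \<in> Pred \<Longrightarrow> ent \<theta> c \<chi>"
  unfolding falsum_def using ent_bot[OF bot_exists] proj_ob ent_dom by blast

text \<open>Whether falsity holds depends on the stage alone and not on the element or its type.
  Negation can thus be expressed by inconsistency of later stages.\<close>

lemma ent_bot_iff:
  assumes "A \<in> Obj E" "a \<in> Hom E (ob \<theta>) A"
  shows "ent \<theta> a (bot_of P A) \<longleftrightarrow> falsum \<theta>"
proof
  assume e: "ent \<theta> a (bot_of P A)"
  have o: "ob \<theta> \<in> Obj E" using Hom_Obj(1)[OF assms(2)] .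
  then have "bot_of P (ob \<theta>) \<in> Pred" "ob (bot_of P (ob \<theta>)) = ob \<theta>" using bot_fibre by (auto simp: fibre_def)
  then show "falsum \<theta>" unfolding falsum_def using ent_bot[OF bot_exists[OF assms(1)] e] id_hom[OF o] by simp
next
  assume "falsum \<theta>"
  then show "ent \<theta> a (bot_of P A)" using falsumE assms bot_fibre[OF assms(1)] by (simp add: fibre_def)
qed

lemma falsum_local:
  assumes f: "covers f \<theta>' \<theta>" and "falsum \<theta>'" shows "falsum \<theta>"
proof -
  have t: "\<theta> \<in> Pred" using covers_ent[OF f] ent_cod by blast
  have b: "bot_of P (ob \<theta>) \<in> Pred" "ob (bot_of P (ob \<theta>)) = ob \<theta>"
    using bot_fibre[OF proj_ob[OF t]] by (auto simp: fibre_def)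
  have I: "idt E (ob \<theta>) \<in> Hom E (ob \<theta>) (ob (bot_of P (ob \<theta>)))" using id_hom[OF proj_ob[OF t]] b by simp
  show ?thesis unfolding falsum_def
    using covers_local[OF f falsumE[OF assms(2) covers_restrict[OF f I] b(1)] I] .
qed

lemma ent_imp_bot:
  assumes "\<phi> \<in> fibre P A" "\<theta> \<in> Pred" "c \<in> Hom E (ob \<theta>) A"
  shows "ent \<theta> c (imp P A \<phi> (bot_of P A)) \<longleftrightarrow> (\<forall>f \<theta>'. ent \<theta>' f \<theta> \<longrightarrow> ent \<theta>' (c \<cdot> f) \<phi> \<longrightarrow> falsum \<theta>')"
proof -
  have A: "A \<in> Obj E" using Hom_Obj(2)[OF assms(3)] .
  show ?thesis unfolding ent_imp[OF assms(1) bot_fibre[OF A] assms(2,3)]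
    using ent_bot_iff[OF A] ent_restrict assms(3) by blast
qed

text \<open>The conjunction of the two images gives one meet explicitly; any other is isomorphic to
  it and so has the same elements.\<close>

lemma im_is_meet:
  assumes w: "w \<in> fibre (sub T) A" and m: "m \<in> fibre (sub T) A"
  shows "\<exists>v. is_meet (sub T) A w m v"
    and "is_meet (sub T) A w m v \<Longrightarrow> ent \<theta> c (im v) \<longleftrightarrow> ent \<theta> c (im w) \<and> ent \<theta> c (im m)"
proof -
  note A = subT_D(3)[OF m]
  note wh = subT_D(1)[OF w] and mh = subT_D(1)[OF m]
  let ?\<phi> = "meet P (fst A) (im w) (im m)"
  note em = ent_meet[OF im_fibre[OF wh] im_fibre[OF mh]]
  have ep: "ext_pred A ?\<phi>"
    using im_ext[OF wh] im_ext[OF mh] meet_fibre em unfolding ext_pred_def by blast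
  note vf = incl_fibre[OF A ep]
  have iv: "ent \<theta> c (im (incl A ?\<phi>)) \<longleftrightarrow> ent \<theta> c (im w) \<and> ent \<theta> c (im m)" for \<theta> c
    using ent_im_incl[OF A ep] em im_eqv[OF wh] by blast
  have v: "is_meet (sub T) A w m (incl A ?\<phi>)"
    unfolding is_meet_def using sub_T_le[OF vf w] sub_T_le[OF vf m] sub_T_le[OF _ vf] sub_T_le[OF _ w] sub_T_le[OF _ m] iv
    by blast
  then show "\<exists>v. is_meet (sub T) A w m v" by blast
  assume v': "is_meet (sub T) A w m v"
  then have vf': "v \<in> fibre (sub T) A" by (auto simp: is_meet_def le_def)
  have "le (sub T) A v (incl A ?\<phi>)" "le (sub T) A (incl A ?\<phi>) v"
    using v v' vf vf' unfolding is_meet_def by blast+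
  then show "ent \<theta> c (im v) \<longleftrightarrow> ent \<theta> c (im w) \<and> ent \<theta> c (im m)"
    using sub_T_le[OF vf' vf] sub_T_le[OF vf vf'] iv by blast
qed

text \<open>\<open>neg\<close> and \<open>bot_of\<close> are choices by \<open>SOME\<close>.
  Explicit inclusions show that suitable objects exist, after which the chosen ones are compared
  with them by their universal properties.\<close>

lemma
  assumes m: "m \<in> fibre (sub T) A"
  shows neg_fibre: "neg (sub T) A m \<in> fibre (sub T) A"
    and le_neg: "w \<in> fibre (sub T) A \<Longrightarrow> le (sub T) A w (neg (sub T) A m) \<longleftrightarrow>
      (\<forall>\<theta> c. ent \<theta> c (im w) \<longrightarrow> ent \<theta> c (im m) \<longrightarrow> falsum \<theta>)"
    and ent_im_neg: "ent \<theta> c (im (neg (sub T) A m)) \<longleftrightarrow>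
      eqv A \<theta> c c \<and> (\<forall>f \<theta>'. ent \<theta>' f \<theta> \<longrightarrow> ent \<theta>' (c \<cdot> f) (im m) \<longrightarrow> falsum \<theta>')"
proof -
  note A = subT_D(3)[OF m] and mh = subT_D(1)[OF m]
  note C = per_Obj[OF A]
  have b0: "ext_pred A (bot_of P (fst A))"
    unfolding ext_pred_def using bot_fibre[OF C] ent_bot_iff[OF C] eqv_hom by blast
  have "is_bot (sub T) A (incl A (bot_of P (fst A)))"
    unfolding is_bot_def
  proof (intro conjI ballI)
    show b: "incl A (bot_of P (fst A)) \<in> fibre (sub T) A" using incl_fibre[OF A b0] .
    fix x assume x: "x \<in> fibre (sub T) A"
    show "le (sub T) A (incl A (bot_of P (fst A))) x"
      unfolding sub_T_le[OF b x] ent_im_incl[OF A b0]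
    proof (intro allI impI)
      fix \<theta> c assume e: "eqv A \<theta> c c \<and> ent \<theta> c (bot_of P (fst A))"
      then have c: "c \<in> Hom E (ob \<theta>) (fst A)" using eqv_hom(1) by blast
      then show "ent \<theta> c (im x)"
        using falsumE[of \<theta> c "im x"] ent_bot_iff[OF C c] e im_fibre[OF subT_D(1)[OF x]] by (simp add: fibre_def)
    qed
  qed
  then have bot: "is_bot (sub T) A (bot_of (sub T) A)" unfolding bot_of_def by (rule someI)
  let ?b = "bot_of (sub T) A"
  have bf: "?b \<in> fibre (sub T) A" using bot by (simp add: is_bot_def)
  have ib: "ent \<theta> c (im ?b) \<longleftrightarrow> c \<in> Hom E (ob \<theta>) (fst A) \<and> falsum \<theta>" for \<theta> c
  proof
    assume e: "ent \<theta> c (im ?b)"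
    have "le (sub T) A ?b (incl A (bot_of P (fst A)))" using bot incl_fibre[OF A b0] by (auto simp: is_bot_def)
    then have "ent \<theta> c (bot_of P (fst A))"
      using sub_T_le[OF bf incl_fibre[OF A b0]] ent_im_incl[OF A b0] e by blast
    moreover have "c \<in> Hom E (ob \<theta>) (fst A)" using e ent_im[OF subT_D(1)[OF bf]] by blast
    ultimately show "c \<in> Hom E (ob \<theta>) (fst A) \<and> falsum \<theta>" using ent_bot_iff[OF C] by blast
  next
    assume "c \<in> Hom E (ob \<theta>) (fst A) \<and> falsum \<theta>"
    then show "ent \<theta> c (im ?b)" using falsumE im_fibre[OF subT_D(1)[OF bf]] by (simp add: fibre_def)
  qed
  have le_b: "le (sub T) A v ?b \<longleftrightarrow> (\<forall>\<theta> c. ent \<theta> c (im w) \<longrightarrow> ent \<theta> c (im m) \<longrightarrow> falsum \<theta>)"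
    if w: "w \<in> fibre (sub T) A" and v: "is_meet (sub T) A w m v" for w v
  proof -
    have vf: "v \<in> fibre (sub T) A" using v by (auto simp: is_meet_def le_def)
    show ?thesis
      unfolding sub_T_le[OF vf bf] im_is_meet(2)[OF w m v] ib using ent_im[OF mh] by blast
  qed
  \<comment> \<open>The fibrewise pseudo-complement of the image; its inclusion is the explicit
    negation of \<open>m\<close>.\<close>
  let ?\<phi> = "imp P (fst A) (im m) (bot_of P (fst A))"
  have pf: "?\<phi> \<in> fibre P (fst A)" using imp_fibre[OF im_fibre[OF mh] bot_fibre[OF C]] .
  note ei = ent_imp_bot[OF im_fibre[OF mh]]
  have ep: "ext_pred A ?\<phi>"
    unfolding ext_pred_def
  proof (intro conjI allI impI pf)
    fix \<theta> a b assume e: "eqv A \<theta> a b" and x: "ent \<theta> a ?\<phi>"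
    note x' = x[unfolded ei[OF eqv_hom(3)[OF e] eqv_hom(1)[OF e]], rule_format]
    show "ent \<theta> b ?\<phi>"
      unfolding ei[OF eqv_hom(3)[OF e] eqv_hom(2)[OF e]]
    proof (intro allI impI)
      fix f \<theta>' assume f: "ent \<theta>' f \<theta>" and y: "ent \<theta>' (b \<cdot> f) (im m)"
      show "falsum \<theta>'"
        using x'[OF f] y im_ext[OF mh] eqv_sym[OF A eqv_restrict[OF f e]] by (auto simp: ext_pred_def)
    qed
  qed
  have I: "is_imp (sub T) A m ?b (incl A ?\<phi>)"
    unfolding is_imp_def
  proof (intro conjI ballI allI impI)
    show z: "incl A ?\<phi> \<in> fibre (sub T) A" using incl_fibre[OF A ep] .
    fix w v assume w: "w \<in> fibre (sub T) A" and v: "is_meet (sub T) A w m v"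
    note wh = subT_D(1)[OF w]
    show "le (sub T) A w (incl A ?\<phi>) \<longleftrightarrow> le (sub T) A v ?b"
      unfolding le_b[OF w v] sub_T_le[OF w z] ent_im_incl[OF A ep]
    proof
      assume l: "\<forall>\<theta> c. ent \<theta> c (im w) \<longrightarrow> eqv A \<theta> c c \<and> ent \<theta> c ?\<phi>"
      show "\<forall>\<theta> c. ent \<theta> c (im w) \<longrightarrow> ent \<theta> c (im m) \<longrightarrow> falsum \<theta>"
      proof (intro allI impI)
        fix \<theta> c assume x: "ent \<theta> c (im w)" and y: "ent \<theta> c (im m)"
        have t: "\<theta> \<in> Pred" and c: "c \<in> Hom E (ob \<theta>) (fst A)" using ent_dom[OF x] x ent_im[OF wh] by blast+
        show "falsum \<theta>"
          using l x y ei[OF t c] ent_refl[OF t] comp_id[OF c] by metis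
      qed
    next
      assume r: "\<forall>\<theta> c. ent \<theta> c (im w) \<longrightarrow> ent \<theta> c (im m) \<longrightarrow> falsum \<theta>"
      show "\<forall>\<theta> c. ent \<theta> c (im w) \<longrightarrow> eqv A \<theta> c c \<and> ent \<theta> c ?\<phi>"
      proof (intro allI impI conjI)
        fix \<theta> c assume x: "ent \<theta> c (im w)"
        show e: "eqv A \<theta> c c" using im_eqv[OF wh x] .
        show "ent \<theta> c ?\<phi>" unfolding ei[OF eqv_hom(3)[OF e] eqv_hom(1)[OF e]] using r ent_comp x by blast
      qed
    qed
  qed
  then have N: "is_imp (sub T) A m ?b (neg (sub T) A m)" unfolding neg_def imp_def by (rule someI)
  show nf: "neg (sub T) A m \<in> fibre (sub T) A" using N by (simp add: is_imp_def)
  show "ent \<theta> c (im (neg (sub T) A m)) \<longleftrightarrow>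
      eqv A \<theta> c c \<and> (\<forall>f \<theta>'. ent \<theta>' f \<theta> \<longrightarrow> ent \<theta>' (c \<cdot> f) (im m) \<longrightarrow> falsum \<theta>')"
  proof -
    let ?N = "neg (sub T) A m" and ?I = "incl A ?\<phi>"
    have If: "?I \<in> fibre (sub T) A" using incl_fibre[OF A ep] .
    \<comment> \<open>Two implications with the same arguments have the same lower bounds, hence lie
      below each other. A meet of \<open>w\<close> and \<open>m\<close> has to exist for
      \<open>is_imp\<close> to say anything about \<open>w\<close>.\<close>
    have iff: "le (sub T) A w ?N \<longleftrightarrow> le (sub T) A w ?I" if w: "w \<in> fibre (sub T) A" for w
      using im_is_meet(1)[OF w m] N I w unfolding is_imp_def by blast
    have "le (sub T) A ?N ?N" "le (sub T) A ?I ?I" using sub_T_le nf If by blast+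
    then have "ent \<theta> c (im ?N) \<longleftrightarrow> ent \<theta> c (im ?I)"
      using iff[OF nf] iff[OF If] sub_T_le[OF nf If] sub_T_le[OF If nf] by blast
    then show ?thesis unfolding ent_im_incl[OF A ep] using ei[OF eqv_hom(3) eqv_hom(1)] by blast
  qed
  assume w: "w \<in> fibre (sub T) A"
  obtain v where v: "is_meet (sub T) A w m v" using im_is_meet(1)[OF w m] by blast
  show "le (sub T) A w (neg (sub T) A m) \<longleftrightarrow> (\<forall>\<theta> c. ent \<theta> c (im w) \<longrightarrow> ent \<theta> c (im m) \<longrightarrow> falsum \<theta>)"
    using N w v le_b[OF w v] unfolding is_imp_def by blast
qed

end

section \<open>The closure operator of a totally connected tripos\<close>

locale tc_tripos = tripos_fib P for P :: "('o, 'a, 'p, 'q) fib" +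
  fixes \<pi> :: "'p \<Rightarrow> 'a"
  assumes pi_fibre: "\<phi> \<in> fibre P A \<Longrightarrow> \<pi> \<phi> \<in> fibre (sub (Base P)) A"
    and pi_adj: "\<phi> \<in> fibre P A \<Longrightarrow> m \<in> fibre (sub (Base P)) A \<Longrightarrow>
      le (sub (Base P)) A (\<pi> \<phi>) m \<longleftrightarrow> le P A \<phi> (delta P m)"
    and pi_reindex_iso: "f \<in> Hom (Base P) A B \<Longrightarrow> \<phi> \<in> fibre P B \<Longrightarrow>
      fib_iso (sub (Base P)) A (\<pi> (reindex P f \<phi>)) (reindex (sub (Base P)) f (\<pi> \<phi>))"
    and pi_top: "is_top P A t \<Longrightarrow> is_top (sub (Base P)) A (\<pi> t)"
    and pi_meet: "is_meet P A \<phi> \<psi> \<chi> \<Longrightarrow> is_meet (sub (Base P)) A (\<pi> \<phi>) (\<pi> \<psi>) (\<pi> \<chi>)"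
    and boolean: "m \<in> fibre (sub (Base P)) A \<Longrightarrow> \<exists>n b t. is_bot (sub (Base P)) A b \<and>
      is_meet (sub (Base P)) A m n b \<and> is_top (sub (Base P)) A t \<and> is_join (sub (Base P)) A m n t"
begin

definition J :: "'p \<Rightarrow> 'p" where "J \<phi> = delta P (\<pi> \<phi>)"

definition closed :: "'p \<Rightarrow> bool" where
  "closed \<psi> \<longleftrightarrow> \<psi> \<in> Pred \<and> (\<forall>\<theta> a. ent \<theta> a (J \<psi>) \<longrightarrow> ent \<theta> a \<psi>)"


lemma
  assumes m: "m \<in> fibre (sub E) A"
  shows delta_fibre: "delta P m \<in> fibre P A"
    and ent_delta: "a \<in> Hom E (ob \<theta>) A \<Longrightarrow>
      ent \<theta> a (delta P m) \<longleftrightarrow> (\<exists>f \<theta>'. covers f \<theta>' \<theta> \<and> factors E m (a \<cdot> f))"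
proof -
  note h = fibre_subD(2)[OF m]
  note o = Hom_Obj(1)[OF h]
  show "delta P m \<in> fibre P A" unfolding delta_def using ex_fibre[OF h top_fibre[OF o]] .
  assume a: "a \<in> Hom E (ob \<theta>) A"
  show "ent \<theta> a (delta P m) \<longleftrightarrow> (\<exists>f \<theta>'. covers f \<theta>' \<theta> \<and> factors E m (a \<cdot> f))"
    unfolding delta_def ent_ex[OF h top_fibre[OF o] a]
  proof
    assume "\<exists>f \<theta>' x. covers f \<theta>' \<theta> \<and> x \<in> Hom E (ob \<theta>') (src E m) \<and> m \<cdot> x = a \<cdot> f \<and> ent \<theta>' x (top_of P (src E m))"
    then show "\<exists>f \<theta>'. covers f \<theta>' \<theta> \<and> factors E m (a \<cdot> f)" using factorsI[OF h] by blast
  next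
    assume "\<exists>f \<theta>'. covers f \<theta>' \<theta> \<and> factors E m (a \<cdot> f)"
    then obtain f \<theta>' where f: "covers f \<theta>' \<theta>" and fa: "factors E m (a \<cdot> f)" by blast
    obtain x where x: "x \<in> Hom E (ob \<theta>') (src E m)" "m \<cdot> x = a \<cdot> f"
      using factorsE[OF fa h covers_restrict[OF f a]] .
    have "ent \<theta>' x (top_of P (src E m))"
      using ent_top[OF top_exists[OF o] ent_dom[OF covers_ent[OF f]] x(1)] .
    then show "\<exists>f \<theta>' x. covers f \<theta>' \<theta> \<and> x \<in> Hom E (ob \<theta>') (src E m) \<and> m \<cdot> x = a \<cdot> f \<and> ent \<theta>' x (top_of P (src E m))"
      using f x by blast
  qed
qed

lemma ent_fibre_hom: "\<phi> \<in> fibre P A \<Longrightarrow> ent \<theta> a \<phi> \<Longrightarrow> a \<in> Hom E (ob \<theta>) A"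
  using ent_hom[of \<theta> a \<phi>] by (simp add: fibre_def)

lemma ent_deltaI:
  assumes m: "m \<in> fibre (sub E) A" and t: "\<theta> \<in> Pred" and a: "a \<in> Hom E (ob \<theta>) A" and "factors E m a"
  shows "ent \<theta> a (delta P m)"
  using ent_delta[OF m a] covers_refl[OF t] comp_id[OF a] assms(4) by metis

lemma delta_mono:
  assumes m: "m \<in> fibre (sub E) A" and n: "n \<in> fibre (sub E) A" and l: "factors E n m"
    and e: "ent \<theta> a (delta P m)"
  shows "ent \<theta> a (delta P n)"
proof -
  have a: "a \<in> Hom E (ob \<theta>) A" using ent_fibre_hom[OF delta_fibre[OF m] e] .
  obtain f \<theta>' where f: "covers f \<theta>' \<theta>" "factors E m (a \<cdot> f)" using e ent_delta[OF m a] by blast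
  have "factors E n (a \<cdot> f)"
    using factors_trans[OF l f(2) fibre_subD(2)[OF n] fibre_subD(2)[OF m] covers_restrict[OF f(1) a]] .
  then show ?thesis using ent_delta[OF n a] f by blast
qed

text \<open>The two memberships hold on two covers; on a common refinement they are plain
  memberships and combine in the meet.\<close>

lemma delta_meet:
  assumes z: "is_meet (sub E) A m n z" and m: "ent \<theta> a (delta P m)" and n: "ent \<theta> a (delta P n)"
  shows "ent \<theta> a (delta P z)"
proof -
  have fib: "m \<in> fibre (sub E) A" "n \<in> fibre (sub E) A" "z \<in> fibre (sub E) A"
    using z by (auto simp: is_meet_def le_def)
  have a: "a \<in> Hom E (ob \<theta>) A" using ent_fibre_hom[OF delta_fibre[OF fib(1)] m] .
  obtain f \<theta>' where f: "covers f \<theta>' \<theta>" "factors E m (a \<cdot> f)" using m ent_delta[OF fib(1) a] by blast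
  note af = covers_restrict[OF f(1) a]
  obtain g \<theta>'' where g: "covers g \<theta>'' \<theta>'" "factors E n (a \<cdot> f \<cdot> g)"
    using ent_comp[OF covers_ent[OF f(1)] n] ent_delta[OF fib(2) af] by blast
  have "factors E m (a \<cdot> f \<cdot> g)"
    using factors_comp[OF f(2) fibre_subD(2)[OF fib(1)] af covers_hom[OF g(1)]] .
  then have "ent \<theta>' (a \<cdot> f) (delta P z)"
    using factors_meet[OF z covers_restrict[OF g(1) af]] g ent_delta[OF fib(3) af] by blast
  then show ?thesis using covers_local[OF f(1)] a delta_fibre[OF fib(3)] by (simp add: fibre_def)
qed

lemma J_fibre: "\<phi> \<in> fibre P A \<Longrightarrow> J \<phi> \<in> fibre P A"
  unfolding J_def using delta_fibre pi_fibre by blast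

lemma J_unit: "\<phi> \<in> fibre P A \<Longrightarrow> le P A \<phi> (J \<phi>)"
  unfolding J_def using pi_adj[of \<phi> A "\<pi> \<phi>"] pi_fibre[of \<phi> A] factors_self[OF fibre_subD(2)] sub_le by blast

lemma J_intro: "ent \<theta> a \<phi> \<Longrightarrow> ent \<theta> a (J \<phi>)"
  using le_ent_mono[OF J_unit] ent_cod[of \<theta> a \<phi>] by (auto simp: fibre_def)

lemma pi_mono:
  assumes "le P A \<phi> \<psi>"
  shows "factors E (\<pi> \<psi>) (\<pi> \<phi>)"
proof -
  have "\<phi> \<in> fibre P A" "\<psi> \<in> fibre P A" using assms by (auto simp: le_def)
  then show ?thesis
    using le_trans[OF assms J_unit] pi_adj[of \<phi> A "\<pi> \<psi>"] pi_fibre sub_le by (auto simp: J_def)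
qed

lemma J_mono: "le P A \<phi> \<psi> \<Longrightarrow> ent \<theta> a (J \<phi>) \<Longrightarrow> ent \<theta> a (J \<psi>)"
  unfolding J_def using delta_mono pi_mono pi_fibre unfolding le_def by blast

lemma factors_pi_reindex:
  assumes f: "f \<in> Hom E A B" and x: "\<phi> \<in> fibre P B" and a: "a \<in> Hom E X A"
  shows "factors E (\<pi> (reindex P f \<phi>)) a \<longleftrightarrow> factors E (\<pi> \<phi>) (f \<cdot> a)"
proof -
  have s: "reindex (sub E) f (\<pi> \<phi>) \<in> fibre (sub E) A" using reindex_sub[OF f pi_fibre[OF x]] .
  have p: "\<pi> (reindex P f \<phi>) \<in> fibre (sub E) A" using pi_fibre[OF reindex_fibre[OF f x]] .
  have "factors E (\<pi> (reindex P f \<phi>)) a \<longleftrightarrow> factors E (reindex (sub E) f (\<pi> \<phi>)) a"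
    using pi_reindex_iso[OF f x] factors_trans[OF _ _ fibre_subD(2)[OF p] fibre_subD(2)[OF s] a]
      factors_trans[OF _ _ fibre_subD(2)[OF s] fibre_subD(2)[OF p] a] by (auto simp: fib_iso_def sub_le)
  then show ?thesis using factors_reindex_sub[OF f pi_fibre[OF x] a] by blast
qed

text \<open>Stability of \<open>J\<close> under substitution is that of \<open>\<pi>\<close>, read
  element by element on each cover of the stage.\<close>

lemma J_reindex:
  assumes f: "f \<in> Hom E A B" and x: "\<phi> \<in> fibre P B" and a: "a \<in> Hom E (ob \<theta>) A"
  shows "ent \<theta> a (J (reindex P f \<phi>)) \<longleftrightarrow> ent \<theta> (f \<cdot> a) (J \<phi>)"
proof -
  have "factors E (\<pi> (reindex P f \<phi>)) (a \<cdot> g) \<longleftrightarrow> factors E (\<pi> \<phi>) (f \<cdot> a \<cdot> g)" if g: "covers g \<theta>' \<theta>" for g \<theta>'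
    using factors_pi_reindex[OF f x covers_restrict[OF g a]] assoc[OF f a covers_hom[OF g]] by simp
  then show ?thesis
    unfolding J_def ent_delta[OF pi_fibre[OF reindex_fibre[OF f x]] a] ent_delta[OF pi_fibre[OF x] comp_hom[OF f a]]
    by blast
qed

lemma closed_reindex:
  assumes f: "f \<in> Hom E A B" and x: "\<phi> \<in> fibre P B" and c: "closed \<phi>"
  shows "closed (reindex P f \<phi>)"
  unfolding closed_def
proof (intro conjI allI impI)
  note r = reindex_fibre[OF f x]
  show "reindex P f \<phi> \<in> Pred" using r by (simp add: fibre_def)
  fix \<theta> a assume e: "ent \<theta> a (J (reindex P f \<phi>))"
  have a: "a \<in> Hom E (ob \<theta>) A" using ent_fibre_hom[OF J_fibre[OF r] e] .
  show "ent \<theta> a (reindex P f \<phi>)"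
    using J_reindex[OF f x a] e c ent_reindex[OF f x a] by (auto simp: closed_def)
qed

text \<open>The elimination rule for the modality \<open>J\<close>: for a closed goal,
  \<open>J \<psi>\<close> is as good as \<open>\<psi>\<close>. A stage is itself a predicate, so it
  can be conjoined with \<open>\<psi>\<close> and carried along under \<open>J\<close>.\<close>

lemma J_elim:
  assumes e: "ent \<theta> a (J \<psi>)" and psi: "\<psi> \<in> fibre P A" and c: "closed \<chi>" and b: "b \<in> Hom E (ob \<theta>) (ob \<chi>)"
    and step: "\<And>f \<theta>'. ent \<theta>' f \<theta> \<Longrightarrow> ent \<theta>' (a \<cdot> f) \<psi> \<Longrightarrow> ent \<theta>' (b \<cdot> f) \<chi>"
  shows "ent \<theta> b \<chi>"
proof -
  let ?G = "ob \<theta>" and ?I = "idt E (ob \<theta>)"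
  have t: "\<theta> \<in> Pred" using ent_dom[OF e] .
  have tf: "\<theta> \<in> fibre P ?G" using t by (simp add: fibre_def)
  have I: "?I \<in> Hom E ?G ?G" using id_hom[OF proj_ob[OF t]] .
  have a: "a \<in> Hom E ?G A" using ent_fibre_hom[OF J_fibre[OF psi] e] .
  have x: "\<chi> \<in> fibre P (ob \<chi>)" using c by (simp add: closed_def fibre_def)
  note af = reindex_fibre[OF a psi] and bf = reindex_fibre[OF b x]
  \<comment> \<open>The generic later stage at which \<open>\<psi>\<close> holds of
    \<open>a\<close>; there the goal follows by \<open>step\<close>.\<close>
  let ?m = "meet P ?G \<theta> (reindex P a \<psi>)"
  note m = meet_exists[OF tf af] and mf = meet_fibre[OF tf af]
  have om: "ob ?m = ?G" using mf by (simp add: fibre_def)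
  have 1: "ent ?m ?I \<theta>" "ent ?m ?I (reindex P a \<psi>)" using m by (auto simp: is_meet_def le_ent)
  have "ent ?m (a \<cdot> ?I) \<psi>" using 1(2) ent_reindex[OF a psi] I om by simp
  then have "ent ?m (b \<cdot> ?I) \<chi>" using step[OF 1(1)] by blast
  then have l: "le P ?G ?m (reindex P b \<chi>)" using ent_id_iff[OF mf b x] comp_id[OF b] by simp
  have "ent \<theta> ?I (J \<theta>)" using J_intro[OF ent_refl[OF t]] .
  moreover have "ent \<theta> ?I (J (reindex P a \<psi>))" using J_reindex[OF a psi I] e comp_id[OF a] by simp
  \<comment> \<open>Preservation of binary meets by \<open>\<pi>\<close> enters here:
    \<open>J \<theta>\<close> and \<open>J \<psi>\<close> combine to \<open>J\<close> of their
    meet.\<close>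
  ultimately have "ent \<theta> ?I (J ?m)" unfolding J_def using delta_meet[OF pi_meet[OF m]] by blast
  then have "ent \<theta> (b \<cdot> ?I) (J \<chi>)" using J_mono[OF l] J_reindex[OF b x I] by blast
  then show ?thesis using c comp_id[OF b] by (simp add: closed_def)
qed

lemma pi_delta_le:
  assumes "m \<in> fibre (sub E) A"
  shows "factors E m (\<pi> (delta P m))"
  using pi_adj[OF delta_fibre[OF assms] assms] le_refl[OF delta_fibre[OF assms]] sub_le by blast

lemma closed_delta:
  assumes m: "m \<in> fibre (sub E) A" shows "closed (delta P m)"
  unfolding closed_def J_def
  using delta_mono[OF pi_fibre[OF delta_fibre[OF m]] m pi_delta_le[OF m]] delta_fibre[OF m] by (auto simp: fibre_def)

lemma closed_J: "\<phi> \<in> fibre P A \<Longrightarrow> closed (J \<phi>)"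
  using closed_delta[OF pi_fibre] by (simp add: J_def)

lemma diag_fibre: "I \<in> Obj E \<Longrightarrow> diag I \<in> fibre (sub E) (prd E I I)"
  using fibre_subI[OF diag_mono diag_hom] .

text \<open>Equality on a constant object is \<open>\<delta>\<close> of the diagonal, so equations
  between elements of constant objects may be proved with \<open>J_elim\<close>.\<close>

lemma closed_equality:
  assumes "I \<in> Obj E" shows "closed (equality P I)"
proof -
  have "equality P I = delta P (diag I)"
    using Hom_src[OF diag_hom[OF assms]] by (simp add: equality_def delta_def)
  then show ?thesis using closed_delta[OF diag_fibre[OF assms]] by simp
qed

text \<open>If \<open>\<phi>\<close> holds of \<open>x\<close> outright, its reindexing along
  \<open>x\<close> is a top element, and \<open>\<pi>\<close> preserves both reindexing and top.
  This converts truth at a global stage into a factorization in the base.\<close>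

lemma factors_if_reindex_top:
  assumes x: "x \<in> Hom E Z A" and phi: "\<phi> \<in> fibre P A" and e: "ent (top_of P Z) x \<phi>"
  shows "factors E (\<pi> \<phi>) x"
proof -
  have Z: "Z \<in> Obj E" using Hom_Obj(1)[OF x] .
  note r = reindex_fibre[OF x phi]
  have "le P Z (top_of P Z) (reindex P x \<phi>)" using ent_id_iff[OF top_fibre[OF Z] x phi] e by blast
  then have "is_top P Z (reindex P x \<phi>)"
    unfolding is_top_def using top_exists[OF Z] le_trans r by (auto simp: is_top_def)
  then have "factors E (\<pi> (reindex P x \<phi>)) (idt E Z)" using factors_top[OF pi_top id_hom[OF Z]] by blast
  then show ?thesis using factors_pi_reindex[OF x phi id_hom[OF Z]] comp_id[OF x] by simp
qed

lemma factors_iff_ent_delta: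
  assumes m: "m \<in> fibre (sub E) A" and x: "x \<in> Hom E Z A"
  shows "factors E m x \<longleftrightarrow> ent (top_of P Z) x (delta P m)"
proof
  have Z: "Z \<in> Obj E" using Hom_Obj(1)[OF x] .
  have "top_of P Z \<in> Pred" "ob (top_of P Z) = Z" using top_fibre[OF Z] by (auto simp: fibre_def)
  then show "ent (top_of P Z) x (delta P m)" if "factors E m x" using ent_deltaI[OF m] that x by simp
  assume "ent (top_of P Z) x (delta P m)"
  then show "factors E m x"
    using factors_trans[OF pi_delta_le[OF m] factors_if_reindex_top[OF x delta_fibre[OF m]]]
      fibre_subD(2)[OF m] fibre_subD(2)[OF pi_fibre[OF delta_fibre[OF m]]] x by blast
qed

text \<open>With \<open>pi_delta_le\<close> it gives \<open>\<pi> (\<delta> m) \<cong> m\<close>,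
  the fibrewise invertible counit.\<close>

lemma le_pi_delta:
  assumes m: "m \<in> fibre (sub E) A" shows "factors E (\<pi> (delta P m)) m"
  using factors_if_reindex_top[OF fibre_subD(2)[OF m] delta_fibre[OF m]]
    factors_iff_ent_delta[OF m fibre_subD(2)[OF m]] factors_self[OF fibre_subD(2)[OF m]] by blast

text \<open>At a global stage local equality is genuine equality, since factoring through the
  diagonal is detected there.\<close>

lemma eqv_const_discrete:
  assumes x: "x \<in> Hom E Z I" and y: "y \<in> Hom E Z I" and e: "eqv (const_obj P I) (top_of P Z) x y"
  shows "x = y"
proof -
  have I: "I \<in> Obj E" using Hom_Obj(2)[OF x] .
  have "equality P I = delta P (diag I)"
    using Hom_src[OF diag_hom[OF I]] by (simp add: equality_def delta_def)
  then have "ent (top_of P Z) (tuple E x y) (delta P (diag I))"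
    using e by (simp add: eqv_def rl_def const_obj_def)
  then have "factors E (diag I) (tuple E x y)"
    using factors_iff_ent_delta[OF diag_fibre[OF I] tuple_hom[OF x y]] by blast
  then obtain z where z: "z \<in> Hom E Z I" and "diag I \<cdot> z = tuple E x y"
    using factorsE[OF _ diag_hom[OF I] tuple_hom[OF x y]] by blast
  then have "tuple E z z = tuple E x y" using diag_comp by simp
  then show ?thesis using tuple_inj[OF _ z z x y] by blast
qed

section \<open>Closed predicates are stable under double negation\<close>

text \<open>The domain of the least subobject is an initial object, and all predicates over it are
  reindexings of the generic predicate along the same arrow.\<close>

lemma bot_sub_eq:
  assumes b: "is_bot (sub E) A b" and u: "u \<in> Hom E (src E b) X" and v: "v \<in> Hom E (src E b) X"
  shows "u = v"
proof -
  have bf: "b \<in> fibre (sub E) A" using b by (simp add: is_bot_def)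
  note bh = fibre_subD(2)[OF bf]
  let ?Z = "src E b"
  have X: "X \<in> Obj E" and Z: "?Z \<in> Obj E" using Hom_Obj[OF u] by auto
  \<comment> \<open>The equalizer of \<open>u\<close> and \<open>v\<close>, obtained from the
    diagonal. Composed with \<open>b\<close> it is a subobject of \<open>A\<close> below the least
    one, hence all of it.\<close>
  obtain p q where pb: "is_pullback E (tuple E u v) (diag X) p q"
    using pullback_exists[OF tuple_hom[OF u v] diag_hom[OF X]] .
  note h = pullback_Hom[OF pb tuple_hom[OF u v] diag_hom[OF X]]
  have pm: "mono_arr E p" using pullback_mono[OF pb tuple_hom[OF u v] diag_hom[OF X] diag_mono[OF X]] .
  have uv: "u \<cdot> p = v \<cdot> p"
    using h(3) tuple_comp[OF u v h(1)] diag_comp[OF h(2)] tuple_inj[OF _ comp_hom[OF u h(1)] comp_hom[OF v h(1)] h(2) h(2)]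
    by simp
  have bp: "b \<cdot> p \<in> Hom E (src E p) A" using comp_hom[OF bh h(1)] .
  have "mono_arr E (b \<cdot> p)"
    unfolding mono_arr_def Hom_src[OF bp]
  proof (intro conjI ballI impI)
    show "b \<cdot> p \<in> Arr E" using Hom_Arr[OF bp] .
    fix Y f g assume f: "f \<in> Hom E Y (src E p)" and g: "g \<in> Hom E Y (src E p)" and e: "b \<cdot> p \<cdot> f = b \<cdot> p \<cdot> g"
    have "b \<cdot> (p \<cdot> f) = b \<cdot> (p \<cdot> g)" using e assoc[OF bh h(1) f] assoc[OF bh h(1) g] by simp
    then have "p \<cdot> f = p \<cdot> g"
      using mono_arrD[OF fibre_subD(1)[OF bf] bh comp_hom[OF h(1) f] comp_hom[OF h(1) g]] by blast
    then show "f = g" using mono_arrD[OF pm h(1) f g] by blast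
  qed
  then have "b \<cdot> p \<in> fibre (sub E) A" using bp by (rule fibre_subI)
  then have "factors E (b \<cdot> p) b" using b by (auto simp: is_bot_def sub_le)
  then obtain k where k: "k \<in> Hom E ?Z (src E p)" "b \<cdot> p \<cdot> k = b" using factorsE[OF _ bp bh] by blast
  have "b \<cdot> (p \<cdot> k) = b \<cdot> idt E ?Z" using k assoc[OF bh h(1) k(1)] comp_id[OF bh] by simp
  then have pk: "p \<cdot> k = idt E ?Z"
    using mono_arrD[OF fibre_subD(1)[OF bf] bh comp_hom[OF h(1) k(1)] id_hom[OF Z]] by blast
  have "u = u \<cdot> p \<cdot> k" using assoc[OF u h(1) k(1)] pk comp_id[OF u] by simp
  also have "\<dots> = v" using uv assoc[OF v h(1) k(1)] pk comp_id[OF v] by simp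
  finally show ?thesis .
qed

lemma delta_bot:
  assumes b: "is_bot (sub E) A b" and e: "ent \<theta> a (delta P b)"
  shows "falsum \<theta>"
proof -
  have bf: "b \<in> fibre (sub E) A" using b by (simp add: is_bot_def)
  note bh = fibre_subD(2)[OF bf]
  let ?Z = "src E b"
  have Z: "?Z \<in> Obj E" using Hom_Obj[OF bh] by simp
  have a: "a \<in> Hom E (ob \<theta>) A" using ent_fibre_hom[OF delta_fibre[OF bf] e] .
  obtain f \<theta>' where f: "covers f \<theta>' \<theta>" and fa: "factors E b (a \<cdot> f)" using e ent_delta[OF bf a] by blast
  obtain x where x: "x \<in> Hom E (ob \<theta>') ?Z" using factorsE[OF fa bh covers_restrict[OF f a]] .
  obtain Prp tr where tr: "tr \<in> fibre P Prp"
    and gen: "\<And>A \<phi>. A \<in> Obj E \<Longrightarrow> \<phi> \<in> fibre P A \<Longrightarrow> \<exists>f\<in>Hom E A Prp. fib_iso P A \<phi> (reindex P f tr)"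
    using trip unfolding tripos_def has_generic_predicate_def by blast
  obtain u where u: "u \<in> Hom E ?Z Prp" "fib_iso P ?Z (top_of P ?Z) (reindex P u tr)" using gen[OF Z top_fibre[OF Z]] by blast
  obtain v where v: "v \<in> Hom E ?Z Prp" "fib_iso P ?Z (bot_of P ?Z) (reindex P v tr)" using gen[OF Z bot_fibre[OF Z]] by blast
  have "u = v" using bot_sub_eq[OF b u(1) v(1)] .
  then have l: "le P ?Z (top_of P ?Z) (bot_of P ?Z)" using u(2) v(2) le_trans by (auto simp: fib_iso_def)
  have "ent \<theta>' x (top_of P ?Z)" using ent_top[OF top_exists[OF Z] ent_dom[OF covers_ent[OF f]] x] .
  then have "falsum \<theta>'" using le_ent_mono[OF l] ent_bot_iff[OF Z x] by blast
  then show ?thesis using falsum_local[OF f] by blast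
qed

text \<open>Trivially \<open>\<bottom> \<le> \<delta> b\<close> for the least subobject
  \<open>b\<close>, so \<open>\<pi> \<bottom> \<le> b\<close> by adjunction, and
  \<open>\<delta> b\<close> is inconsistent by \<open>delta_bot\<close>.\<close>

lemma closed_bot:
  assumes A: "A \<in> Obj E" shows "closed (bot_of P A)"
  unfolding closed_def
proof (intro conjI allI impI)
  note bf = bot_fibre[OF A]
  show "bot_of P A \<in> Pred" using bf by (simp add: fibre_def)
  fix \<theta> a assume e: "ent \<theta> a (J (bot_of P A))"
  \<comment> \<open>A least subobject is taken from a complement of the identity.\<close>
  obtain b where b: "is_bot (sub E) A b" using boolean[OF id_fibre_sub[OF A]] by blast
  then have bb: "b \<in> fibre (sub E) A" by (simp add: is_bot_def)
  have "le P A (bot_of P A) (delta P b)" using bot_exists[OF A] delta_fibre[OF bb] by (auto simp: is_bot_def)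
  then have "factors E b (\<pi> (bot_of P A))" using pi_adj[OF bf bb] sub_le by blast
  then have "ent \<theta> a (delta P b)" using delta_mono[OF pi_fibre[OF bf] bb] e by (simp add: J_def)
  then have "falsum \<theta>" using delta_bot[OF b] by blast
  then show "ent \<theta> a (bot_of P A)" using ent_bot_iff[OF A ent_fibre_hom[OF J_fibre[OF bf] e]] by blast
qed

text \<open>With \<open>\<psi>\<close> pulled back to the context of \<open>\<theta>\<close>, the subobject \<open>\<pi> (\<theta> \<Rightarrow> \<psi>)\<close> contains both \<open>\<pi> \<psi>\<close> and
  its complement, hence is everything, so that \<open>J (\<theta> \<Rightarrow> \<psi>)\<close> holds.\<close>

lemma closed_stable:
  assumes c: "closed \<psi>" and a: "a \<in> Hom E (ob \<theta>) (ob \<psi>)" and t: "\<theta> \<in> Pred"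
    and nn: "\<And>f \<theta>'. ent \<theta>' f \<theta> \<Longrightarrow> (\<And>g \<theta>''. ent \<theta>'' g \<theta>' \<Longrightarrow> ent \<theta>'' (a \<cdot> f \<cdot> g) \<psi> \<Longrightarrow> falsum \<theta>'') \<Longrightarrow> falsum \<theta>'"
  shows "ent \<theta> a \<psi>"
proof -
  let ?G = "ob \<theta>" and ?I = "idt E (ob \<theta>)"
  have tf: "\<theta> \<in> fibre P ?G" using t by (simp add: fibre_def)
  have I: "?I \<in> Hom E ?G ?G" using id_hom[OF proj_ob[OF t]] .
  have pf: "\<psi> \<in> fibre P (ob \<psi>)" using c by (simp add: closed_def fibre_def)
  let ?p = "reindex P a \<psi>"
  note rf = reindex_fibre[OF a pf]
  have op: "ob ?p = ?G" using rf by (simp add: fibre_def)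
  let ?k = "imp P ?G \<theta> ?p"
  note kf = imp_fibre[OF tf rf] and ek = ent_imp[OF tf rf]
  have sf: "\<pi> ?p \<in> fibre (sub E) ?G" and ef: "\<pi> ?k \<in> fibre (sub E) ?G" using pi_fibre rf kf by blast+
  \<comment> \<open>Booleanness of the base: \<open>s'\<close> is the complement of
    \<open>\<pi> ?p\<close>.\<close>
  obtain s' b u where b: "is_bot (sub E) ?G b" and mt: "is_meet (sub E) ?G (\<pi> ?p) s' b"
    and u: "is_top (sub E) ?G u" and jn: "is_join (sub E) ?G (\<pi> ?p) s' u"
    using boolean[OF sf] by blast
  have s'f: "s' \<in> fibre (sub E) ?G" and uf: "u \<in> fibre (sub E) ?G"
    using mt jn by (auto simp: is_meet_def is_join_def le_def)
  have "le P ?G ?p ?k"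
    unfolding le_ent_ball[OF rf kf] using ek ent_dom ent_comp by blast
  then have 1: "factors E (\<pi> ?k) (\<pi> ?p)" by (rule pi_mono)
  \<comment> \<open>On the complement, \<open>\<psi>\<close> together with \<open>s'\<close> would
    put the element into the least subobject. So \<open>\<psi>\<close> is refuted there, and by
    \<open>nn\<close> any such stage at which \<open>\<theta>\<close> holds is inconsistent; the
    implication holds vacuously.\<close>
  have "ent \<theta>1 g ?k" if e: "ent \<theta>1 g (delta P s')" for \<theta>1 g
  proof -
    have g: "g \<in> Hom E (ob \<theta>1) ?G" using ent_fibre_hom[OF delta_fibre[OF s'f] e] .
    show ?thesis
      unfolding ek[OF ent_dom[OF e] g]
    proof (intro allI impI)
      fix f \<theta>2 assume f: "ent \<theta>2 f \<theta>1" and gf: "ent \<theta>2 (g \<cdot> f) \<theta>"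
      have ggf: "g \<cdot> f \<in> Hom E (ob \<theta>2) ?G" using ent_restrict[OF f g] .
      have "falsum \<theta>2"
      proof (rule nn[OF gf])
        fix h \<theta>3 assume h: "ent \<theta>3 h \<theta>2" and x: "ent \<theta>3 (a \<cdot> (g \<cdot> f) \<cdot> h) \<psi>"
        have "ent \<theta>3 (g \<cdot> f \<cdot> h) ?p"
          using ent_reindex[OF a pf ent_restrict[OF h ggf]] x assoc[OF a ggf ent_hom[OF h]] by simp
        then have "ent \<theta>3 (g \<cdot> f \<cdot> h) (delta P (\<pi> ?p))" using J_intro by (simp add: J_def)
        moreover have "ent \<theta>3 (g \<cdot> f \<cdot> h) (delta P s')" using ent_comp[OF h ent_comp[OF f e]] .
        ultimately show "falsum \<theta>3" using delta_bot[OF b delta_meet[OF mt]] by blast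
      qed
      then show "ent \<theta>2 (g \<cdot> f) ?p" using falsumE[of \<theta>2 "g \<cdot> f" ?p] ggf rf by (simp add: fibre_def)
    qed
  qed
  then have "le P ?G (delta P s') ?k" unfolding le_ent_ball[OF delta_fibre[OF s'f] kf] by blast
  then have "factors E (\<pi> ?k) (\<pi> (delta P s'))" by (rule pi_mono)
  \<comment> \<open>Invertibility of the counit returns from \<open>\<pi> (\<delta> s')\<close> to
    the subobject \<open>s'\<close> itself.\<close>
  then have 2: "factors E (\<pi> ?k) s'"
    using factors_trans[OF _ le_pi_delta[OF s'f] fibre_subD(2)[OF ef] fibre_subD(2)[OF pi_fibre[OF delta_fibre[OF s'f]]] fibre_subD(2)[OF s'f]]
    by blast
  have "le (sub E) ?G u (\<pi> ?k)" using jn 1 2 ef sf s'f by (auto simp: is_join_def sub_le)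
  then have "factors E (\<pi> ?k) ?I"
    using factors_trans[OF _ factors_top[OF u I] fibre_subD(2)[OF ef] fibre_subD(2)[OF uf] I] sub_le by blast
  then have jk: "ent \<theta> ?I (J ?k)" unfolding J_def using ent_deltaI[OF ef t I] by blast
  have "ent \<theta> ?I ?p"
  proof (rule J_elim[OF jk kf closed_reindex[OF a pf c]])
    show "?I \<in> Hom E ?G (ob ?p)" using I op by simp
    fix f \<theta>' assume f: "ent \<theta>' f \<theta>" and k: "ent \<theta>' (?I \<cdot> f) ?k"
    have fh: "f \<in> Hom E (ob \<theta>') ?G" using ent_hom[OF f] .
    have "ent \<theta>' f ?k" using k id_comp[OF fh] by simp
    then show "ent \<theta>' (?I \<cdot> f) ?p"
      using ek[OF ent_dom[OF f] fh] ent_refl[OF ent_dom[OF f]] f comp_id[OF fh] id_comp[OF fh] by metis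
  qed
  then show ?thesis using ent_reindex[OF a pf I] comp_id[OF a] by simp
qed

end

section \<open>Power objects\<close>

lemma ex1_unique: "\<exists>!x. Q x \<Longrightarrow> Q x \<Longrightarrow> Q y \<Longrightarrow> x = y"
  by blast

text \<open>The arrow \<open>r\<close> is the transpose of the characteristic map of
  \<open>R\<close> and sends \<open>b\<close> to the set of \<open>w\<close> with
  \<open>(b, w)\<close> in \<open>R\<close>. Just two facts about the power object are kept: equal
  sets have equal members, and sets with the same members at all later stages are equal.\<close>

lemma (in lex_category) power_object:
  assumes "has_exponentials C" "has_subobject_classifier C"
    and R: "R \<in> fibre (sub C) (prd C B B)" and B: "B \<in> Obj C"
  shows "\<exists>X. \<exists>r\<in>Hom C B X.
    (\<forall>\<Gamma>. \<forall>u\<in>Hom C \<Gamma> B. \<forall>v\<in>Hom C \<Gamma> B. \<forall>w\<in>Hom C \<Gamma> B. cmp C r u = cmp C r v \<longrightarrow>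
      factors C R (tuple C u w) \<longrightarrow> factors C R (tuple C v w)) \<and>
    (\<forall>\<Gamma>. \<forall>u\<in>Hom C \<Gamma> B. \<forall>v\<in>Hom C \<Gamma> B.
      (\<forall>\<Gamma>'. \<forall>g\<in>Hom C \<Gamma>' \<Gamma>. \<forall>w\<in>Hom C \<Gamma>' B.
        factors C R (tuple C (cmp C u g) w) \<longleftrightarrow> factors C R (tuple C (cmp C v g) w)) \<longrightarrow> cmp C r u = cmp C r v)"
proof -
  obtain T \<Omega> t where T: "is_terminal C T" and t: "t \<in> Hom C T \<Omega>"
    and cl: "\<And>m. mono_arr C m \<Longrightarrow>
      \<exists>!\<chi>. \<chi> \<in> Hom C (tgt C m) \<Omega> \<and> (\<exists>u\<in>Hom C (src C m) T. is_pullback C \<chi> t m u)"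
    using assms(2) unfolding has_subobject_classifier_def by blast
  have T1: "f = g" if "f \<in> Hom C X T" "g \<in> Hom C X T" for f g X
    using T that Hom_Obj(1)[OF that(1)] unfolding is_terminal_def by blast
  have tm: "mono_arr C t"
    unfolding mono_arr_def Hom_src[OF t] using Hom_Arr[OF t] T1 by blast
  \<comment> \<open>Maps into \<open>\<Omega>\<close> that are true of the same elements classify
    the same subobject \<open>p\<close>, so uniqueness of characteristic maps applies.\<close>
  have char_eq: "y1 = y2"
    if y1: "y1 \<in> Hom C W \<Omega>" and y2: "y2 \<in> Hom C W \<Omega>"
      and eq: "\<And>Z x. x \<in> Hom C Z W \<Longrightarrow> factors C t (cmp C y1 x) \<longleftrightarrow> factors C t (cmp C y2 x)" for y1 y2 W
  proof -
    obtain p q where pb: "is_pullback C y1 t p q" using pullback_exists[OF y1 t] .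
    note h = pullback_Hom[OF pb y1 t]
    have pm: "mono_arr C p" using pullback_mono[OF pb y1 t tm] .
    have "factors C t (cmp C y2 p)" using eq[OF h(1)] h(3) factorsI[OF t h(2)] by simp
    then obtain q' where q': "q' \<in> Hom C (src C p) T" "cmp C t q' = cmp C y2 p"
      using factorsE[OF _ t comp_hom[OF y2 h(1)]] by blast
    have "is_pullback C y2 t p q'"
      unfolding is_pullback_def
    proof (intro conjI ballI impI)
      show "{y2, t, p, q'} \<subseteq> Arr C" using Hom_Arr[OF y2] Hom_Arr[OF t] Hom_Arr[OF h(1)] Hom_Arr[OF q'(1)] by simp
      show "tgt C y2 = tgt C t" "src C p = src C q'" "tgt C p = src C y2" "tgt C q' = src C t" "cmp C y2 p = cmp C t q'"
        using Hom_tgt[OF y2] Hom_tgt[OF t] Hom_src[OF q'(1)] Hom_tgt[OF h(1)] Hom_src[OF y2] Hom_tgt[OF q'(1)]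
          Hom_src[OF t] q'(2) by simp_all
      fix Z a b assume a: "a \<in> Hom C Z (src C y2)" and b: "b \<in> Hom C Z (src C t)" and e: "cmp C y2 a = cmp C t b"
      note a = a[unfolded Hom_src[OF y2]] and b = b[unfolded Hom_src[OF t]]
      have "factors C t (cmp C y1 a)" using eq[OF a] e factorsI[OF t b] by simp
      then have "factors C p a" using pullback_factors[OF pb y1 t a] by blast
      then obtain k where k: "k \<in> Hom C Z (src C p)" "cmp C p k = a" using factorsE[OF _ h(1) a] by blast
      show "\<exists>!k. k \<in> Hom C Z (src C p) \<and> cmp C p k = a \<and> cmp C q' k = b"
      proof (rule ex1I[of _ k])
        show "k \<in> Hom C Z (src C p) \<and> cmp C p k = a \<and> cmp C q' k = b"
          using k T1[OF comp_hom[OF q'(1) k(1)] b] by simp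
        fix y assume "y \<in> Hom C Z (src C p) \<and> cmp C p y = a \<and> cmp C q' y = b"
        then show "y = k" using mono_arrD[OF pm h(1) _ k(1)] k(2) by simp
      qed
    qed
    then have "y1 \<in> Hom C (tgt C p) \<Omega> \<and> (\<exists>u\<in>Hom C (src C p) T. is_pullback C y1 t p u)"
      "y2 \<in> Hom C (tgt C p) \<Omega> \<and> (\<exists>u\<in>Hom C (src C p) T. is_pullback C y2 t p u)"
      using y1 y2 pb h(2) q'(1) Hom_tgt[OF h(1)] by auto
    then show ?thesis using ex1_unique[OF cl[OF pm]] by blast
  qed
  note Rh = fibre_subD(2)[OF R]
  obtain \<chi> w where chi: "\<chi> \<in> Hom C (prd C B B) \<Omega>" and pbR: "is_pullback C \<chi> t R w"
    using cl[OF fibre_subD(1)[OF R]] unfolding Hom_tgt[OF Rh] by blast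
  have fR: "factors C R x \<longleftrightarrow> factors C t (cmp C \<chi> x)" if "x \<in> Hom C Z (prd C B B)" for x Z
    using pullback_factors[OF pbR chi t that] .
  have \<Omega>: "\<Omega> \<in> Obj C" using Hom_Obj[OF t] by blast
  obtain X ev where X: "X \<in> Obj C" and ev: "ev \<in> Hom C (prd C X B) \<Omega>"
    and ex1': "\<forall>Z\<in>Obj C. \<forall>f\<in>Hom C (prd C Z B) \<Omega>. 
      \<exists>!g. g \<in> Hom C Z X \<and> cmp C ev (tuple C (cmp C g (pr1 C Z B)) (pr2 C Z B)) = f"
    using bspec[OF bspec[OF assms(1)[unfolded has_exponentials_def] B] \<Omega>] by (elim bexE)
  note ex1 = ex1'[rule_format]
  obtain r where r: "r \<in> Hom C B X" and rr: "cmp C ev (tuple C (cmp C r (pr1 C B B)) (pr2 C B B)) = \<chi>"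
    using ex1[OF B chi] by blast
  have evr: "cmp C ev (tuple C (cmp C r u) w) = cmp C \<chi> (tuple C u w)"
    if u: "u \<in> Hom C Z B" and w: "w \<in> Hom C Z B" for u w Z
  proof -
    note p1 = pr1_hom[OF B B] and p2 = pr2_hom[OF B B] and uw = tuple_hom[OF u w]
    have "cmp C \<chi> (tuple C u w) = cmp C ev (cmp C (tuple C (cmp C r (pr1 C B B)) (pr2 C B B)) (tuple C u w))"
      using assoc[OF ev tuple_hom[OF comp_hom[OF r p1] p2] uw] rr by simp
    also have "cmp C (tuple C (cmp C r (pr1 C B B)) (pr2 C B B)) (tuple C u w) = tuple C (cmp C r u) w"
      using tuple_comp[OF comp_hom[OF r p1] p2 uw] assoc[OF r p1 uw] pr1_tuple[OF u w] pr2_tuple[OF u w] by simp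
    finally show ?thesis by simp
  qed
  show ?thesis
  proof (rule exI[of _ X], rule bexI[OF _ r], intro conjI allI ballI impI)
    fix \<Gamma> u v w assume u: "u \<in> Hom C \<Gamma> B" and v: "v \<in> Hom C \<Gamma> B" and w: "w \<in> Hom C \<Gamma> B"
      and e: "cmp C r u = cmp C r v" and f: "factors C R (tuple C u w)"
    show "factors C R (tuple C v w)"
      using f fR[OF tuple_hom[OF u w]] fR[OF tuple_hom[OF v w]] evr[OF u w] evr[OF v w] e by simp
  next
    fix \<Gamma> u v assume u: "u \<in> Hom C \<Gamma> B" and v: "v \<in> Hom C \<Gamma> B"
      and eq: "\<forall>\<Gamma>'. \<forall>g\<in>Hom C \<Gamma>' \<Gamma>. \<forall>w\<in>Hom C \<Gamma>' B.
        factors C R (tuple C (cmp C u g) w) \<longleftrightarrow> factors C R (tuple C (cmp C v g) w)"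
    have G: "\<Gamma> \<in> Obj C" using Hom_Obj[OF u] by blast
    note p1 = pr1_hom[OF G B] and p2 = pr2_hom[OF G B]
    let ?f = "\<lambda>u. cmp C \<chi> (tuple C (cmp C u (pr1 C \<Gamma> B)) (pr2 C \<Gamma> B))"
    have fh: "?f u \<in> Hom C (prd C \<Gamma> B) \<Omega>" if u: "u \<in> Hom C \<Gamma> B" for u
      using comp_hom[OF chi tuple_hom[OF comp_hom[OF u p1] p2]] .
    have evf: "cmp C ev (tuple C (cmp C (cmp C r u) (pr1 C \<Gamma> B)) (pr2 C \<Gamma> B)) = ?f u" if u: "u \<in> Hom C \<Gamma> B" for u
      using evr[OF comp_hom[OF u p1] p2] assoc[OF r u p1] by simp
    \<comment> \<open>The transposes are compared as maps into \<open>\<Omega>\<close>. An element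
      of their domain is a pair \<open>(g, w)\<close>, at which the hypothesis \<open>eq\<close> can
      be used.\<close>
    have "?f u = ?f v"
    proof (rule char_eq[OF fh[OF u] fh[OF v]])
      fix Z x assume x: "x \<in> Hom C Z (prd C \<Gamma> B)"
      obtain g w where g: "g \<in> Hom C Z \<Gamma>" and w: "w \<in> Hom C Z B"
        and px: "cmp C (pr1 C \<Gamma> B) x = g" "cmp C (pr2 C \<Gamma> B) x = w" using tuple_cases[OF x G B] by metis
      have "cmp C (?f u) x = cmp C \<chi> (tuple C (cmp C u g) w)" if u: "u \<in> Hom C \<Gamma> B" for u
        using assoc[OF chi tuple_hom[OF comp_hom[OF u p1] p2] x] tuple_comp[OF comp_hom[OF u p1] p2 x]
          assoc[OF u p1 x] px by simp
      then show "factors C t (cmp C (?f u) x) \<longleftrightarrow> factors C t (cmp C (?f v) x)"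
        using u v eq[rule_format, OF g w] fR[OF tuple_hom[OF comp_hom[OF u g] w]] fR[OF tuple_hom[OF comp_hom[OF v g] w]] by simp
    qed
    then show "cmp C r u = cmp C r v"
      using ex1[OF G fh[OF u]] evf[OF u] evf[OF v] comp_hom[OF r u] comp_hom[OF r v] by metis
  qed
qed

section \<open>Pullbacks of monomorphisms\<close>

context tripos_fib begin

text \<open>The inverse image of a subobject is carved out by the predicate
  \<open>\<exists>b. F(a, b) \<and> im m b\<close>. Beyond existence of the pullback, this
  description of its elements is what the closure operation needs.\<close>

lemma pullback_of_mono:
  assumes F: "F \<in> Hom T A B" and m: "m \<in> Hom T V B" and mono: "mono_arr T m"
  obtains p q where "is_pullback T F m p q" "p \<in> fibre (sub T) A"
    and "\<And>\<theta> c. ent \<theta> c (im p) \<longleftrightarrow> eqv A \<theta> c c \<and>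
      (\<exists>f \<theta>' b. covers f \<theta>' \<theta> \<and> ap F \<theta>' (c \<cdot> f) b \<and> ent \<theta>' b (im m))"
proof -
  note A = hom_per(1)[OF F] and B = hom_per(2)[OF F]
  note oA = per_Obj[OF A] and oB = per_Obj[OF B]
  note p1 = pr1_hom[OF oA oB] and p2 = pr2_hom[OF oA oB]
  let ?AB = "prd E (fst A) (fst B)"
  note rf = reindex_fibre[OF p2 im_fibre[OF m]]
  note mf = meet_fibre[OF pred_fibre[OF F] rf]
  let ?mm = "meet P ?AB (pred F) (reindex P (pr2 E (fst A) (fst B)) (im m))"
  let ?k = "ex P (pr1 E (fst A) (fst B)) ?mm"
  have kf: "?k \<in> fibre P (fst A)" using ex_fibre[OF p1 mf] .
  have ek: "ent \<theta> c ?k \<longleftrightarrow> c \<in> Hom E (ob \<theta>) (fst A) \<and>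
      (\<exists>f \<theta>' b. covers f \<theta>' \<theta> \<and> ap F \<theta>' (c \<cdot> f) b \<and> ent \<theta>' b (im m))" for \<theta> c
  proof (cases "c \<in> Hom E (ob \<theta>) (fst A)")
    case c: True
    have em: "ent \<theta>' (tuple E a b) ?mm \<longleftrightarrow> ap F \<theta>' a b \<and> ent \<theta>' b (im m)"
      if a: "a \<in> Hom E (ob \<theta>') (fst A)" and b: "b \<in> Hom E (ob \<theta>') (fst B)" for \<theta>' a b
      unfolding ent_meet[OF pred_fibre[OF F] rf] ap_rl[OF F] rl_def
      using a b ent_reindex[OF p2 im_fibre[OF m] tuple_hom[OF a b]] pr2_tuple[OF a b] by simp
    show ?thesis
      unfolding ent_ex[OF p1 mf c]
    proof
      assume "\<exists>f \<theta>' a. covers f \<theta>' \<theta> \<and> a \<in> Hom E (ob \<theta>') ?AB \<and> pr1 E (fst A) (fst B) \<cdot> a = c \<cdot> f \<and> ent \<theta>' a ?mm"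
      then obtain f \<theta>' a where f: "covers f \<theta>' \<theta>" and a: "a \<in> Hom E (ob \<theta>') ?AB"
        and e: "pr1 E (fst A) (fst B) \<cdot> a = c \<cdot> f" "ent \<theta>' a ?mm" by blast
      obtain b where b: "b \<in> Hom E (ob \<theta>') (fst B)" "a = tuple E (c \<cdot> f) b" using tuple_cases[OF a oA oB] e by metis
      then show "c \<in> Hom E (ob \<theta>) (fst A) \<and> (\<exists>f \<theta>' b. covers f \<theta>' \<theta> \<and> ap F \<theta>' (c \<cdot> f) b \<and> ent \<theta>' b (im m))"
        using f e em[OF covers_restrict[OF f c] b(1)] c by blast
    next
      assume "c \<in> Hom E (ob \<theta>) (fst A) \<and> (\<exists>f \<theta>' b. covers f \<theta>' \<theta> \<and> ap F \<theta>' (c \<cdot> f) b \<and> ent \<theta>' b (im m))"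
      then obtain f \<theta>' b where f: "covers f \<theta>' \<theta>" and e: "ap F \<theta>' (c \<cdot> f) b" "ent \<theta>' b (im m)" by blast
      note cf = ap_hom[OF F e(1)]
      show "\<exists>f \<theta>' a. covers f \<theta>' \<theta> \<and> a \<in> Hom E (ob \<theta>') ?AB \<and> pr1 E (fst A) (fst B) \<cdot> a = c \<cdot> f \<and> ent \<theta>' a ?mm"
        using f tuple_hom[OF cf] pr1_tuple[OF cf] em[OF cf] e by blast
    qed
  next
    case False
    then show ?thesis using ent_hom[of \<theta> c ?k] kf by (auto simp: fibre_def)
  qed
  have ep: "ext_pred A ?k"
    unfolding ext_pred_def
  proof (intro conjI allI impI kf)
    fix \<theta> a b assume e: "eqv A \<theta> a b" and "ent \<theta> a ?k"
    then obtain f \<theta>' d where f: "covers f \<theta>' \<theta>" and x: "ap F \<theta>' (a \<cdot> f) d" "ent \<theta>' d (im m)" unfolding ek by blast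
    have "ap F \<theta>' (b \<cdot> f) d" using ap_ext1[OF F x(1) eqv_restrict[OF covers_ent[OF f] e]] .
    then show "ent \<theta> b ?k" unfolding ek using f x(2) eqv_hom(2)[OF e] by blast
  qed
  let ?p = "incl A ?k"
  note ph = incl_hom[OF A ep] and pf = incl_fibre[OF A ep]
  note pm = fibre_subD(1)[OF pf]
  have ip: "ent \<theta> c (im ?p) \<longleftrightarrow> eqv A \<theta> c c \<and>
      (\<exists>f \<theta>' b. covers f \<theta>' \<theta> \<and> ap F \<theta>' (c \<cdot> f) b \<and> ent \<theta>' b (im m))" for \<theta> c
    unfolding ent_im_incl[OF A ep] ek using eqv_hom(1) by blast
  have Fp: "cmp T F ?p \<in> Hom T (restr A ?k) B" using T_comp_hom[OF ph F] .
  \<comment> \<open>The values of \<open>F\<close> on the carved-out part lie in the image of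
    \<open>m\<close>; the factorization is the second projection \<open>q\<close>.\<close>
  have "factors T m (cmp T F ?p)"
  proof (rule factors_if_im[OF Fp m mono])
    fix \<theta> b assume e: "ent \<theta> b (im (cmp T F ?p))"
    have b: "b \<in> Hom E (ob \<theta>) (fst B)" using e ent_im[OF Fp] by blast
    obtain f \<theta>' d where f: "covers f \<theta>' \<theta>" and x: "ap (cmp T F ?p) \<theta>' d (b \<cdot> f)"
      using e ent_im[OF Fp] by blast
    obtain g \<theta>'' a where g: "covers g \<theta>'' \<theta>'" and y: "ap ?p \<theta>'' (d \<cdot> g) a" "ap F \<theta>'' a (b \<cdot> f \<cdot> g)"
      using x unfolding ap_comp[OF ph F] by blast
    have "ent \<theta>'' a ?k" using y(1) eqv_sym[OF A] ep unfolding ap_incl[OF A ep] ext_pred_def by blast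
    then obtain h \<theta>3 b' where h: "covers h \<theta>3 \<theta>''" and z: "ap F \<theta>3 (a \<cdot> h) b'" "ent \<theta>3 b' (im m)" unfolding ek by blast
    have "eqv B \<theta>3 b' (b \<cdot> f \<cdot> g \<cdot> h)" using ap_single[OF F z(1) ap_restrict[OF covers_ent[OF h] y(2)]] .
    then have *: "ent \<theta>3 (b \<cdot> f \<cdot> g \<cdot> h) (im m)" using im_ext[OF m] z(2) unfolding ext_pred_def by blast
    note bf = covers_restrict[OF f b]
    note bfg = covers_restrict[OF g bf]
    show "ent \<theta> b (im m)"
      using ent_local_ext[OF im_ext[OF m] f ent_local_ext[OF im_ext[OF m] g ent_local_ext[OF im_ext[OF m] h * bfg] bf] b] .
  qed
  then obtain q where q: "q \<in> Hom T (restr A ?k) V" "cmp T m q = cmp T F ?p" using T.factorsE[OF _ m Fp] by blast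
  have "is_pullback T F m ?p q"
    unfolding is_pullback_def
  proof (intro conjI ballI impI)
    show "{F, m, ?p, q} \<subseteq> Arr T" using Hom_Arr[OF F] Hom_Arr[OF m] Hom_Arr[OF ph] Hom_Arr[OF q(1)] by simp
    show "tgt T F = tgt T m" "src T ?p = src T q" "tgt T ?p = src T F" "tgt T q = src T m" "cmp T F ?p = cmp T m q"
      using Hom_tgt[OF F] Hom_tgt[OF m] Hom_src[OF ph] Hom_src[OF q(1)] Hom_tgt[OF ph] Hom_src[OF F]
        Hom_tgt[OF q(1)] Hom_src[OF m] q(2) by simp_all
    fix Z a b assume a: "a \<in> Hom T Z (src T F)" and b: "b \<in> Hom T Z (src T m)" and e: "cmp T F a = cmp T m b"
    note a = a[unfolded Hom_src[OF F]] and b = b[unfolded Hom_src[OF m]]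
    \<comment> \<open>A competing square is tested on images alone. The mediating arrow commutes
      with \<open>q\<close> and is unique because \<open>m\<close> and \<open>?p\<close> are
      monic.\<close>
    have "factors T ?p a"
    proof (rule factors_if_im[OF a ph pm])
      fix \<theta> c assume x: "ent \<theta> c (im a)"
      have c: "c \<in> Hom E (ob \<theta>) (fst A)" and cc: "eqv A \<theta> c c" using x ent_im[OF a] im_eqv[OF a] by blast+
      obtain f \<theta>' z where f: "covers f \<theta>' \<theta>" and y: "ap a \<theta>' z (c \<cdot> f)" using x ent_im[OF a] by blast
      obtain g \<theta>'' d where g: "covers g \<theta>'' \<theta>'" and w: "ap F \<theta>'' (c \<cdot> f \<cdot> g) d" using ap_total[OF F ap_eqv(2)[OF a y]] by blast
      have "ap (cmp T m b) \<theta>'' (z \<cdot> g) d"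
        using ap_compI[OF a F ap_restrict[OF covers_ent[OF g] y] w] e by simp
      then obtain h \<theta>3 v where h: "covers h \<theta>3 \<theta>''" and v: "ap m \<theta>3 v (d \<cdot> h)" unfolding ap_comp[OF b m] by blast
      have "ent \<theta>'' d (im m)" using ent_local_ext[OF im_ext[OF m] h ent_imI[OF m v] ap_hom(2)[OF F w]] .
      moreover have "covers (f \<cdot> g) \<theta>'' \<theta>" using covers_trans[OF f g] .
      moreover have "c \<cdot> f \<cdot> g = c \<cdot> (f \<cdot> g)" using assoc[OF c covers_hom[OF f] covers_hom[OF g]] by simp
      ultimately show "ent \<theta> c (im ?p)" unfolding ip using cc w by metis
    qed
    then obtain h where h: "h \<in> Hom T Z (restr A ?k)" "cmp T ?p h = a" using T.factorsE[OF _ ph a] by blast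
    have "cmp T m (cmp T q h) = cmp T m b"
      using T.assoc[OF m q(1) h(1)] T.assoc[OF F ph h(1)] q(2) h(2) e by simp
    then have qh: "cmp T q h = b" using T.mono_arrD[OF mono m T_comp_hom[OF h(1) q(1)] b] by blast
    have u: "y = h" if "y \<in> Hom T Z (restr A ?k)" "cmp T ?p y = a" for y
      using T.mono_arrD[OF pm ph that(1) h(1)] that(2) h(2) by simp
    show "\<exists>!h. h \<in> Hom T Z (src T ?p) \<and> cmp T ?p h = a \<and> cmp T q h = b"
      unfolding Hom_src[OF ph] using h qh u by blast
  qed
  then show thesis using that[OF _ pf ip] by blast
qed

end

section \<open>The reflection onto constant objects\<close>

locale reflection_tripos = tc_tripos P \<pi> for P :: "('o, 'a, 'p, 'q) fib" and \<pi> +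
  fixes \<Pi> :: "('o \<times> 'p, ('o \<times> 'p) \<times> ('o \<times> 'p) \<times> 'p set, 'o, 'a) cfunctor"
    and \<eta> :: "'o \<times> 'p \<Rightarrow> ('o \<times> 'p) \<times> ('o \<times> 'p) \<times> 'p set"
  assumes expo: "has_exponentials (Base P)" and subcl: "has_subobject_classifier (Base P)"
    and adj: "adjunction (tripos_to_topos P) (Base P) \<Pi> (constant_objects P) \<eta>"
begin

abbreviation L :: "'o \<times> 'p \<Rightarrow> 'o" where "L \<equiv> FOb \<Pi>"
abbreviation \<Delta> :: "'o \<Rightarrow> 'o \<times> 'p" where "\<Delta> \<equiv> const_obj P"

lemma const_functor:
  "A \<in> Obj E \<Longrightarrow> const_arr P (idt E A) = idt T (\<Delta> A)"
  "f \<in> Hom E A B \<Longrightarrow> g \<in> Hom E B D \<Longrightarrow> const_arr P (g \<cdot> f) = cmp T (const_arr P g) (const_arr P f)"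
  using adj unfolding adjunction_def is_functor_def constant_objects_def by (auto simp: Hom_def)

lemma L_Obj: "is_per P X \<Longrightarrow> L X \<in> Obj E"
  using adj unfolding adjunction_def is_functor_def T_Obj[symmetric] by blast

lemma eta_hom: "is_per P X \<Longrightarrow> \<eta> X \<in> Hom T X (\<Delta> (L X))"
  using adj unfolding adjunction_def constant_objects_def T_Obj[symmetric] by auto

lemma Pi_hom: "F \<in> Hom T X Y \<Longrightarrow> FAr \<Pi> F \<in> Hom E (L X) (L Y)"
  using adj unfolding adjunction_def is_functor_def by (auto simp: Hom_def)

lemma eta_nat: "F \<in> Hom T X Y \<Longrightarrow> cmp T (const_arr P (FAr \<Pi> F)) (\<eta> X) = cmp T (\<eta> Y) F"
  using adj unfolding adjunction_def constant_objects_def by (auto simp: Hom_def)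

lemma eta_univ:
  assumes "G \<in> Hom T X (\<Delta> I)" "I \<in> Obj E"
  shows "\<exists>!g. g \<in> Hom E (L X) I \<and> cmp T (const_arr P g) (\<eta> X) = G"
proof -
  have "X \<in> Obj T" using hom_per(1)[OF assms(1)] T_Obj by blast
  then show ?thesis using adj assms unfolding adjunction_def constant_objects_def by simp
qed

text \<open>Equality in a constant object is equality of arrows on a cover, and there monicity of
  \<open>s\<close> applies directly.\<close>

lemma const_mono:
  assumes s: "s \<in> Hom E I K" and mono: "mono_arr E s"
  shows "mono_arr T (const_arr P s)"
  unfolding mono_T_iff[OF const_arr_hom[OF s]] ap_const_arr[OF s]
proof (intro allI impI)
  note IK = Hom_Obj[OF s]
  note K = const_per[OF IK(2)]
  fix \<theta> d d' c assume 1: "d \<in> Hom E (ob \<theta>) I \<and> eqv (\<Delta> K) \<theta> (s \<cdot> d) c" and 2: "d' \<in> Hom E (ob \<theta>) I \<and> eqv (\<Delta> K) \<theta> (s \<cdot> d') c"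
  then have "eqv (\<Delta> K) \<theta> (s \<cdot> d) (s \<cdot> d')" using eqv_sym[OF K] eqv_trans[OF K] by blast
  then obtain f \<theta>' where f: "covers f \<theta>' \<theta>" and e: "s \<cdot> d \<cdot> f = s \<cdot> d' \<cdot> f" using eqv_const[OF IK(2)] by blast
  have d: "d \<in> Hom E (ob \<theta>) I" "d' \<in> Hom E (ob \<theta>) I" using 1 2 by auto
  have "s \<cdot> (d \<cdot> f) = s \<cdot> (d' \<cdot> f)" using e assoc[OF s d(1) covers_hom[OF f]] assoc[OF s d(2) covers_hom[OF f]] by simp
  then have "d \<cdot> f = d' \<cdot> f" using mono_arrD[OF mono s covers_restrict[OF f d(1)] covers_restrict[OF f d(2)]] by blast
  then show "eqv (\<Delta> I) \<theta> d d'" using eqv_const[OF IK(1)] f d by blast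
qed

text \<open>The bridge between the two operators: the closure \<open>j\<close> is formed with arrows
  between constant objects, \<open>J\<close> with \<open>\<delta>\<close>.\<close>

lemma ent_im_const:
  assumes s: "s \<in> fibre (sub E) K"
  shows "ent \<theta> j (im (const_arr P s)) \<longleftrightarrow> ent \<theta> j (delta P s)"
proof -
  note sh = fibre_subD(2)[OF s]
  note IK = Hom_Obj[OF sh]
  note ch = const_arr_hom[OF sh]
  have df: "delta P s \<in> Pred" "ob (delta P s) = K" using delta_fibre[OF s] by (auto simp: fibre_def)
  show ?thesis
  proof
    assume e: "ent \<theta> j (im (const_arr P s))"
    then have j: "j \<in> Hom E (ob \<theta>) K" using ent_im[OF ch] by (simp add: fst_const_obj)
    obtain f \<theta>' i where f: "covers f \<theta>' \<theta>" and i: "i \<in> Hom E (ob \<theta>') (src E s)"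
      and x: "eqv (\<Delta> K) \<theta>' (s \<cdot> i) (j \<cdot> f)" using e unfolding ent_im[OF ch] ap_const_arr[OF sh] by blast
    obtain g \<theta>'' where g: "covers g \<theta>'' \<theta>'" and y: "s \<cdot> i \<cdot> g = j \<cdot> f \<cdot> g" using x eqv_const[OF IK(2)] by blast
    note jf = covers_restrict[OF f j]
    have "factors E s (j \<cdot> f \<cdot> g)"
      using factorsI[OF sh covers_restrict[OF g i]] assoc[OF sh i covers_hom[OF g]] y by simp
    then have "ent \<theta>' (j \<cdot> f) (delta P s)" using ent_delta[OF s jf] g by blast
    then show "ent \<theta> j (delta P s)" using covers_local[OF f] j df by simp
  next
    assume e: "ent \<theta> j (delta P s)"
    then have j: "j \<in> Hom E (ob \<theta>) K" using ent_hom df by metis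
    obtain f \<theta>' where f: "covers f \<theta>' \<theta>" and x: "factors E s (j \<cdot> f)" using e ent_delta[OF s j] by blast
    obtain i where i: "i \<in> Hom E (ob \<theta>') (src E s)" "s \<cdot> i = j \<cdot> f" using factorsE[OF x sh covers_restrict[OF f j]] .
    have "eqv (\<Delta> K) \<theta>' (s \<cdot> i) (j \<cdot> f)"
      using i eqv_const_refl[OF IK(2) ent_dom[OF covers_ent[OF f]] covers_restrict[OF f j]] by simp
    then show "ent \<theta> j (im (const_arr P s))" unfolding ent_im[OF ch] ap_const_arr[OF sh] fst_const_obj using i f j by blast
  qed
qed

text \<open>The kernel of the unit at \<open>(C, \<rho>)\<close> is contained in \<open>J \<rho>\<close>: the map \<open>C \<rightarrow> \<Omega>\<^sup>C\<close> classifying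
  \<open>\<pi> \<rho>\<close> is constant on \<open>\<rho>\<close>-classes and hence factors through the unit.\<close>

lemma eta_kernel:
  assumes X: "is_per P X" and 1: "ap (\<eta> X) \<theta> c i" and 2: "ap (\<eta> X) \<theta> c' i"
  shows "ent \<theta> (tuple E c c') (J (snd X))"
proof -
  let ?C = "fst X" and ?R = "\<pi> (snd X)"
  note C = per_Obj[OF X] and rf = per_fibre[OF X]
  have R: "?R \<in> fibre (sub E) (prd E ?C ?C)" using pi_fibre[OF rf] .
  note Jf = J_fibre[OF rf]
  note cJ = closed_J[OF rf]
  have oJ: "ob (J (snd X)) = prd E ?C ?C" using Jf by (simp add: fibre_def)
  have Jeqv: "ent \<theta> (tuple E a b) (J (snd X))" if "eqv X \<theta> a b" for \<theta> a b
    using J_intro that by (simp add: eqv_def rl_def)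
  \<comment> \<open>\<open>J \<rho>\<close> inherits symmetry, and next transitivity, from
    \<open>\<rho>\<close>: its hypotheses may be taken without \<open>J\<close> because
    \<open>J \<rho>\<close> is closed.\<close>
  have Jsym: "ent \<theta> (tuple E b a) (J (snd X))"
    if a: "a \<in> Hom E (ob \<theta>) ?C" and b: "b \<in> Hom E (ob \<theta>) ?C" and e: "ent \<theta> (tuple E a b) (J (snd X))" for \<theta> a b
  proof (rule J_elim[OF e rf cJ])
    show "tuple E b a \<in> Hom E (ob \<theta>) (ob (J (snd X)))" using tuple_hom[OF b a] oJ by simp
    fix f \<theta>' assume f: "ent \<theta>' f \<theta>" and x: "ent \<theta>' (tuple E a b \<cdot> f) (snd X)"
    have "eqv X \<theta>' (a \<cdot> f) (b \<cdot> f)"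
      using x tuple_comp[OF a b ent_hom[OF f]] ent_restrict[OF f a] ent_restrict[OF f b] by (simp add: eqv_def rl_def)
    then show "ent \<theta>' (tuple E b a \<cdot> f) (J (snd X))"
      using Jeqv[OF eqv_sym[OF X]] tuple_comp[OF b a ent_hom[OF f]] by simp
  qed
  have Jtrans: "ent \<theta> (tuple E a d) (J (snd X))"
    if a: "a \<in> Hom E (ob \<theta>) ?C" and b: "b \<in> Hom E (ob \<theta>) ?C" and d: "d \<in> Hom E (ob \<theta>) ?C"
      and e: "ent \<theta> (tuple E a b) (J (snd X))" and e': "ent \<theta> (tuple E b d) (J (snd X))" for \<theta> a b d
  proof (rule J_elim[OF e rf cJ])
    show "tuple E a d \<in> Hom E (ob \<theta>) (ob (J (snd X)))" using tuple_hom[OF a d] oJ by simp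
    fix f \<theta>' assume f: "ent \<theta>' f \<theta>" and x: "ent \<theta>' (tuple E a b \<cdot> f) (snd X)"
    note af = ent_restrict[OF f a] and bf = ent_restrict[OF f b] and df = ent_restrict[OF f d]
    have ab: "eqv X \<theta>' (a \<cdot> f) (b \<cdot> f)"
      using x tuple_comp[OF a b ent_hom[OF f]] af bf by (simp add: eqv_def rl_def)
    have e2: "ent \<theta>' (tuple E (b \<cdot> f) (d \<cdot> f)) (J (snd X))"
      using ent_comp[OF f e'] tuple_comp[OF b d ent_hom[OF f]] by simp
    have "ent \<theta>' (tuple E (a \<cdot> f) (d \<cdot> f)) (J (snd X))"
    proof (rule J_elim[OF e2 rf cJ])
      show "tuple E (a \<cdot> f) (d \<cdot> f) \<in> Hom E (ob \<theta>') (ob (J (snd X)))" using tuple_hom[OF af df] oJ by simp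
      fix g \<theta>'' assume g: "ent \<theta>'' g \<theta>'" and y: "ent \<theta>'' (tuple E (b \<cdot> f) (d \<cdot> f) \<cdot> g) (snd X)"
      have "eqv X \<theta>'' (b \<cdot> f \<cdot> g) (d \<cdot> f \<cdot> g)"
        using y tuple_comp[OF bf df ent_hom[OF g]] ent_restrict[OF g bf] ent_restrict[OF g df] by (simp add: eqv_def rl_def)
      then show "ent \<theta>'' (tuple E (a \<cdot> f) (d \<cdot> f) \<cdot> g) (J (snd X))"
        using Jeqv[OF eqv_trans[OF X eqv_restrict[OF g ab]]] tuple_comp[OF af df ent_hom[OF g]] by simp
    qed
    then show "ent \<theta>' (tuple E a d \<cdot> f) (J (snd X))" using tuple_comp[OF a d ent_hom[OF f]] by simp
  qed
  \<comment> \<open>At global stages, membership in \<open>\<pi> \<rho>\<close> is truth of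
    \<open>J \<rho>\<close>, so the laws just proved carry over to the subobject
    \<open>?R\<close>.\<close>
  have fR: "factors E ?R (tuple E a b) \<longleftrightarrow> ent (top_of P Z) (tuple E a b) (J (snd X))"
    if "a \<in> Hom E Z ?C" "b \<in> Hom E Z ?C" for a b Z
    unfolding J_def using factors_iff_ent_delta[OF R tuple_hom[OF that]] .
  have otop: "ob (top_of P Z) = Z" if "Z \<in> Obj E" for Z using top_fibre[OF that] by (simp add: fibre_def)
  obtain Y r where r: "r \<in> Hom E ?C Y"
    and sep: "\<forall>\<Gamma>. \<forall>u\<in>Hom E \<Gamma> ?C. \<forall>v\<in>Hom E \<Gamma> ?C. \<forall>w\<in>Hom E \<Gamma> ?C. r \<cdot> u = r \<cdot> v \<longrightarrow>
      factors E ?R (tuple E u w) \<longrightarrow> factors E ?R (tuple E v w)"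
    and ext: "\<forall>\<Gamma>. \<forall>u\<in>Hom E \<Gamma> ?C. \<forall>v\<in>Hom E \<Gamma> ?C. (\<forall>\<Gamma>'. \<forall>g\<in>Hom E \<Gamma>' \<Gamma>. \<forall>w\<in>Hom E \<Gamma>' ?C.
        factors E ?R (tuple E (u \<cdot> g) w) \<longleftrightarrow> factors E ?R (tuple E (v \<cdot> g) w)) \<longrightarrow> r \<cdot> u = r \<cdot> v"
    using power_object[OF expo subcl R C] by (elim exE bexE conjE)
  have Y: "Y \<in> Obj E" using Hom_Obj[OF r] by blast
  note Yp = const_per[OF Y]
  have r_cong: "eqv (\<Delta> Y) \<theta> (r \<cdot> a) (r \<cdot> b)" if e: "eqv X \<theta> a b" for \<theta> a b
  proof -
    note a = eqv_hom(1)[OF e] and b = eqv_hom(2)[OF e]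
    obtain f \<theta>' where f: "covers f \<theta>' \<theta>" and x: "factors E ?R (tuple E a b \<cdot> f)"
      using Jeqv[OF e] ent_delta[OF R tuple_hom[OF a b]] by (auto simp: J_def)
    note af = covers_restrict[OF f a] and bf = covers_restrict[OF f b]
    have x: "factors E ?R (tuple E (a \<cdot> f) (b \<cdot> f))" using x tuple_comp[OF a b covers_hom[OF f]] by simp
    \<comment> \<open>Extensionality of \<open>r\<close> tests arrows into the bare context, with no
      predicate attached. Each test is moved to the global stage over \<open>Z\<close>, where the
      laws of \<open>J \<rho>\<close> are available.\<close>
    have "r \<cdot> (a \<cdot> f) = r \<cdot> (b \<cdot> f)"
    proof (rule ext[rule_format, OF af bf])
      fix Z g w assume g: "g \<in> Hom E Z (ob \<theta>')" and w: "w \<in> Hom E Z ?C"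
      have Z: "Z \<in> Obj E" using Hom_Obj[OF g] by blast
      note afg = comp_hom[OF af g] and bfg = comp_hom[OF bf g]
      have "factors E ?R (tuple E (a \<cdot> f \<cdot> g) (b \<cdot> f \<cdot> g))"
        using factors_comp[OF x fibre_subD(2)[OF R] tuple_hom[OF af bf] g] tuple_comp[OF af bf g] by simp
      then have y: "ent (top_of P Z) (tuple E (a \<cdot> f \<cdot> g) (b \<cdot> f \<cdot> g)) (J (snd X))" using fR[OF afg bfg] by blast
      have h: "a \<cdot> f \<cdot> g \<in> Hom E (ob (top_of P Z)) ?C" "b \<cdot> f \<cdot> g \<in> Hom E (ob (top_of P Z)) ?C"
        "w \<in> Hom E (ob (top_of P Z)) ?C" using afg bfg w otop[OF Z] by simp_all
      show "factors E ?R (tuple E (a \<cdot> f \<cdot> g) w) \<longleftrightarrow> factors E ?R (tuple E (b \<cdot> f \<cdot> g) w)"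
        unfolding fR[OF afg w] fR[OF bfg w]
        using Jtrans[OF h(2,1,3) Jsym[OF h(1,2) y]] Jtrans[OF h(1,2,3) y] by blast
    qed
    then have "r \<cdot> a \<cdot> f = r \<cdot> b \<cdot> f" using assoc[OF r a covers_hom[OF f]] assoc[OF r b covers_hom[OF f]] by simp
    then show ?thesis unfolding eqv_const[OF Y] using f comp_hom[OF r a] comp_hom[OF r b] by blast
  qed
  have r': "r \<in> Hom E (fst X) (fst (\<Delta> Y))" using r by (simp add: fst_const_obj)
  obtain G where G: "G \<in> Hom T X (\<Delta> Y)"
    and apG: "\<And>\<theta> c d. ap G \<theta> c d \<longleftrightarrow> eqv X \<theta> c c \<and> eqv (\<Delta> Y) \<theta> (r \<cdot> c) d"
    by (rule graph_exists[OF X Yp r' r_cong]) blast+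
  obtain g where g: "g \<in> Hom E (L X) Y" and gG: "cmp T (const_arr P g) (\<eta> X) = G" using eta_univ[OF G Y] by blast
  note eh = eta_hom[OF X]
  \<comment> \<open>The mediating arrow \<open>g\<close> makes \<open>r c\<close> a function of the
    value of the unit at \<open>c\<close>, so elements with a common value have equal images under
    \<open>r\<close>.\<close>
  have *: "eqv X \<theta> c c \<and> eqv (\<Delta> Y) \<theta> (r \<cdot> c) (g \<cdot> i)" if a: "ap (\<eta> X) \<theta> c i" for \<theta> c i
  proof -
    have i: "i \<in> Hom E (ob \<theta>) (L X)" using ap_hom(2)[OF eh a] by (simp add: fst_const_obj)
    have t: "\<theta> \<in> Pred" using eqv_hom(3)[OF ap_eqv(1)[OF eh a]] .
    have "ap (const_arr P g) \<theta> i (g \<cdot> i)" using ap_const_arr[OF g] i eqv_const_refl[OF Y t comp_hom[OF g i]] by blast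
    then show ?thesis using ap_compI[OF eh const_arr_hom[OF g] a] gG apG by simp
  qed
  have e: "eqv (\<Delta> Y) \<theta> (r \<cdot> c) (r \<cdot> c')" using *[OF 1] *[OF 2] eqv_sym[OF Yp] eqv_trans[OF Yp] by blast
  have c: "c \<in> Hom E (ob \<theta>) ?C" and c': "c' \<in> Hom E (ob \<theta>) ?C" using ap_hom(1)[OF eh] 1 2 by blast+
  obtain f \<theta>' where f: "covers f \<theta>' \<theta>" and x: "r \<cdot> c \<cdot> f = r \<cdot> c' \<cdot> f" using e eqv_const[OF Y] by blast
  note cf = covers_restrict[OF f c] and cf' = covers_restrict[OF f c']
  have "eqv X \<theta>' (c \<cdot> f) (c \<cdot> f)" using *[OF 1] eqv_restrict[OF covers_ent[OF f]] by blast
  then obtain k \<theta>'' where k: "covers k \<theta>'' \<theta>'" and y: "factors E ?R (tuple E (c \<cdot> f) (c \<cdot> f) \<cdot> k)"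
    using Jeqv ent_delta[OF R tuple_hom[OF cf cf]] unfolding J_def by blast
  note cfk = covers_restrict[OF k cf] and cfk' = covers_restrict[OF k cf']
  have y: "factors E ?R (tuple E (c \<cdot> f \<cdot> k) (c \<cdot> f \<cdot> k))" using y tuple_comp[OF cf cf covers_hom[OF k]] by simp
  have "r \<cdot> (c \<cdot> f \<cdot> k) = r \<cdot> (c' \<cdot> f \<cdot> k)"
    using x assoc[OF r c covers_hom[OF f]] assoc[OF r c' covers_hom[OF f]]
      assoc[OF r cf covers_hom[OF k]] assoc[OF r cf' covers_hom[OF k]] by simp
  \<comment> \<open>The member tested is \<open>c\<close> itself: it belongs to its own class, hence
    to the class of \<open>c'\<close>.\<close>
  then have "factors E ?R (tuple E (c' \<cdot> f \<cdot> k) (c \<cdot> f \<cdot> k))" using sep cfk cfk' y by blast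
  then have "factors E ?R (tuple E (c' \<cdot> f) (c \<cdot> f) \<cdot> k)" using tuple_comp[OF cf' cf covers_hom[OF k]] by simp
  then have "ent \<theta>' (tuple E (c' \<cdot> f) (c \<cdot> f)) (J (snd X))"
    unfolding J_def ent_delta[OF R tuple_hom[OF cf' cf]] using k by blast
  then have "ent \<theta>' (tuple E c' c \<cdot> f) (J (snd X))" using tuple_comp[OF c' c covers_hom[OF f]] by simp
  then have "ent \<theta> (tuple E c' c) (J (snd X))" using covers_local[OF f] tuple_hom[OF c' c] oJ by simp
  then show ?thesis using Jsym[OF c' c] by blast
qed

text \<open>The unit is not an epimorphism in general, but it is one up to \<open>J\<close>: it factors through
  the constant subobject on \<open>\<pi>\<close> of its image, which is therefore everything by the universal property.\<close>

lemma eta_surj: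
  assumes X: "is_per P X" and t: "\<theta> \<in> Pred" and i: "i \<in> Hom E (ob \<theta>) (L X)"
  shows "ent \<theta> i (J (im (\<eta> X)))"
proof -
  note eh = eta_hom[OF X]
  have imf: "im (\<eta> X) \<in> fibre P (L X)" using im_fibre[OF eh] by (simp add: fst_const_obj)
  let ?s = "\<pi> (im (\<eta> X))"
  have s: "?s \<in> fibre (sub E) (L X)" using pi_fibre[OF imf] .
  note sh = fibre_subD(2)[OF s]
  have "factors T (const_arr P ?s) (\<eta> X)"
  proof (rule factors_if_im[OF eh const_arr_hom[OF sh] const_mono[OF sh fibre_subD(1)[OF s]]])
    fix \<theta> c assume "ent \<theta> c (im (\<eta> X))"
    then show "ent \<theta> c (im (const_arr P ?s))" unfolding ent_im_const[OF s] using J_intro by (simp add: J_def)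
  qed
  then obtain G where G: "G \<in> Hom T X (\<Delta> (src E ?s))" "cmp T (const_arr P ?s) G = \<eta> X"
    using T.factorsE[OF _ const_arr_hom[OF sh] eh] by blast
  obtain g where g: "g \<in> Hom E (L X) (src E ?s)" "cmp T (const_arr P g) (\<eta> X) = G"
    using eta_univ[OF G(1) Hom_Obj(1)[OF sh]] by blast
  have "cmp T (const_arr P (?s \<cdot> g)) (\<eta> X) = \<eta> X"
    using const_functor(2)[OF g(1) sh] T.assoc[OF const_arr_hom[OF sh] const_arr_hom[OF g(1)] eh] g(2) G(2) by simp
  moreover have "cmp T (const_arr P (idt E (L X))) (\<eta> X) = \<eta> X"
    using const_functor(1)[OF L_Obj[OF X]] T.id_comp[OF eh] by simp
  \<comment> \<open>Both arrows mediate the unit through itself, so they agree and \<open>g\<close>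
    is a section of the mono \<open>?s\<close>.\<close>
  ultimately have "?s \<cdot> g = idt E (L X)"
    using eta_univ[OF eh L_Obj[OF X]] comp_hom[OF sh g(1)] id_hom[OF L_Obj[OF X]] by blast
  then have "?s \<cdot> (g \<cdot> i) = i" using assoc[OF sh g(1) i] id_comp[OF i] by simp
  then have "factors E ?s i" using factorsI[OF sh comp_hom[OF g(1) i]] by blast
  then show ?thesis unfolding J_def using ent_deltaI[OF s t i] by blast
qed

text \<open>For a closed goal, an element of the reflection may be assumed to be a value of the unit
  after restriction.\<close>

lemma eta_surj_elim:
  assumes X: "is_per P X" and t: "\<theta> \<in> Pred" and i: "i \<in> Hom E (ob \<theta>) (L X)"
    and c: "closed \<chi>" and b: "b \<in> Hom E (ob \<theta>) (ob \<chi>)"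
    and step: "\<And>f \<theta>' d. ent \<theta>' f \<theta> \<Longrightarrow> ap (\<eta> X) \<theta>' d (i \<cdot> f) \<Longrightarrow> ent \<theta>' (b \<cdot> f) \<chi>"
  shows "ent \<theta> b \<chi>"
proof -
  note eh = eta_hom[OF X]
  show ?thesis
  proof (rule J_elim[OF eta_surj[OF X t i] im_fibre[OF eh] c b])
    fix f \<theta>' assume f: "ent \<theta>' f \<theta>" and "ent \<theta>' (i \<cdot> f) (im (\<eta> X))"
    then obtain g \<theta>'' d where g: "covers g \<theta>'' \<theta>'" and d: "ap (\<eta> X) \<theta>'' d (i \<cdot> f \<cdot> g)"
      unfolding ent_im[OF eh] by blast
    have "ap (\<eta> X) \<theta>'' d (i \<cdot> (f \<cdot> g))" using d assoc[OF i ent_hom[OF f] covers_hom[OF g]] by simp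
    then have "ent \<theta>'' (b \<cdot> (f \<cdot> g)) \<chi>" using step[OF ent_comp[OF covers_ent[OF g] f]] by blast
    then have "ent \<theta>'' (b \<cdot> f \<cdot> g) \<chi>" using assoc[OF b ent_hom[OF f] covers_hom[OF g]] by simp
    then show "ent \<theta>' (b \<cdot> f) \<chi>" using covers_local[OF g] ent_restrict[OF f b] by blast
  qed
qed

lemma eta_nat_ap:
  assumes m: "m \<in> Hom T U A" and a: "ap (\<eta> U) \<theta> d i"
  obtains f \<theta>' c where "covers f \<theta>' \<theta>" "ap m \<theta>' (d \<cdot> f) c" "ap (\<eta> A) \<theta>' c (FAr \<Pi> m \<cdot> i \<cdot> f)"
proof -
  note U = hom_per(1)[OF m] and A = hom_per(2)[OF m]
  note uh = eta_hom[OF U] and ah = eta_hom[OF A] and n = Pi_hom[OF m]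
  have i: "i \<in> Hom E (ob \<theta>) (L U)" using ap_hom(2)[OF uh a] by (simp add: fst_const_obj)
  have t: "\<theta> \<in> Pred" using eqv_hom(3)[OF ap_eqv(1)[OF uh a]] .
  have "ap (const_arr P (FAr \<Pi> m)) \<theta> i (FAr \<Pi> m \<cdot> i)"
    using ap_const_arr[OF n] i eqv_const_refl[OF L_Obj[OF A] t comp_hom[OF n i]] by blast
  then have "ap (cmp T (\<eta> A) m) \<theta> d (FAr \<Pi> m \<cdot> i)"
    using ap_compI[OF uh const_arr_hom[OF n] a] eta_nat[OF m] by simp
  then show thesis using that unfolding ap_comp[OF m ah] by blast
qed

text \<open>Since the left adjoint is only given by its universal property, its preservation of
  monomorphisms has to be derived; this is its internal form.\<close>

lemma Pi_mono_internal:
  assumes m: "m \<in> Hom T U A" and mono: "mono_arr T m"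
    and i: "i \<in> Hom E (ob \<theta>) (L U)" and i': "i' \<in> Hom E (ob \<theta>) (L U)"
    and e: "eqv (\<Delta> (L A)) \<theta> (FAr \<Pi> m \<cdot> i) (FAr \<Pi> m \<cdot> i')"
  shows "eqv (\<Delta> (L U)) \<theta> i i'"
proof -
  note U = hom_per(1)[OF m] and A = hom_per(2)[OF m]
  note uh = eta_hom[OF U] and ah = eta_hom[OF A] and n = Pi_hom[OF m]
  note LU = L_Obj[OF U] and LA = L_Obj[OF A]
  note inj = mono_T_iff[OF m, THEN iffD1, OF mono, rule_format]
  note dU = const_per[OF LU] and dA = const_per[OF LA]
  let ?eq = "equality P (L U)"
  note cl = closed_equality[OF LU]
  have oq: "ob ?eq = prd E (L U) (L U)" using equality_fibre[OF LU] by (simp add: fibre_def)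
  have eqI: "ent \<theta> (tuple E x y) ?eq" if "eqv (\<Delta> (L U)) \<theta> x y" for \<theta> x y
    using that by (simp add: eqv_def rl_def const_obj_def)
  have eqD: "eqv (\<Delta> (L U)) \<theta> x y"
    if "ent \<theta> (tuple E x y) ?eq" "x \<in> Hom E (ob \<theta>) (L U)" "y \<in> Hom E (ob \<theta>) (L U)" for \<theta> x y
    using that by (simp add: eqv_def rl_def const_obj_def)
  \<comment> \<open>The case in which both elements are values of the unit, \<open>x\<close> at
    \<open>d\<close> and \<open>y\<close> at \<open>d'\<close>; the general case reduces to it by
    \<open>eta_surj_elim\<close>, used once for each element.\<close>
  have core: "eqv (\<Delta> (L U)) \<theta> x y"
    if 1: "ap (\<eta> U) \<theta> d x" and 2: "ap (\<eta> U) \<theta> d' y"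
      and e: "eqv (\<Delta> (L A)) \<theta> (FAr \<Pi> m \<cdot> x) (FAr \<Pi> m \<cdot> y)" for \<theta> d d' x y
  proof -
    have x: "x \<in> Hom E (ob \<theta>) (L U)" and y: "y \<in> Hom E (ob \<theta>) (L U)"
      using ap_hom(2)[OF uh] 1 2 by (auto simp: fst_const_obj)
    obtain f \<theta>' c where f: "covers f \<theta>' \<theta>" and a: "ap m \<theta>' (d \<cdot> f) c" "ap (\<eta> A) \<theta>' c (FAr \<Pi> m \<cdot> x \<cdot> f)"
      using eta_nat_ap[OF m 1] .
    note xf = covers_restrict[OF f x] and yf = covers_restrict[OF f y]
    obtain g \<theta>'' c' where g: "covers g \<theta>'' \<theta>'" and b: "ap m \<theta>'' (d' \<cdot> f \<cdot> g) c'"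
      "ap (\<eta> A) \<theta>'' c' (FAr \<Pi> m \<cdot> (y \<cdot> f) \<cdot> g)"
      using eta_nat_ap[OF m ap_restrict[OF covers_ent[OF f] 2]] .
    have fe: "ent \<theta>' f \<theta>" and ge: "ent \<theta>'' g \<theta>'" using covers_ent f g by blast+
    have b2: "ap (\<eta> A) \<theta>'' c' (FAr \<Pi> m \<cdot> y \<cdot> f \<cdot> g)" using b(2) assoc[OF n y covers_hom[OF f]] by simp
    have "eqv (\<Delta> (L A)) \<theta>'' (FAr \<Pi> m \<cdot> y \<cdot> f \<cdot> g) (FAr \<Pi> m \<cdot> x \<cdot> f \<cdot> g)"
      using eqv_sym[OF dA eqv_restrict[OF ge eqv_restrict[OF fe e]]] .
    then have c'1: "ap (\<eta> A) \<theta>'' c' (FAr \<Pi> m \<cdot> x \<cdot> f \<cdot> g)" using ap_ext2[OF ah b2] by blast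
    have cg: "ap (\<eta> A) \<theta>'' (c \<cdot> g) (FAr \<Pi> m \<cdot> x \<cdot> f \<cdot> g)" using ap_restrict[OF ge a(2)] .
    have mg: "ap m \<theta>'' (d \<cdot> f \<cdot> g) (c \<cdot> g)" using ap_restrict[OF ge a(1)] .
    \<comment> \<open>By naturality the images \<open>c\<close> and \<open>c'\<close> of
      \<open>d\<close> and \<open>d'\<close> under \<open>m\<close> have the same value under the
      unit of \<open>A\<close>, so they agree up to \<open>J\<close>. Since the goal is an equation
      in a constant object, they may be taken to agree outright, and injectivity of \<open>m\<close>
      identifies \<open>d\<close> with \<open>d'\<close>.\<close>
    have J: "ent \<theta>'' (tuple E (c \<cdot> g) c') (J (snd A))" using eta_kernel[OF A cg c'1] .
    note ch = ap_hom(1)[OF ah cg] and ch' = ap_hom(1)[OF ah c'1]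
    note xfg = covers_restrict[OF g xf] and yfg = covers_restrict[OF g yf]
    have "ent \<theta>'' (tuple E (x \<cdot> f \<cdot> g) (y \<cdot> f \<cdot> g)) ?eq"
    proof (rule J_elim[OF J per_fibre[OF A] cl])
      show "tuple E (x \<cdot> f \<cdot> g) (y \<cdot> f \<cdot> g) \<in> Hom E (ob \<theta>'') (ob ?eq)" using tuple_hom[OF xfg yfg] oq by simp
      fix h \<theta>3 assume h: "ent \<theta>3 h \<theta>''" and r: "ent \<theta>3 (tuple E (c \<cdot> g) c' \<cdot> h) (snd A)"
      have "eqv A \<theta>3 (c \<cdot> g \<cdot> h) (c' \<cdot> h)"
        using r tuple_comp[OF ch ch' ent_hom[OF h]] ent_restrict[OF h ch] ent_restrict[OF h ch']
        by (simp add: eqv_def rl_def)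
      then have "ap m \<theta>3 (d \<cdot> f \<cdot> g \<cdot> h) (c' \<cdot> h)" using ap_ext2[OF m ap_restrict[OF h mg]] by blast
      then have "eqv U \<theta>3 (d' \<cdot> f \<cdot> g \<cdot> h) (d \<cdot> f \<cdot> g \<cdot> h)" using inj ap_restrict[OF h b(1)] by blast
      moreover have "ap (\<eta> U) \<theta>3 (d' \<cdot> f \<cdot> g \<cdot> h) (y \<cdot> f \<cdot> g \<cdot> h)" "ap (\<eta> U) \<theta>3 (d \<cdot> f \<cdot> g \<cdot> h) (x \<cdot> f \<cdot> g \<cdot> h)"
        using ap_restrict[OF h ap_restrict[OF ge ap_restrict[OF fe 2]]]
          ap_restrict[OF h ap_restrict[OF ge ap_restrict[OF fe 1]]] .
      ultimately have "eqv (\<Delta> (L U)) \<theta>3 (x \<cdot> f \<cdot> g \<cdot> h) (y \<cdot> f \<cdot> g \<cdot> h)"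
        using ap_single[OF uh] ap_ext1[OF uh] by blast
      then show "ent \<theta>3 (tuple E (x \<cdot> f \<cdot> g) (y \<cdot> f \<cdot> g) \<cdot> h) ?eq"
        using eqI tuple_comp[OF xfg yfg ent_hom[OF h]] by simp
    qed
    then have "eqv (\<Delta> (L U)) \<theta>'' (x \<cdot> f \<cdot> g) (y \<cdot> f \<cdot> g)" using eqD xfg yfg by blast
    then have "eqv (\<Delta> (L U)) \<theta>' (x \<cdot> f) (y \<cdot> f)" using eqv_local[OF dU g] xf yf by (simp add: fst_const_obj)
    then show ?thesis using eqv_local[OF dU f] x y by (simp add: fst_const_obj)
  qed
  have t: "\<theta> \<in> Pred" using eqv_hom(3)[OF e] .
  have "ent \<theta> (tuple E i i') ?eq"
  proof (rule eta_surj_elim[OF U t i cl])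
    show "tuple E i i' \<in> Hom E (ob \<theta>) (ob ?eq)" using tuple_hom[OF i i'] oq by simp
    fix f \<theta>' d assume f: "ent \<theta>' f \<theta>" and d: "ap (\<eta> U) \<theta>' d (i \<cdot> f)"
    note if1 = ent_restrict[OF f i] and if2 = ent_restrict[OF f i']
    have "ent \<theta>' (tuple E (i \<cdot> f) (i' \<cdot> f)) ?eq"
    proof (rule eta_surj_elim[OF U ent_dom[OF f] if2 cl])
      show "tuple E (i \<cdot> f) (i' \<cdot> f) \<in> Hom E (ob \<theta>') (ob ?eq)" using tuple_hom[OF if1 if2] oq by simp
      fix g \<theta>'' d' assume g: "ent \<theta>'' g \<theta>'" and d': "ap (\<eta> U) \<theta>'' d' (i' \<cdot> f \<cdot> g)"
      have "eqv (\<Delta> (L A)) \<theta>'' (FAr \<Pi> m \<cdot> (i \<cdot> f \<cdot> g)) (FAr \<Pi> m \<cdot> (i' \<cdot> f \<cdot> g))"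
        using eqv_restrict[OF g eqv_restrict[OF f e]] assoc[OF n i ent_hom[OF f]] assoc[OF n i' ent_hom[OF f]]
          assoc[OF n if1 ent_hom[OF g]] assoc[OF n if2 ent_hom[OF g]] by simp
      then have "eqv (\<Delta> (L U)) \<theta>'' (i \<cdot> f \<cdot> g) (i' \<cdot> f \<cdot> g)" using core[OF ap_restrict[OF g d] d'] by blast
      then show "ent \<theta>'' (tuple E (i \<cdot> f) (i' \<cdot> f) \<cdot> g) ?eq" using eqI tuple_comp[OF if1 if2 ent_hom[OF g]] by simp
    qed
    then show "ent \<theta>' (tuple E i i' \<cdot> f) ?eq" using tuple_comp[OF i i' ent_hom[OF f]] by simp
  qed
  then show ?thesis using eqD i i' by blast
qed

text \<open>At a global stage the internal statement becomes cancellation of arrows of the base, by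
  \<open>eqv_const_discrete\<close>.\<close>

lemma Pi_mono:
  assumes m: "m \<in> Hom T U A" and mono: "mono_arr T m"
  shows "FAr \<Pi> m \<in> fibre (sub E) (L A)"
proof (rule fibre_subI[OF _ Pi_hom[OF m]])
  note U = hom_per(1)[OF m] and A = hom_per(2)[OF m] and n = Pi_hom[OF m]
  show "mono_arr E (FAr \<Pi> m)"
    unfolding mono_arr_def Hom_src[OF n]
  proof (intro conjI ballI impI)
    show "FAr \<Pi> m \<in> Arr E" using Hom_Arr[OF n] .
    fix Z x y assume Z: "Z \<in> Obj E" and x: "x \<in> Hom E Z (L U)" and y: "y \<in> Hom E Z (L U)"
      and e: "FAr \<Pi> m \<cdot> x = FAr \<Pi> m \<cdot> y"
    have t: "top_of P Z \<in> Pred" "ob (top_of P Z) = Z" using top_fibre[OF Z] by (auto simp: fibre_def)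
    have "eqv (\<Delta> (L A)) (top_of P Z) (FAr \<Pi> m \<cdot> x) (FAr \<Pi> m \<cdot> y)"
      using eqv_const_refl[OF L_Obj[OF A] t(1)] comp_hom[OF n x] t(2) e by simp
    then have "eqv (\<Delta> (L U)) (top_of P Z) x y" using Pi_mono_internal[OF m mono] x y t(2) by simp
    then show "x = y" using eqv_const_discrete[OF x y] by blast
  qed
qed

section \<open>The closure operation\<close>

text \<open>\<open>closure_op\<close> takes some pullback by \<open>SOME\<close>. The explicit one
  of \<open>pullback_of_mono\<close> is isomorphic to it and so has the same elements.\<close>

lemma closure_is_pullback:
  assumes m: "m \<in> fibre (sub T) A"
  defines "p \<equiv> closure_op T \<Pi> (constant_objects P) \<eta> m"
  shows "p \<in> fibre (sub T) A"
    and "ent \<theta> c (im p) \<longleftrightarrow> eqv A \<theta> c c \<and>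
      (\<exists>f \<theta>' i. covers f \<theta>' \<theta> \<and> ap (\<eta> A) \<theta>' (c \<cdot> f) i \<and> ent \<theta>' i (delta P (FAr \<Pi> m)))"
proof -
  note mh = subT_D(1)[OF m] and A = subT_D(3)[OF m]
  note n = Pi_mono[OF mh fibre_subD(1)[OF m]]
  note nh = Pi_hom[OF mh] and ah = eta_hom[OF A]
  note ch = const_arr_hom[OF nh] and cm = const_mono[OF nh fibre_subD(1)[OF n]]
  obtain p0 q0 where pb0: "is_pullback T (\<eta> A) (const_arr P (FAr \<Pi> m)) p0 q0" and p0: "p0 \<in> fibre (sub T) A"
    and ip: "\<And>\<theta> c. ent \<theta> c (im p0) \<longleftrightarrow> eqv A \<theta> c c \<and>
      (\<exists>f \<theta>' b. covers f \<theta>' \<theta> \<and> ap (\<eta> A) \<theta>' (c \<cdot> f) b \<and> ent \<theta>' b (im (const_arr P (FAr \<Pi> m))))"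
    using pullback_of_mono[OF ah ch cm] by metis
  have "p = (SOME p. \<exists>q. is_pullback T (\<eta> A) (const_arr P (FAr \<Pi> m)) p q)"
    by (simp add: p_def closure_op_def pullback_along_def constant_objects_def Hom_tgt[OF mh])
  then have "\<exists>q. is_pullback T (\<eta> A) (const_arr P (FAr \<Pi> m)) p q"
    using someI[of "\<lambda>p. \<exists>q. is_pullback T (\<eta> A) (const_arr P (FAr \<Pi> m)) p q", OF exI, OF pb0] by (rule ssubst)
  then obtain q where pb: "is_pullback T (\<eta> A) (const_arr P (FAr \<Pi> m)) p q" ..
  note h = T.pullback_Hom[OF pb ah ch] and h0 = T.pullback_Hom[OF pb0 ah ch]
  show pf: "p \<in> fibre (sub T) A" using fibre_subI[OF T.pullback_mono[OF pb ah ch cm] h(1)] .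
  have "factors T p p0"
    by (rule T.pullback_lift[OF pb ah ch h0]) (use T.factorsI[OF h(1)] in blast)
  moreover have "factors T p0 p"
    by (rule T.pullback_lift[OF pb0 ah ch h]) (use T.factorsI[OF h0(1)] in blast)
  ultimately have "ent \<theta> c (im p) \<longleftrightarrow> ent \<theta> c (im p0)"
    using factors_im[OF h0(1) h(1)] factors_im[OF h(1) h0(1)] by blast
  then show "ent \<theta> c (im p) \<longleftrightarrow> eqv A \<theta> c c \<and>
      (\<exists>f \<theta>' i. covers f \<theta>' \<theta> \<and> ap (\<eta> A) \<theta>' (c \<cdot> f) i \<and> ent \<theta>' i (delta P (FAr \<Pi> m)))"
    unfolding ip ent_im_const[OF n] .
qed

text \<open>On a cover the unit sends \<open>c\<close> to \<open>\<Pi> m\<close> of some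
  \<open>u\<close>. Up to \<open>J\<close>, \<open>u\<close> is a value of the unit at some
  \<open>d\<close>, and naturality makes \<open>m d\<close> and \<open>c\<close> have the same
  value. By \<open>eta_kernel\<close> they agree up to \<open>J\<close>, so \<open>c\<close> lies in
  the image of \<open>m\<close> up to \<open>J\<close>.\<close>

lemma im_closure_le_J:
  assumes m: "m \<in> fibre (sub T) A"
    and e: "ent \<theta> c (im (closure_op T \<Pi> (constant_objects P) \<eta> m))"
  shows "ent \<theta> c (J (im m))"
proof -
  note mh = subT_D(1)[OF m] and A = subT_D(3)[OF m]
  note n = Pi_mono[OF mh fibre_subD(1)[OF m]]
  note nh = Pi_hom[OF mh] and ah = eta_hom[OF A] and U = hom_per(1)[OF mh]
  note imf = im_fibre[OF mh]
  note cJ = closed_J[OF imf]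
  have oJ: "ob (J (im m)) = fst A" using J_fibre[OF imf] by (simp add: fibre_def)
  obtain f \<theta>1 i where f: "covers f \<theta>1 \<theta>" and a: "ap (\<eta> A) \<theta>1 (c \<cdot> f) i" and ni: "ent \<theta>1 i (delta P (FAr \<Pi> m))"
    and cc: "eqv A \<theta> c c"
    using e closure_is_pullback(2)[OF m] by blast
  note c = eqv_hom(1)[OF cc]
  note cf = covers_restrict[OF f c]
  have i: "i \<in> Hom E (ob \<theta>1) (L A)" using ap_hom(2)[OF ah a] by (simp add: fst_const_obj)
  obtain g \<theta>2 where g: "covers g \<theta>2 \<theta>1" and fac: "factors E (FAr \<Pi> m) (i \<cdot> g)" using ni ent_delta[OF n i] by blast
  note cfg = covers_restrict[OF g cf]
  obtain u where u: "u \<in> Hom E (ob \<theta>2) (L (src T m))" and nu: "FAr \<Pi> m \<cdot> u = i \<cdot> g"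
    using factorsE[OF fac nh covers_restrict[OF g i]] .
  have t2: "\<theta>2 \<in> Pred" using ent_dom[OF covers_ent[OF g]] .
  have a2: "ap (\<eta> A) \<theta>2 (c \<cdot> f \<cdot> g) (FAr \<Pi> m \<cdot> u)" using ap_restrict[OF covers_ent[OF g] a] nu by simp
  have "ent \<theta>2 (c \<cdot> f \<cdot> g) (J (im m))"
  proof (rule eta_surj_elim[OF U t2 u cJ])
    show "c \<cdot> f \<cdot> g \<in> Hom E (ob \<theta>2) (ob (J (im m)))" using cfg oJ by simp
    fix h \<theta>3 d assume h: "ent \<theta>3 h \<theta>2" and d: "ap (\<eta> (src T m)) \<theta>3 d (u \<cdot> h)"
    note x = ent_restrict[OF h cfg]
    obtain k \<theta>4 c' where k: "covers k \<theta>4 \<theta>3" and mc: "ap m \<theta>4 (d \<cdot> k) c'"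
      and ec: "ap (\<eta> A) \<theta>4 c' (FAr \<Pi> m \<cdot> (u \<cdot> h) \<cdot> k)" using eta_nat_ap[OF mh d] .
    let ?x = "c \<cdot> f \<cdot> g \<cdot> h"
    have "ap (\<eta> A) \<theta>4 (?x \<cdot> k) (FAr \<Pi> m \<cdot> (u \<cdot> h) \<cdot> k)"
      using ap_restrict[OF covers_ent[OF k] ap_restrict[OF h a2]] assoc[OF nh u ent_hom[OF h]] by simp
    from eta_kernel[OF A ec this] have Jr: "ent \<theta>4 (tuple E c' (?x \<cdot> k)) (J (snd A))" .
    note xk = covers_restrict[OF k x] and c'h = ap_hom(1)[OF ah ec]
    have "ent \<theta>4 (?x \<cdot> k) (J (im m))"
    proof (rule J_elim[OF Jr per_fibre[OF A] cJ])
      show "?x \<cdot> k \<in> Hom E (ob \<theta>4) (ob (J (im m)))" using xk oJ by simp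
      fix l \<theta>5 assume l: "ent \<theta>5 l \<theta>4" and r: "ent \<theta>5 (tuple E c' (?x \<cdot> k) \<cdot> l) (snd A)"
      have "eqv A \<theta>5 (c' \<cdot> l) (?x \<cdot> k \<cdot> l)"
        using r tuple_comp[OF c'h xk ent_hom[OF l]] ent_restrict[OF l c'h] ent_restrict[OF l xk]
        by (simp add: eqv_def rl_def)
      then have "ap m \<theta>5 (d \<cdot> k \<cdot> l) (?x \<cdot> k \<cdot> l)" using ap_ext2[OF mh ap_restrict[OF l mc]] by blast
      then show "ent \<theta>5 (?x \<cdot> k \<cdot> l) (J (im m))" using J_intro ent_imI[OF mh] by blast
    qed
    then show "ent \<theta>3 ?x (J (im m))" using covers_local[OF k] x oJ by simp
  qed
  then have "ent \<theta>1 (c \<cdot> f) (J (im m))" using covers_local[OF g] cf oJ by simp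
  then show ?thesis using covers_local[OF f] c oJ by simp
qed

theorem closure_iso_neg_neg:
  assumes m: "m \<in> fibre (sub T) A"
  shows "fib_iso (sub T) A (closure_op T \<Pi> (constant_objects P) \<eta> m) (neg (sub T) A (neg (sub T) A m))"
proof -
  let ?p = "closure_op T \<Pi> (constant_objects P) \<eta> m"
  let ?N = "neg (sub T) A m"
  let ?NN = "neg (sub T) A ?N"
  note mh = subT_D(1)[OF m] and A = subT_D(3)[OF m]
  note n = Pi_mono[OF mh fibre_subD(1)[OF m]]
  note nh = Pi_hom[OF mh] and ah = eta_hom[OF A] and U = hom_per(1)[OF mh]
  note imf = im_fibre[OF mh]
  have N: "?N \<in> fibre (sub T) A" using neg_fibre[OF m] .
  have NN: "?NN \<in> fibre (sub T) A" using neg_fibre[OF N] .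
  have p: "?p \<in> fibre (sub T) A" using closure_is_pullback(1)[OF m] .
  have "le (sub T) A ?p ?NN"
    unfolding le_neg[OF N p]
  proof (intro allI impI)
    fix \<theta> c assume x: "ent \<theta> c (im ?p)" and y: "ent \<theta> c (im ?N)"
    have t: "ob \<theta> \<in> Obj E" using proj_ob[OF ent_dom[OF x]] .
    have ob: "ob (bot_of P (ob \<theta>)) = ob \<theta>" using bot_fibre[OF t] by (simp add: fibre_def)
    \<comment> \<open>Falsity is closed, so \<open>J (im m)\<close> may be weakened to
      \<open>im m\<close>, which contradicts membership in \<open>?N\<close>.\<close>
    show "falsum \<theta>"
      unfolding falsum_def
    proof (rule J_elim[OF im_closure_le_J[OF m x] imf closed_bot[OF t]])
      show "idt E (ob \<theta>) \<in> Hom E (ob \<theta>) (ob (bot_of P (ob \<theta>)))" using id_hom[OF t] ob by simp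
      fix f \<theta>' assume f: "ent \<theta>' f \<theta>" and z: "ent \<theta>' (c \<cdot> f) (im m)"
      have "falsum \<theta>'" using y f z ent_im_neg[OF m] by blast
      then show "ent \<theta>' (idt E (ob \<theta>) \<cdot> f) (bot_of P (ob \<theta>))"
        using ent_bot_iff[OF t ent_hom[OF f]] id_comp[OF ent_hom[OF f]] by simp
    qed
  qed
  moreover have "le (sub T) A ?NN ?p"
    unfolding sub_T_le[OF NN p]
  proof (intro allI impI)
    fix \<theta> c assume x: "ent \<theta> c (im ?NN)"
    have cc: "eqv A \<theta> c c" using x ent_im_neg[OF N] by blast
    note c = eqv_hom(1)[OF cc]
    obtain f \<theta>1 i where f: "covers f \<theta>1 \<theta>" and a: "ap (\<eta> A) \<theta>1 (c \<cdot> f) i" using ap_total[OF ah cc] by blast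
    have i: "i \<in> Hom E (ob \<theta>1) (L A)" using ap_hom(2)[OF ah a] by (simp add: fst_const_obj)
    have od: "ob (delta P (FAr \<Pi> m)) = L A" using delta_fibre[OF n] by (simp add: fibre_def)
    note cf = covers_restrict[OF f c]
    \<comment> \<open>Stability is applied to the value \<open>i\<close> of the unit at
      \<open>c\<close>, in a constant object. The double negation known for \<open>c\<close> in
      \<open>m\<close> must therefore be carried over to \<open>i\<close> in
      \<open>\<Pi> m\<close>.\<close>
    have "ent \<theta>1 i (delta P (FAr \<Pi> m))"
    proof (rule closed_stable[OF closed_delta[OF n] _ ent_dom[OF covers_ent[OF f]]])
      show "i \<in> Hom E (ob \<theta>1) (ob (delta P (FAr \<Pi> m)))" using i od by simp
      fix g \<theta>2 assume g: "ent \<theta>2 g \<theta>1"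
        and nn: "\<And>h \<theta>3. ent \<theta>3 h \<theta>2 \<Longrightarrow> ent \<theta>3 (i \<cdot> g \<cdot> h) (delta P (FAr \<Pi> m)) \<Longrightarrow> falsum \<theta>3"
      let ?c = "c \<cdot> f \<cdot> g"
      note cfg = ent_restrict[OF g cf]
      have ig: "i \<cdot> g \<in> Hom E (ob \<theta>2) (L A)" using ent_restrict[OF g i] .
      \<comment> \<open>By contraposition along the unit: if \<open>c\<close> were in
        \<open>m\<close> at a later stage, naturality would put \<open>i\<close> into
        \<open>\<Pi> m\<close>, which \<open>nn\<close> excludes.\<close>
      have "ent \<theta>2 ?c (im ?N)"
        unfolding ent_im_neg[OF m]
      proof (intro conjI allI impI)
        show "eqv A \<theta>2 ?c ?c" using eqv_restrict[OF g eqv_restrict[OF covers_ent[OF f] cc]] .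
        fix h \<theta>3 assume h: "ent \<theta>3 h \<theta>2" and y: "ent \<theta>3 (?c \<cdot> h) (im m)"
        note igh = ent_restrict[OF h ig]
        obtain k \<theta>4 d where k: "covers k \<theta>4 \<theta>3" and md: "ap m \<theta>4 d (?c \<cdot> h \<cdot> k)" using y ent_im[OF mh] by blast
        have "ap (\<eta> A) \<theta>4 (?c \<cdot> h \<cdot> k) (i \<cdot> g \<cdot> h \<cdot> k)"
          using ap_restrict[OF covers_ent[OF k] ap_restrict[OF h ap_restrict[OF g a]]] .
        then have "ap (cmp T (const_arr P (FAr \<Pi> m)) (\<eta> (src T m))) \<theta>4 d (i \<cdot> g \<cdot> h \<cdot> k)"
          using ap_compI[OF mh ah md] eta_nat[OF mh] by simp
        then obtain l \<theta>5 u where l: "covers l \<theta>5 \<theta>4" and cu: "ap (const_arr P (FAr \<Pi> m)) \<theta>5 u (i \<cdot> g \<cdot> h \<cdot> k \<cdot> l)"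
          unfolding ap_comp[OF eta_hom[OF U] const_arr_hom[OF nh]] by blast
        have "ent \<theta>5 (i \<cdot> g \<cdot> h \<cdot> k \<cdot> l) (delta P (FAr \<Pi> m))"
          using ent_imI[OF const_arr_hom[OF nh] cu] ent_im_const[OF n] by blast
        then have "ent \<theta>4 (i \<cdot> g \<cdot> h \<cdot> k) (delta P (FAr \<Pi> m))"
          using covers_local[OF l] covers_restrict[OF k igh] od by simp
        then have "ent \<theta>3 (i \<cdot> g \<cdot> h) (delta P (FAr \<Pi> m))" using covers_local[OF k] igh od by simp
        then show "falsum \<theta>3" using nn[OF h] by blast
      qed
      moreover have "ent \<theta>2 ?c (im ?NN)" using ent_comp[OF g ent_comp[OF covers_ent[OF f] x]] .
      ultimately show "falsum \<theta>2"
        using ent_im_neg[OF N] ent_refl[OF ent_dom[OF g]] comp_id[OF cfg] by metis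
    qed
    then show "ent \<theta> c (im ?p)" unfolding closure_is_pullback(2)[OF m] using cc f a by blast
  qed
  ultimately show ?thesis by (simp add: fib_iso_def)
qed

end

section \<open>The locale assumptions discharged for the given tripos\<close>

theorem corollary3p4p35:
  fixes P :: "('o, 'a, 'p, 'q) fib"
    and \<Pi> :: "('o \<times> 'p, ('o \<times> 'p) \<times> ('o \<times> 'p) \<times> 'p set, 'o, 'a) cfunctor"
    and \<eta> :: "'o \<times> 'p \<Rightarrow> ('o \<times> 'p) \<times> ('o \<times> 'p) \<times> 'p set"
  assumes "boolean_topos (Base P)"
    and "totally_connected_tripos P"
    and "adjunction (tripos_to_topos P) (Base P) \<Pi> (constant_objects P) \<eta>"
    and "A \<in> Obj (tripos_to_topos P)"
    and "m \<in> fibre (sub (tripos_to_topos P)) A"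
  shows "fib_iso (sub (tripos_to_topos P)) A
           (closure_op (tripos_to_topos P) \<Pi> (constant_objects P) \<eta> m)
           (neg (sub (tripos_to_topos P)) A (neg (sub (tripos_to_topos P)) A m))"
proof -
  have trip: "tripos P" and tc: "totally_connected P"
    using assms(2) by (auto simp: totally_connected_tripos_def regular_tripos_def)
  have top: "topos (Base P)" using assms(1) by (simp add: boolean_topos_def)
  interpret tripos_fib P
    using trip top by unfold_locales (auto simp: tripos_def topos_def)
  obtain \<pi> where pi1: "\<forall>A\<in>Obj E. \<forall>\<phi>\<in>fibre P A. \<pi> \<phi> \<in> fibre (sub E) A \<and>
        (\<forall>m\<in>fibre (sub E) A. le (sub E) A (\<pi> \<phi>) m \<longleftrightarrow> le P A \<phi> (delta P m))"
    and pi2: "\<forall>A B. \<forall>f\<in>Hom E A B. \<forall>\<phi>\<in>fibre P B.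
        fib_iso (sub E) A (\<pi> (reindex P f \<phi>)) (reindex (sub E) f (\<pi> \<phi>))"
    and pi3: "\<forall>A\<in>Obj E. (\<forall>t. is_top P A t \<longrightarrow> is_top (sub E) A (\<pi> t)) \<and>
        (\<forall>\<phi>\<in>fibre P A. \<forall>\<psi>\<in>fibre P A. \<forall>\<chi>. is_meet P A \<phi> \<psi> \<chi> \<longrightarrow> is_meet (sub E) A (\<pi> \<phi>) (\<pi> \<psi>) (\<pi> \<chi>))"
    using tc unfolding totally_connected_def by (elim exE conjE)
  have fo: "A \<in> Obj E" if "\<phi> \<in> fibre P A" for \<phi> A using that proj_ob by (auto simp: fibre_def)
  interpret reflection_tripos P \<pi> \<Pi> \<eta>
  proof unfold_locales
    show "is_top (sub E) A (\<pi> t)" if "is_top P A t" for A t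
      using that pi3 fo[of t A] by (auto simp: is_top_def)
    show "is_meet (sub E) A (\<pi> \<phi>) (\<pi> \<psi>) (\<pi> \<chi>)" if h: "is_meet P A \<phi> \<psi> \<chi>" for A \<phi> \<psi> \<chi>
    proof -
      have "\<phi> \<in> fibre P A" "\<psi> \<in> fibre P A" using h by (auto simp: is_meet_def le_def)
      then show ?thesis using h pi3 fo by blast
    qed
    show "\<exists>n b t. is_bot (sub E) A b \<and> is_meet (sub E) A m n b \<and> is_top (sub E) A t \<and> is_join (sub E) A m n t"
      if h: "m \<in> fibre (sub E) A" for A m
      using assms(1) h Hom_Obj(2)[OF fibre_subD(2)[OF h]] unfolding boolean_topos_def by blast
    show "\<pi> \<phi> \<in> fibre (sub E) A" if "\<phi> \<in> fibre P A" for A \<phi>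
      using that pi1 fo by blast
    show "le (sub E) A (\<pi> \<phi>) m \<longleftrightarrow> le P A \<phi> (delta P m)" if "\<phi> \<in> fibre P A" "m \<in> fibre (sub E) A" for A \<phi> m
      using that pi1 fo by blast
    show "fib_iso (sub E) A (\<pi> (reindex P f \<phi>)) (reindex (sub E) f (\<pi> \<phi>))"
      if "f \<in> Hom E A B" "\<phi> \<in> fibre P B" for A B f \<phi>
      using that pi2 by blast
    show "has_exponentials E" "has_subobject_classifier E" using top by (simp_all add: topos_def)
  qed (rule assms(3))
  show ?thesis using closure_iso_neg_neg[OF assms(5)] .
qed

end
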